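(* For every integer $n\ge 0$, $$\mathrm{spt}_{\omega}(5n+3)\equiv 0\pmod 5.$$
   Context: For a positive integer $m$, $\mathrm{spt}_{\omega}(m)$ denotes the total number of appearances of the smallest part (counted with multiplicity), summed over all partitions of $m$ into positive parts in which every odd part is less than twice the smallest part. Equivalently, as power series, $$\sum_{m=1}^{\infty}\mathrm{spt}_{\omega}(m)q^m=\sum_{m=1}^{\infty}\frac{q^m}{(1-q^m)^2(q^{m+1};q)_m(q^{2m+2};q^2)_{\infty}},$$ where $(a;q)_k:=\prod_{j=0}^{k-1}(1-aq^j)$ and $(a;q)_\infty:=\prod_{j=0}^{\infty}(1-aq^j)$. *)

theory Defs
  imports "HOL-Number_Theory.Cong" "HOL-Library.Multiset"
begin

definition partitions :: "nat \<Rightarrow> nat multiset set" where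
  "partitions m = {P. 0 \<notin># P \<and> sum_mset P = m}"

definition spt_omega :: "nat \<Rightarrow> nat" where
  "spt_omega m =
     (\<Sum>P \<in> {P \<in> partitions m. \<forall>k \<in># P. odd k \<longrightarrow> k < 2 * Min (set_mset P)}.
        count P (Min (set_mset P)))"

text \<open>The set summed over is finite, so the sum is not degenerate.\<close>

lemma finite_partitions: "finite (partitions m)"
proof -
  have "size P \<le> sum_mset P" if "0 \<notin># P" for P :: "nat multiset"
    using that by (induction P) auto
  moreover have "k \<le> sum_mset P" if "k \<in># P" for k and P :: "nat multiset"
    using that by (induction P) auto
  ultimately have bounds: "set_mset P \<subseteq> {..m} \<and> size P \<le> m" if "P \<in> partitions m" for P
    using that unfolding partitions_def by fastforce
  have "partitions m \<subseteq> mset ` {xs. set xs \<subseteq> {..m} \<and> length xs \<le> m}"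
  proof
    fix P assume P: "P \<in> partitions m"
    obtain xs where "P = mset xs" by (metis ex_mset)
    with bounds[OF P] show "P \<in> mset ` {xs. set xs \<subseteq> {..m} \<and> length xs \<le> m}" by auto
  qed
  moreover have "finite {xs. set xs \<subseteq> {..m} \<and> length xs \<le> m}"
    by (rule finite_lists_length_le) simp
  ultimately show ?thesis
    by (meson finite_imageI finite_subset)
qed

end

theory Submission
  imports Defs "HOL-Computational_Algebra.Formal_Laurent_Series" "Berlekamp_Zassenhaus.Finite_Field"
begin

text \<open>Write \<open>f\<^sub>d = (q\<^sup>d; q\<^sup>d)\<^sub>\<infinity>\<close>. Classifying partitions by the smallest part and applying the Bailey lemma
  gives \<open>f\<^sub>2 \<Sum> spt\<^sub>\<omega>(n) q\<^sup>n = S + M\<close>, where \<open>S = \<Sum> q\<^sup>n / (1 - q\<^sup>n)\<^sup>2\<close> and \<open>M\<close> is an Appell-Lerch sum in \<open>q\<^sup>2\<close>.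
  Over a field of characteristic \<open>5\<close> we have \<open>f\<^sub>d\<^sup>5 = f\<^sub>5\<^sub>d\<close>, so factors \<open>f\<^sup>5\<close> do not affect vanishing on a residue
  class of exponents. The identities of Jacobi for \<open>f\<^sub>1\<^sup>3\<close> and Gauss for \<open>f\<^sub>1\<^sup>2 / f\<^sub>2\<close> turn \<open>S / f\<^sub>2\<close> into a binary theta
  series without exponents \<open>5n + 3\<close>. In \<open>M\<close> we replace \<open>1 / (1 - x)\<^sup>2\<close> by \<open>(1 - x)\<^sup>3 / (1 - x\<^sup>5)\<close> and split
  by residue classes of the summation index. Partial fractions of reciprocal theta products, obtained as limits of
  Lagrange interpolation, relate the resulting Lambert series to each other, and the same
  expansions yield Ramanujan's dissection of \<open>f\<^sub>2\<close>. Multiplying \<open>M\<close> by \<open>f\<^sub>2\<^sup>4\<close>, everything on the class of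
  \<open>5n + 3\<close> cancels.\<close>

subsection \<open>Limits, sums and products of formal power series\<close>

text \<open>Why the cancellation happens: 1/f_2 = f_2^4 / f_2^5, so modulo 5 dividing by f_2 amounts
  to multiplying by f_2^4. The dissection makes f_2, up to factors living on a single class of
  exponents, a quadratic form in q^2 whose fourth power has only four classes modulo 5, since the
  middle coefficient is a multiple of 5. In M the new denominators are 1 - q^(10k), so the class of
  each Lambert term is determined by k modulo 5. Exactly four products of a class of f_2^4 with a
  class of M reach the critical class, and two Lambert relations with matching inhomogeneous terms
  make their sum vanish. The obstacle is that such relations are usually proved by residues of
  meromorphic functions. Here a theta product is replaced by a finite periodic set of integer nodes,
  for which interpolation is exact, and limits are taken coefficientwise. Negative powers of q
  appear before normalization, hence the detour through Laurent series. In the same spirit the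
  Bailey lemma and the three theta identities begin as finite identities proved by
  recurrences.\<close>

lemma fps_tendsto_iff_cutoff:
  fixes g :: "'a::group_add fps"
  shows "(f \<longlongrightarrow> g) F \<longleftrightarrow> (\<forall>n. \<forall>\<^sub>F x in F. \<forall>i\<le>n. f x $ i = g $ i)"
proof
  assume "(f \<longlongrightarrow> g) F"
  then have "\<forall>\<^sub>F x in F. \<forall>i\<in>{..n}. f x $ i = g $ i" for n
    by (subst eventually_ball_finite_distrib) (auto simp: tendsto_fps_iff)
  then show "\<forall>n. \<forall>\<^sub>F x in F. \<forall>i\<le>n. f x $ i = g $ i" by (simp add: Ball_def)
next
  assume *: "\<forall>n. \<forall>\<^sub>F x in F. \<forall>i\<le>n. f x $ i = g $ i"
  show "(f \<longlongrightarrow> g) F"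
    unfolding tendsto_fps_iff
  proof
    fix n show "\<forall>\<^sub>F x in F. f x $ n = g $ n"
      using *[rule_format, of n] by eventually_elim auto
  qed
qed

text \<open>Coefficient \<open>n\<close> of a product depends only on coefficients up to
  \<open>n\<close> of the factors, hence the cutoff form of convergence. Convergence means that each
  coefficient is eventually constant.\<close>

lemma fps_tendsto_mult:
  fixes g :: "'a::ring_1 fps"
  assumes "(f \<longlongrightarrow> g) F" "(f' \<longlongrightarrow> g') F"
  shows "((\<lambda>x. f x * f' x) \<longlongrightarrow> g * g') F"
  unfolding tendsto_fps_iff
proof
  fix n
  have "\<forall>\<^sub>F x in F. \<forall>i\<le>n. f x $ i = g $ i" "\<forall>\<^sub>F x in F. \<forall>i\<le>n. f' x $ i = g' $ i"
    using assms by (simp_all add: fps_tendsto_iff_cutoff)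
  then show "\<forall>\<^sub>F x in F. (f x * f' x) $ n = (g * g') $ n"
    by eventually_elim (auto simp: fps_mult_nth intro!: sum.cong)
qed

lemma fps_tendsto_add:
  fixes g :: "'a::ab_group_add fps"
  assumes "(f \<longlongrightarrow> g) F" "(f' \<longlongrightarrow> g') F"
  shows "((\<lambda>x. f x + f' x) \<longlongrightarrow> g + g') F"
  unfolding tendsto_fps_iff
proof
  fix n
  have "\<forall>\<^sub>F x in F. f x $ n = g $ n" "\<forall>\<^sub>F x in F. f' x $ n = g' $ n"
    using assms by (simp_all add: tendsto_fps_iff)
  then show "\<forall>\<^sub>F x in F. (f x + f' x) $ n = (g + g') $ n"
    by eventually_elim auto
qed

lemma fps_tendsto_inverse:
  fixes g :: "'a::field fps"
  assumes "(f \<longlongrightarrow> g) F" and g: "g $ 0 \<noteq> 0"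
  shows "((\<lambda>x. inverse (f x)) \<longlongrightarrow> inverse g) F"
  unfolding tendsto_fps_iff
proof
  fix n
  have "\<forall>\<^sub>F x in F. \<forall>i\<le>n. f x $ i = g $ i"
    using assms by (simp add: fps_tendsto_iff_cutoff)
  then show "\<forall>\<^sub>F x in F. inverse (f x) $ n = inverse g $ n"
  proof eventually_elim
    case (elim x)
    have "inverse g * g = 1" "inverse (f x) * f x = 1"
      using g elim by (auto intro!: inverse_mult_eq_1)
    \<comment> \<open>The difference of the inverses is a multiple of \<open>f x - g\<close>, which
      has no coefficients up to \<open>n\<close>.\<close>
    then have "inverse g - inverse (f x) = inverse g * inverse (f x) * (f x - g)"
      by (smt (verit) left_diff_distrib right_diff_distrib mult.assoc mult.commute mult_1)
    also have "\<dots> $ n = 0"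
      using elim by (subst fps_mult_nth) (auto intro!: sum.neutral)
    finally show ?case by simp
  qed
qed

lemma fps_tendsto_deriv:
  fixes g :: "'a::{ring_1} fps"
  assumes "(f \<longlongrightarrow> g) F"
  shows "((\<lambda>x. fps_deriv (f x)) \<longlongrightarrow> fps_deriv g) F"
  unfolding tendsto_fps_iff
proof
  fix n
  have "\<forall>\<^sub>F x in F. f x $ Suc n = g $ Suc n" using assms by (simp add: tendsto_fps_iff)
  then show "\<forall>\<^sub>F x in F. fps_deriv (f x) $ n = fps_deriv g $ n"
    by eventually_elim simp
qed

section \<open>Formal sums and products over arbitrary index sets\<close>

definition fps_summable :: "('i \<Rightarrow> 'a::comm_monoid_add fps) \<Rightarrow> 'i set \<Rightarrow> bool" where
  "fps_summable t A \<longleftrightarrow> (\<forall>n. finite {k\<in>A. t k $ n \<noteq> 0})"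

text \<open>Each coefficient is a finite sum, so the index set carries no order; bilateral sums,
  splitting into residue classes and reindexing need no convergence argument. A coefficient with
  infinitely many contributions gets the default value 0, so the algebraic rules ask for
  \<open>fps_summable\<close>.\<close>

definition fps_infsum :: "('i \<Rightarrow> 'a::comm_monoid_add fps) \<Rightarrow> 'i set \<Rightarrow> 'a fps" where
  "fps_infsum t A = Abs_fps (\<lambda>n. \<Sum>k\<in>{k\<in>A. t k $ n \<noteq> 0}. t k $ n)"

lemma fps_infsum_nth:
  assumes "finite B" "B \<subseteq> A" "\<And>k. k \<in> A \<Longrightarrow> k \<notin> B \<Longrightarrow> t k $ n = 0"
  shows "fps_infsum t A $ n = (\<Sum>k\<in>B. t k $ n)"
  unfolding fps_infsum_def fps_nth_Abs_fps by (rule sum.mono_neutral_left) (use assms in auto)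

lemma fps_infsum_cong:
  assumes "\<And>k. k \<in> A \<Longrightarrow> t k = t' k"
  shows "fps_infsum t A = fps_infsum t' A"
  unfolding fps_infsum_def by (rule arg_cong[of _ _ Abs_fps], rule ext, rule sum.cong) (use assms in auto)

lemma fps_summable_subset: "fps_summable t A \<Longrightarrow> B \<subseteq> A \<Longrightarrow> fps_summable t B"
  unfolding fps_summable_def
proof
  fix n
  assume *: "\<forall>n. finite {k\<in>A. t k $ n \<noteq> 0}" and "B \<subseteq> A"
  show "finite {k\<in>B. t k $ n \<noteq> 0}"
    by (rule finite_subset[OF _ *[rule_format, of n]]) (use \<open>B \<subseteq> A\<close> in auto)
qed

lemma fps_summable_common:
  assumes "fps_summable t A"
  shows "finite {k\<in>A. \<exists>i\<le>n. t k $ i \<noteq> 0}"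
proof -
  have "{k\<in>A. \<exists>i\<le>n. t k $ i \<noteq> 0} = (\<Union>i\<le>n. {k\<in>A. t k $ i \<noteq> 0})" by auto
  then show ?thesis using assms by (simp add: fps_summable_def)
qed

lemma fps_summable_mult_left:
  fixes c :: "'a::ring_1 fps"
  assumes "fps_summable t A"
  shows "fps_summable (\<lambda>k. c * t k) A"
  unfolding fps_summable_def
proof
  fix n
  have "{k\<in>A. (c * t k) $ n \<noteq> 0} \<subseteq> {k\<in>A. \<exists>i\<le>n. t k $ i \<noteq> 0}"
  proof safe
    fix k assume "(c * t k) $ n \<noteq> 0"
    then obtain i where "i \<in> {0..n}" "c $ i * t k $ (n - i) \<noteq> 0"
      unfolding fps_mult_nth by (rule sum.not_neutral_contains_not_neutral)
    then show "\<exists>i\<le>n. t k $ i \<noteq> 0" by (intro exI[of _ "n - i"]) auto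
  qed
  then show "finite {k\<in>A. (c * t k) $ n \<noteq> 0}"
    using fps_summable_common[OF assms] finite_subset by blast
qed

lemma fps_infsum_mult_left:
  fixes c :: "'a::ring_1 fps"
  assumes "fps_summable t A"
  shows "c * fps_infsum t A = fps_infsum (\<lambda>k. c * t k) A"
proof (rule fps_ext)
  fix n
  define B where "B = {k\<in>A. \<exists>i\<le>n. t k $ i \<noteq> 0}"
  have B: "finite B" "B \<subseteq> A" using fps_summable_common[OF assms] by (auto simp: B_def)
  have "(c * fps_infsum t A) $ n = (\<Sum>i=0..n. c $ i * (\<Sum>k\<in>B. t k $ (n - i)))"
    unfolding fps_mult_nth
    by (rule sum.cong, simp, subst fps_infsum_nth[OF B]) (auto simp: B_def)
  also have "\<dots> = (\<Sum>k\<in>B. (c * t k) $ n)"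
    unfolding fps_mult_nth sum_distrib_left by (rule sum.swap)
  also have "\<dots> = fps_infsum (\<lambda>k. c * t k) A $ n"
    by (rule fps_infsum_nth[OF B, symmetric]) (auto simp: B_def fps_mult_nth intro!: sum.neutral)
  finally show "(c * fps_infsum t A) $ n = fps_infsum (\<lambda>k. c * t k) A $ n" .
qed

lemma fps_infsum_add:
  fixes t :: "_ \<Rightarrow> 'a::ab_group_add fps"
  assumes "fps_summable t A" "fps_summable t' A"
  shows "fps_infsum (\<lambda>k. t k + t' k) A = fps_infsum t A + fps_infsum t' A"
proof (rule fps_ext)
  fix n
  define B where "B = {k\<in>A. t k $ n \<noteq> 0} \<union> {k\<in>A. t' k $ n \<noteq> 0}"
  have B: "finite B" "B \<subseteq> A" using assms by (auto simp: B_def fps_summable_def)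
  have t: "t k $ n = 0" and t': "t' k $ n = 0" if "k \<in> A" "k \<notin> B" for k
    using that by (auto simp: B_def)
  show "fps_infsum (\<lambda>k. t k + t' k) A $ n = (fps_infsum t A + fps_infsum t' A) $ n"
    using fps_infsum_nth[OF B, of t n] fps_infsum_nth[OF B, of t' n]
      fps_infsum_nth[OF B, of "\<lambda>k. t k + t' k" n]
    by (simp add: t t' sum.distrib)
qed

lemma fps_summable_add:
  fixes t :: "_ \<Rightarrow> 'a::ab_group_add fps"
  assumes "fps_summable t A" "fps_summable t' A"
  shows "fps_summable (\<lambda>k. t k + t' k) A"
  unfolding fps_summable_def
proof
  fix n
  have "{k\<in>A. (t k + t' k) $ n \<noteq> 0} \<subseteq> {k\<in>A. t k $ n \<noteq> 0} \<union> {k\<in>A. t' k $ n \<noteq> 0}" by auto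
  then show "finite {k\<in>A. (t k + t' k) $ n \<noteq> 0}"
    by (rule finite_subset) (use assms in \<open>auto simp only: fps_summable_def finite_Un\<close>)
qed

lemma fps_infsum_Un:
  fixes t :: "_ \<Rightarrow> 'a::ab_group_add fps"
  assumes "fps_summable t (A \<union> B)" "A \<inter> B = {}"
  shows "fps_infsum t (A \<union> B) = fps_infsum t A + fps_infsum t B"
proof (rule fps_ext)
  fix n
  have f: "finite {k\<in>A. t k $ n \<noteq> 0}" "finite {k\<in>B. t k $ n \<noteq> 0}"
    using fps_summable_subset[OF assms(1), of A] fps_summable_subset[OF assms(1), of B]
    by (auto simp only: fps_summable_def)
  have "{k\<in>A\<union>B. t k $ n \<noteq> 0} = {k\<in>A. t k $ n \<noteq> 0} \<union> {k\<in>B. t k $ n \<noteq> 0}" by auto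
  then show "fps_infsum t (A \<union> B) $ n = (fps_infsum t A + fps_infsum t B) $ n"
    using sum.union_disjoint[OF f, of "\<lambda>k. t k $ n"] assms(2)
    by (simp add: fps_infsum_def disjoint_iff)
qed

lemma fps_infsum_reindex:
  assumes "bij_betw h A B"
  shows "fps_infsum t B = fps_infsum (\<lambda>k. t (h k)) A"
proof (rule fps_ext)
  fix n
  have "bij_betw h {k\<in>A. t (h k) $ n \<noteq> 0} {k\<in>B. t k $ n \<noteq> 0}"
    using assms unfolding bij_betw_def by (auto simp: inj_on_def)
  from sum.reindex_bij_betw[OF this, of "\<lambda>k. t k $ n"]
  show "fps_infsum t B $ n = fps_infsum (\<lambda>k. t (h k)) A $ n"
    by (simp add: fps_infsum_def)
qed

text \<open>Tannery's theorem for formal series. Assumption \<open>dom\<close> is the domination: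
  for each coefficient, one finite set of indices contains all contributions of all stages.
  Eventually \<open>W N\<close> contains this set and its terms have stabilised.\<close>

lemma fps_infsum_tendsto:
  fixes T :: "nat \<Rightarrow> 'i \<Rightarrow> 'a::ring_1 fps"
  assumes lim: "\<And>k. k \<in> A \<Longrightarrow> (\<lambda>N. T N k) \<longlonglongrightarrow> t k"
    and dom: "\<And>n. finite {k\<in>A. \<exists>N. k \<in> W N \<and> T N k $ n \<noteq> 0}"
    and W: "\<And>N. finite (W N)" "\<And>N. W N \<subseteq> A" "\<And>k. k \<in> A \<Longrightarrow> \<forall>\<^sub>F N in sequentially. k \<in> W N"
  shows "fps_summable t A" and "(\<lambda>N. \<Sum>k\<in>W N. T N k) \<longlonglongrightarrow> fps_infsum t A"
proof -
  have nz: "\<exists>N. k \<in> W N \<and> T N k $ n \<noteq> 0" if "k \<in> A" "t k $ n \<noteq> 0" for k n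
  proof -
    have "\<forall>\<^sub>F N in sequentially. T N k $ n = t k $ n \<and> k \<in> W N"
      using lim[OF that(1)] W(3)[OF that(1)] by (auto simp: tendsto_fps_iff eventually_conj_iff)
    then obtain N where "T N k $ n = t k $ n" "k \<in> W N" by (auto simp: eventually_sequentially)
    then show ?thesis using that by auto
  qed
  then have sub: "{k\<in>A. t k $ n \<noteq> 0} \<subseteq> {k\<in>A. \<exists>N. k \<in> W N \<and> T N k $ n \<noteq> 0}" for n
    by blast
  then show "fps_summable t A"
    unfolding fps_summable_def using dom finite_subset by blast
  show "(\<lambda>N. \<Sum>k\<in>W N. T N k) \<longlonglongrightarrow> fps_infsum t A"
    unfolding tendsto_fps_iff
  proof
    fix n
    define B where "B = {k\<in>A. \<exists>N. k \<in> W N \<and> T N k $ n \<noteq> 0}"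
    have B: "finite B" "B \<subseteq> A" using dom by (auto simp: B_def)
    have "\<forall>\<^sub>F N in sequentially. \<forall>k\<in>B. T N k $ n = t k $ n \<and> k \<in> W N"
      using B lim W(3)
      by (subst eventually_ball_finite_distrib) (auto simp: tendsto_fps_iff eventually_conj_iff)
    then show "\<forall>\<^sub>F N in sequentially. (\<Sum>k\<in>W N. T N k) $ n = fps_infsum t A $ n"
    proof eventually_elim
      case (elim N)
      have "(\<Sum>k\<in>W N. T N k) $ n = (\<Sum>k\<in>B. t k $ n)"
        unfolding fps_sum_nth by (rule sum.mono_neutral_cong) (use elim B W in \<open>auto simp: B_def\<close>)
      also have "\<dots> = fps_infsum t A $ n"
        by (rule fps_infsum_nth[OF B, symmetric]) (use sub[of n] in \<open>auto simp only: B_def\<close>)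
      finally show ?case .
    qed
  qed
qed

text \<open>An element \<open>0\<close> of the set is ignored.\<close>

definition qprod :: "nat set \<Rightarrow> 'a::comm_ring_1 fps" where
  "qprod A = Abs_fps (\<lambda>n. (\<Prod>k\<in>A \<inter> {1..n}. 1 - fps_X ^ k) $ n)"

lemma fps_mult_one_minus_X_power_nth:
  fixes f :: "'a::comm_ring_1 fps"
  shows "n < k \<Longrightarrow> (f * (1 - fps_X ^ k)) $ n = f $ n"
  by (simp add: algebra_simps fps_X_power_mult_right_nth)

lemma prod_one_minus_X_power_nth:
  fixes B C :: "nat set"
  assumes "finite C" "B \<subseteq> C" "\<And>k. k \<in> C - B \<Longrightarrow> n < k"
  shows "(\<Prod>k\<in>C. 1 - fps_X ^ k :: 'a::comm_ring_1 fps) $ n = (\<Prod>k\<in>B. 1 - fps_X ^ k) $ n"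
proof -
  have "(g * (\<Prod>k\<in>D. 1 - fps_X ^ k :: 'a fps)) $ n = g $ n" if "finite D" "\<And>k. k \<in> D \<Longrightarrow> n < k" for D g
    using that
  proof (induction D)
    case (insert k D)
    have "(g * (\<Prod>k\<in>insert k D. 1 - fps_X ^ k)) $ n = (g * (\<Prod>k\<in>D. 1 - fps_X ^ k) * (1 - fps_X ^ k)) $ n"
      using insert by (simp add: mult_ac)
    also have "\<dots> = g $ n" using insert fps_mult_one_minus_X_power_nth by (metis insertCI)
    finally show ?case .
  qed simp
  from this[of "C - B" "\<Prod>k\<in>B. 1 - fps_X ^ k"] show ?thesis
    using assms by (subst prod.subset_diff[OF assms(2,1)]) (simp add: mult.commute)
qed

lemma qprod_nth:
  assumes "finite B" "A \<inter> {1..n} \<subseteq> B" "B \<subseteq> A" "0 \<notin> B"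
  shows "qprod A $ n = (\<Prod>k\<in>B. 1 - fps_X ^ k) $ n"
proof -
  have "(\<Prod>k\<in>B. 1 - fps_X ^ k) $ n = (\<Prod>k\<in>A \<inter> {1..n}. 1 - fps_X ^ k :: 'a fps) $ n"
    by (rule prod_one_minus_X_power_nth) (use assms in \<open>auto simp: not_le Suc_le_eq\<close>)
  then show ?thesis by (simp add: qprod_def)
qed

lemma tendsto_qprod:
  assumes "\<And>N. finite (W N)" "\<And>N. W N \<subseteq> A" "\<And>N. 0 \<notin> W N"
    and "\<And>k. k \<in> A \<Longrightarrow> 0 < k \<Longrightarrow> \<forall>\<^sub>F N in F. k \<in> W N"
  shows "((\<lambda>N. \<Prod>k\<in>W N. 1 - fps_X ^ k) \<longlongrightarrow> (qprod A :: 'a::comm_ring_1 fps)) F"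
  unfolding tendsto_fps_iff
proof
  fix n
  have "\<forall>\<^sub>F N in F. \<forall>k\<in>A \<inter> {1..n}. k \<in> W N"
    by (subst eventually_ball_finite_distrib) (use assms in auto)
  then show "\<forall>\<^sub>F N in F. (\<Prod>k\<in>W N. 1 - fps_X ^ k) $ n = (qprod A :: 'a fps) $ n"
    by eventually_elim (rule qprod_nth[symmetric], use assms in auto)
qed

lemma qprod_nth_0 [simp]: "qprod A $ 0 = 1"
  by (simp add: qprod_def)

lemma qprod_nonzero [simp]: "qprod A \<noteq> 0"
  by (metis fps_zero_nth qprod_nth_0 zero_neq_one)

lemma qprod_Un:
  assumes "A \<inter> B \<subseteq> {0}"
  shows "qprod (A \<union> B) = qprod A * (qprod B :: 'a::comm_ring_1 fps)"
proof (rule LIMSEQ_unique)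
  let ?P = "\<lambda>A N. \<Prod>k\<in>A \<inter> {1..N}. 1 - fps_X ^ k :: 'a fps"
  have L: "?P A \<longlonglongrightarrow> qprod A" for A
    by (rule tendsto_qprod) (auto intro: eventually_ge_at_top)
  have "?P (A \<union> B) = (\<lambda>N. ?P A N * ?P B N)"
  proof
    fix N
    have "(A \<union> B) \<inter> {1..N} = (A \<inter> {1..N}) \<union> (B \<inter> {1..N})" by auto
    then show "?P (A \<union> B) N = ?P A N * ?P B N"
      by (simp only:, subst prod.union_disjoint) (use assms in auto)
  qed
  then show "?P (A \<union> B) \<longlonglongrightarrow> qprod A * qprod B"
    by (simp only:) (intro fps_tendsto_mult L)
qed (rule tendsto_qprod; auto intro: eventually_ge_at_top)

subsection \<open>Finite identities\<close>

definition qf :: "nat \<Rightarrow> 'a::field fps" where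
  "qf n = (\<Prod>i\<in>{1..n}. 1 - fps_X ^ i)"

definition qf_even :: "nat \<Rightarrow> 'a::field fps" where
  "qf_even n = (\<Prod>i\<in>{1..n}. 1 - fps_X ^ (2 * i))"

definition qf_odd :: "nat \<Rightarrow> 'a::field fps" where
  "qf_odd n = (\<Prod>i\<in>{1..n}. 1 - fps_X ^ (2 * i - 1))"

text \<open>The kernel of Bailey pairs relative to a = 1. The value 0 for \<open>r > n\<close> is
  the usual convention 1/(q)_j = 0 for negative j; it lets recurrences in \<open>n\<close> be summed
  over a common range of \<open>r\<close>.\<close>

definition iqf2 :: "nat \<Rightarrow> nat \<Rightarrow> 'a::field fps" where
  "iqf2 n r = (if r \<le> n then inverse (qf (n - r)) * inverse (qf (n + r)) else 0)"

lemma qf_0 [simp]: "qf 0 = 1" "qf_even 0 = 1" "qf_odd 0 = 1"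
  by (simp_all add: qf_def qf_even_def qf_odd_def)

lemma qf_Suc: "qf (Suc n) = qf n * (1 - fps_X ^ Suc n)"
  by (simp add: qf_def)

lemma qf_even_Suc: "qf_even (Suc n) = qf_even n * (1 - fps_X ^ (2 * n + 2))"
  by (simp add: qf_even_def)

lemma qf_odd_Suc: "qf_odd (Suc n) = qf_odd n * (1 - fps_X ^ (2 * n + 1))"
  by (simp add: qf_odd_def)

lemma prod_one_minus_X_nth_0:
  assumes "\<And>i. i \<in> A \<Longrightarrow> f i > 0"
  shows "(\<Prod>i\<in>A. 1 - fps_X ^ f i :: 'a::comm_ring_1 fps) $ 0 = 1"
  using assms by (induction A rule: infinite_finite_induct) (auto simp: fps_X_power_nth)

lemma qf_nth_0 [simp]: "qf n $ 0 = 1" "qf_even n $ 0 = 1" "qf_odd n $ 0 = 1"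
  unfolding qf_def qf_even_def qf_odd_def by (rule prod_one_minus_X_nth_0; simp)+

lemma inverse_qf [simp]: "inverse (qf n) * qf n = 1" "inverse (qf_even n) * qf_even n = 1"
    "inverse (qf_odd n) * qf_odd n = 1" "qf n * inverse (qf n) = 1"
  by (auto intro!: inverse_mult_eq_1 inverse_mult_eq_1')

lemma inverse_qf_Suc: "inverse (qf n) = (1 - fps_X ^ Suc n) * inverse (qf (Suc n))"
proof -
  have "inverse (qf n) = inverse (qf n) * (inverse (qf (Suc n)) * qf (Suc n) :: 'a fps)" by simp
  also have "\<dots> = (inverse (qf n) * qf n) * ((1 - fps_X ^ Suc n) * inverse (qf (Suc n)))"
    by (simp only: qf_Suc mult_ac)
  finally show ?thesis by simp
qed

lemma fps_X_power_nonzero: "n > 0 \<Longrightarrow> 1 - fps_X ^ n \<noteq> (0 :: 'a::field fps)"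
  by (metis diff_0_right fps_X_power_nth fps_nonzero_nth fps_one_nth fps_sub_nth less_numeral_extra(3) zero_neq_one)

lemma inverse_one_minus_X_power [simp]:
  "n > 0 \<Longrightarrow> inverse (1 - fps_X ^ n) * (1 - fps_X ^ n) = (1 :: 'a::field fps)"
  by (intro inverse_mult_eq_1) (simp add: fps_X_power_nth)

lemma iqf2_eq_0 [simp]: "r > n \<Longrightarrow> iqf2 n r = 0"
  by (simp add: iqf2_def)

lemma iqf2_Suc:
  assumes "r \<le> Suc n"
  shows "iqf2 n r = (1 - fps_X ^ (Suc n - r)) * (1 - fps_X ^ (Suc n + r)) * iqf2 (Suc n) r"
proof (cases "r = Suc n")
  case False
  then have "inverse (qf (n - r) :: 'a fps) = (1 - fps_X ^ (Suc n - r)) * inverse (qf (Suc n - r))"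
    using assms inverse_qf_Suc[of "n - r"] by (simp add: Suc_diff_le)
  moreover have "inverse (qf (n + r) :: 'a fps) = (1 - fps_X ^ (Suc n + r)) * inverse (qf (Suc n + r))"
    using inverse_qf_Suc[of "n + r"] by simp
  ultimately show ?thesis
    using assms False by (simp add: iqf2_def)
qed (simp add: iqf2_def)

text \<open>This is the \<open>q\<close>-Gauss sum with both parameters \<open>q\<^sup>r\<close>, whose partial sums happen to have a closed form.\<close>

lemma qGauss_partial_sum:
  assumes "r > 0"
  shows "(\<Sum>n\<in>{1..N}. fps_X ^ n * qf (n - 1) ^ 2 * iqf2 n r)
    = fps_X ^ r * inverse (1 - fps_X ^ r) ^ 2 * qf N ^ 2 * (iqf2 N r :: 'a::field fps)"
proof (induction N)
  case (Suc N)
  show ?case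
  proof (cases "r \<le> Suc N")
    case True
    define z where "z = (fps_X :: 'a fps) ^ (Suc N - r)"
    define R where "R = (fps_X :: 'a fps) ^ r"
    define E where "E = inverse (1 - R)"
    have E: "E * (1 - R) = 1" using assms by (simp add: E_def R_def)
    have z: "fps_X ^ Suc N = R * z" "fps_X ^ (Suc N + r) = R\<^sup>2 * z"
      using True by (auto simp: R_def z_def simp flip: power_add power_mult)
    have "(\<Sum>n\<in>{1..Suc N}. fps_X ^ n * qf (n - 1) ^ 2 * iqf2 n r)
      = R * E ^ 2 * qf N ^ 2 * iqf2 N r + R * z * qf N ^ 2 * iqf2 (Suc N) r"
      using Suc z(1) by (simp add: R_def E_def del: power_Suc)
    also have "\<dots> = qf N ^ 2 * iqf2 (Suc N) r * R * (E ^ 2 * (1 - z) * (1 - R\<^sup>2 * z) + z)"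
      unfolding iqf2_Suc[OF True] z z_def[symmetric] by (simp add: algebra_simps)
    \<comment> \<open>Since (1 - z)(1 - R^2 z) = (1 - R z)^2 - z (1 - R)^2, the new summand
      completes the square.\<close>
    also have "E ^ 2 * (1 - z) * (1 - R\<^sup>2 * z) + z = E ^ 2 * (1 - R * z) ^ 2 - z * (E * (1 - R)) ^ 2 + z"
      by (simp add: algebra_simps power2_eq_square)
    also have "\<dots> = E ^ 2 * (1 - R * z) ^ 2" by (simp add: E)
    also have "qf N ^ 2 * iqf2 (Suc N) r * R * \<dots> = R * E ^ 2 * qf (Suc N) ^ 2 * iqf2 (Suc N) r"
      by (simp add: qf_Suc z power_mult_distrib mult_ac del: power_Suc)
    finally show ?thesis by (simp add: R_def E_def)
  qed (use Suc in simp)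
qed (use assms in simp)

text \<open>The terms of a Bailey pair of Slater relative to a = 1: alpha vanishes at odd indices,
  alpha_(2k) = (-1)^k q^(3k^2) (q^k + q^(-k)), and beta_n is 1/((q;q)_n (q;q^2)_n).\<close>

definition bailey_term :: "nat \<Rightarrow> nat \<Rightarrow> 'a::field fps" where
  "bailey_term n k = (-1) ^ k * (fps_X ^ (k * (3 * k + 1)) + fps_X ^ (k * (3 * k - 1))) * iqf2 n (2 * k)"

text \<open>A \<open>q\<close>-Zeilberger certificate: it makes the recurrence of \<open>bailey_term\<close> in \<open>n\<close> telescope over \<open>k\<close>.\<close>

definition bailey_cert :: "nat \<Rightarrow> nat \<Rightarrow> 'a::field fps" where
  "bailey_cert n k = - ((-1) ^ k * fps_X ^ (3 * (k * (k - 1)) + n + 1) *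
     (if 2 * k \<le> n + 1 then inverse (qf (n + 1 - 2 * k)) * inverse (qf (n + 2 * k - 1)) else 0))"

lemma bailey_cert:
  assumes "k > 0"
  shows "(1 - fps_X ^ (n + 1)) * (1 - fps_X ^ (2 * n + 1)) * bailey_term (n + 1) k - bailey_term n k
    = bailey_cert n (k + 1) - (bailey_cert n k :: 'a::field fps)"
proof (cases "2 * k \<le> n + 1")
  case True
  obtain l where k: "k = Suc l" using assms by (cases k) auto
  define j where "j = n + 1 - 2 * k"
  have n: "n + 1 = 2 * k + j" using True by (simp add: j_def)
  define p where "p = (fps_X :: 'a fps) ^ (3 * (k * (k - 1)))"
  define y where "y = (fps_X :: 'a fps) ^ k"
  define I where "I = inverse (qf j :: 'a fps)"
  define J where "J = inverse (qf (n + 1 + 2 * k) :: 'a fps)"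
  define e where "e = (-1 :: 'a fps) ^ k"
  have pw: "fps_X ^ (k * (3 * k + 1)) = p * y ^ 4" "fps_X ^ (k * (3 * k - 1)) = p * y ^ 2"
    "fps_X ^ (3 * ((k + 1) * (k + 1 - 1))) = p * y ^ 6"
    by (simp_all add: k p_def y_def algebra_simps flip: power_add power_mult)
  have J1: "inverse (qf (n + 2 * k)) = (1 - fps_X ^ (n + 2 * k + 1)) * J"
    using inverse_qf_Suc[of "n + 2 * k"] by (simp add: J_def)
  have J2: "inverse (qf (n + 2 * k - 1)) = (1 - fps_X ^ (n + 2 * k)) * (1 - fps_X ^ (n + 2 * k + 1)) * J"
    using inverse_qf_Suc[of "n + 2 * k - 1"] k unfolding mult.assoc J1[symmetric] by simp
  have IJ: "iqf2 (n + 1) (2 * k) = I * J"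
    using True by (simp add: iqf2_def I_def J_def j_def)
  have t1: "bailey_term (n + 1) k = e * (p * y ^ 4 + p * y ^ 2) * (I * J)"
    unfolding bailey_term_def pw IJ by (simp add: e_def)
  have t0: "bailey_term n k = e * (p * y ^ 4 + p * y ^ 2) * ((1 - fps_X ^ j) * (1 - fps_X ^ (n + 2 * k + 1)) * (I * J))"
    using IJ unfolding bailey_term_def pw iqf2_Suc[OF True[unfolded Suc_eq_plus1[symmetric]]]
    by (simp add: e_def j_def)
  have g0: "bailey_cert n k = - (e * p * fps_X ^ (n + 1) * (I * ((1 - fps_X ^ (n + 2 * k)) * (1 - fps_X ^ (n + 2 * k + 1)) * J)))"
    using True unfolding bailey_cert_def J2 by (simp add: e_def p_def I_def j_def power_add mult_ac)
  show ?thesis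
  proof (cases j)
    case 0
    have ex: "n + 1 = 2 * k" "n + 2 * k + 1 = 4 * k" "n + 2 * k = 2 * n + 1" using n 0 by auto
    have pw1: "fps_X ^ (n + 1) = y ^ 2"
      by (simp only: ex(1) y_def power_mult[symmetric] mult.commute[of k])
    have pw2: "fps_X ^ (n + 2 * k + 1) = y ^ 4"
      by (simp only: ex(2) y_def power_mult[symmetric] mult.commute[of k])
    have g1: "bailey_cert n (k + 1) = 0" using n 0 by (simp add: bailey_cert_def)
    show ?thesis
      unfolding t1 t0 g0 g1 pw1 pw2 0 unfolding ex(3) by (simp add: algebra_simps power_numeral_reduce)
  next
    case (Suc i)
    define z where "z = (fps_X :: 'a fps) ^ i"
    have pw': "fps_X ^ (n + 1) = y ^ 2 * z * fps_X" "fps_X ^ (n + 2 * k + 1) = y ^ 4 * z * fps_X"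
       "fps_X ^ (n + 2 * k) = y ^ 4 * z" "fps_X ^ (2 * n + 1) = y ^ 4 * z ^ 2 * fps_X" "fps_X ^ j = z * fps_X"
      using n Suc by (simp_all add: y_def z_def algebra_simps flip: power_add power_mult power_Suc power_Suc2)
    \<comment> \<open>For \<open>i = 0\<close> the certificate is 0 by its range condition; the
      formula agrees because then \<open>1 - z\<close> is 0.\<close>
    have g1: "bailey_cert n (k + 1) = e * p * y ^ 6 * fps_X ^ (n + 1) * ((1 - z) * (1 - fps_X ^ j) * (I * J))"
    proof (cases i)
      case 0
      then show ?thesis using n Suc by (simp add: bailey_cert_def z_def)
    next
      case (Suc h)
      have "inverse (qf i) = (1 - fps_X ^ j) * I"
        using inverse_qf_Suc[of i, where ?'a = 'a] \<open>j = Suc i\<close> by (simp add: I_def)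
      then have "inverse (qf h) = (1 - fps_X ^ i) * (1 - fps_X ^ j) * I"
        using inverse_qf_Suc[of h, where ?'a = 'a] Suc by simp
      moreover have "n + 1 - 2 * (k + 1) = h" "2 * (k + 1) \<le> n + 1" "n + 2 * (k + 1) - 1 = n + 1 + 2 * k"
        using n Suc \<open>j = Suc i\<close> by auto
      moreover have "fps_X ^ (3 * ((k + 1) * (k + 1 - 1)) + n + 1) = p * y ^ 6 * fps_X ^ (n + 1)"
        by (simp only: add.assoc power_add[of _ _ "n + 1"] pw)
      ultimately show ?thesis
        unfolding bailey_cert_def by (simp add: e_def z_def J_def mult_ac)
    qed
    show ?thesis
      unfolding t1 t0 g0 g1 pw' by (simp add: algebra_simps power_numeral_reduce)
  qed
next
  case False
  then show ?thesis by (simp add: bailey_term_def bailey_cert_def)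
qed

text \<open>Summing the certificate over \<open>k\<close> leaves only its value at
  \<open>k = 1\<close>, which cancels what the term \<open>iqf2 n 0\<close> contributes to the
  recurrence. Hence both sides satisfy the same first-order recurrence in \<open>n\<close>.\<close>

lemma bailey_pair:
  "iqf2 n 0 + (\<Sum>k\<in>{1..n}. bailey_term n k) = inverse (qf n * qf_odd n :: 'a::field fps)"
proof -
  define a where "a n = iqf2 n 0 + (\<Sum>k\<in>{1..n}. bailey_term n k :: 'a fps)" for n
  have step: "(1 - fps_X ^ (n + 1)) * (1 - fps_X ^ (2 * n + 1)) * a (n + 1) = a n" for n
  proof -
    define I where "I = inverse (qf (n + 1) :: 'a fps)"
    have J: "inverse (qf n) = (1 - fps_X ^ (n + 1)) * I"
      using inverse_qf_Suc[of n] by (simp add: I_def)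
    have g1: "bailey_cert n 1 = fps_X ^ (n + 1) * ((1 - fps_X ^ n) * (1 - fps_X ^ (n + 1)) * I * I)"
    proof (cases n)
      case (Suc m)
      then have "inverse (qf m) = (1 - fps_X ^ n) * ((1 - fps_X ^ (n + 1)) * I)"
        using inverse_qf_Suc[of m] unfolding J[symmetric] by simp
      then show ?thesis using Suc by (simp add: bailey_cert_def I_def mult_ac)
    qed (simp add: bailey_cert_def)
    let ?c = "(1 - fps_X ^ (n + 1)) * (1 - fps_X ^ (2 * n + 1)) :: 'a fps"
    have a: "a n = iqf2 n 0 + (\<Sum>k\<in>{1..n+1}. bailey_term n k)"
      by (simp add: a_def bailey_term_def)
    have rearr: "c * (x + s) - (x' + s') = (c * x - x') + (c * s - s')" for c x x' s s' :: "'a fps"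
      by (simp add: algebra_simps)
    have "?c * a (n + 1) - a n = (?c * iqf2 (n + 1) 0 - iqf2 n 0)
        + (\<Sum>k\<in>{1..n+1}. ?c * bailey_term (n + 1) k - bailey_term n k)"
      unfolding a unfolding a_def by (simp only: sum_subtractf sum_distrib_left[symmetric] rearr)
    also have "(\<Sum>k\<in>{1..n+1}. ?c * bailey_term (n + 1) k - bailey_term n k)
        = (\<Sum>k\<in>{1..n+1}. bailey_cert n (k + 1) - bailey_cert n k)"
      by (rule sum.cong[OF refl], rule bailey_cert) simp
    also have "\<dots> = bailey_cert n (n + 2) - bailey_cert n 1"
      using sum_Suc_diff[of 1 "n + 1" "bailey_cert n"] by simp
    also have "bailey_cert n (n + 2) = 0" by (simp add: bailey_cert_def)
    also have "iqf2 (n + 1) 0 = I * I" by (simp add: iqf2_def I_def)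
    also have "iqf2 n 0 = (1 - fps_X ^ (n + 1)) * I * ((1 - fps_X ^ (n + 1)) * I)"
      by (simp add: iqf2_def J)
    also have "(fps_X :: 'a fps) ^ (2 * n + 1) = fps_X ^ n * fps_X ^ (n + 1)"
      by (simp flip: power_add add: mult_2)
    finally show ?thesis unfolding g1 by (simp add: algebra_simps power_add mult_2_right)
  qed
  have "qf n * qf_odd n * a n = 1"
  proof (induction n)
    case (Suc n)
    have "qf (Suc n) * qf_odd (Suc n) * a (Suc n)
      = qf n * qf_odd n * ((1 - fps_X ^ (n + 1)) * (1 - fps_X ^ (2 * n + 1)) * a (n + 1))"
      by (simp add: qf_Suc qf_odd_Suc mult_ac)
    then show ?case using Suc unfolding step by simp
  qed (simp add: a_def iqf2_def)
  then show ?thesis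
    unfolding a_def[symmetric] by (metis fps_inverse_unique mult.commute)
qed

text \<open>A finite form of Gauss's identity, with \<open>k\<close> and \<open>- k\<close> merged
  into the factor 2. The method is that of \<open>bailey_pair\<close>: \<open>G\<close> is a
  certificate for the recurrence (1 - q^(2n+2)) a(n+1) = a(n), and its boundary value
  \<open>G n 1\<close> is absorbed by the term at 0.\<close>

lemma gauss_finite:
  "iqf2 n 0 + (\<Sum>k\<in>{1..n}. 2 * (-1) ^ k * fps_X ^ (k * k) * iqf2 n k)
    = inverse (qf_even n :: 'a::field fps)"
proof -
  define G :: "nat \<Rightarrow> nat \<Rightarrow> 'a fps" where "G n k = - (2 * (-1) ^ k * fps_X ^ (k * (k - 1) + n + 1) *
     (if k \<le> n + 1 then inverse (qf (n + 1 - k)) * inverse (qf (n + k)) else 0))" for n k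
  define t :: "nat \<Rightarrow> nat \<Rightarrow> 'a fps" where "t n k = 2 * (-1) ^ k * fps_X ^ (k * k) * iqf2 n k" for n k
  have cert: "(1 - fps_X ^ (2 * n + 2)) * t (n + 1) k - t n k = G n (k + 1) - G n k" if "k > 0" for n k
  proof (cases "k \<le> n + 1")
    case True
    obtain l where k: "k = Suc l" using \<open>k > 0\<close> by (cases k) auto
    define j where "j = n + 1 - k"
    have n: "n + 1 = k + j" using True by (simp add: j_def)
    define p where "p = (fps_X :: 'a fps) ^ (k * (k - 1))"
    define y where "y = (fps_X :: 'a fps) ^ k"
    define z where "z = (fps_X :: 'a fps) ^ j"
    define I where "I = inverse (qf j :: 'a fps)"
    define J where "J = inverse (qf (n + 1 + k) :: 'a fps)"
    define e where "e = 2 * (-1 :: 'a fps) ^ k"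
    have pw: "fps_X ^ (k * k) = p * y" "fps_X ^ ((k + 1) * (k + 1 - 1)) = p * y ^ 2"
      "fps_X ^ (n + 1) = y * z" "fps_X ^ (2 * n + 2) = y ^ 2 * z ^ 2" "fps_X ^ (n + 1 + k) = y ^ 2 * z"
      using n by (simp_all add: k p_def y_def z_def algebra_simps flip: power_add power_mult)
    have J1: "inverse (qf (n + k)) = (1 - y ^ 2 * z) * J"
      using inverse_qf_Suc[of "n + k", where ?'a = 'a] pw(5) by (simp add: J_def del: power_Suc)
    have IJ: "iqf2 (n + 1) k = I * J"
      using True by (simp add: iqf2_def I_def J_def j_def)
    have t1: "t (n + 1) k = e * (p * y) * (I * J)"
      unfolding t_def pw IJ by (simp add: e_def)
    have t0: "t n k = e * (p * y) * ((1 - z) * (1 - y ^ 2 * z) * (I * J))"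
      using IJ unfolding t_def pw iqf2_Suc[OF True[unfolded Suc_eq_plus1[symmetric]]] Suc_eq_plus1 pw
      by (simp add: e_def j_def z_def)
    have g0: "G n k = - (e * p * (y * z) * (I * ((1 - y ^ 2 * z) * J)))"
      using True unfolding G_def J1 add.assoc power_add[of _ _ "n + 1"] pw by (simp add: e_def p_def I_def j_def mult_ac)
    have g1: "G n (k + 1) = e * p * y ^ 2 * (y * z) * ((1 - z) * (I * J))"
    proof (cases j)
      case 0
      then show ?thesis using n by (simp add: G_def z_def)
    next
      case (Suc h)
      have "inverse (qf h) = (1 - z) * I"
        using inverse_qf_Suc[of h] Suc by (simp add: I_def z_def mult_ac)
      moreover have "n + 1 - (k + 1) = h" "k + 1 \<le> n + 1" "n + (k + 1) = n + 1 + k"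
        using n Suc by auto
      ultimately show ?thesis
        unfolding G_def add.assoc[of _ n 1] power_add[of _ _ "n + 1"] pw by (simp add: e_def J_def mult_ac)
    qed
    show ?thesis
      unfolding t1 t0 g0 g1 pw by (simp add: algebra_simps power_numeral_reduce)
  next
    case False
    then show ?thesis by (simp add: t_def G_def)
  qed
  define a where "a n = iqf2 n 0 + (\<Sum>k\<in>{1..n}. t n k :: 'a fps)" for n
  have step: "(1 - fps_X ^ (2 * n + 2)) * a (n + 1) = a n" for n
  proof -
    define I where "I = inverse (qf (n + 1) :: 'a fps)"
    have J: "inverse (qf n) = (1 - fps_X ^ (n + 1)) * I"
      using inverse_qf_Suc[of n] by (simp add: I_def)
    have g1: "G n 1 = 2 * fps_X ^ (n + 1) * ((1 - fps_X ^ (n + 1)) * I * I)"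
      using J by (simp add: G_def I_def mult_ac)
    let ?c = "(1 - fps_X ^ (2 * n + 2)) :: 'a fps"
    have a: "a n = iqf2 n 0 + (\<Sum>k\<in>{1..n+1}. t n k)"
      by (simp add: a_def t_def)
    have rearr: "c * (x + s) - (x' + s') = (c * x - x') + (c * s - s')" for c x x' s s' :: "'a fps"
      by (simp add: algebra_simps)
    have "?c * a (n + 1) - a n = (?c * iqf2 (n + 1) 0 - iqf2 n 0)
        + (\<Sum>k\<in>{1..n+1}. ?c * t (n + 1) k - t n k)"
      unfolding a unfolding a_def by (simp only: sum_subtractf sum_distrib_left[symmetric] rearr)
    also have "(\<Sum>k\<in>{1..n+1}. ?c * t (n + 1) k - t n k) = (\<Sum>k\<in>{1..n+1}. G n (k + 1) - G n k)"
      by (rule sum.cong[OF refl], rule cert) simp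
    also have "\<dots> = G n (n + 2) - G n 1"
      using sum_Suc_diff[of 1 "n + 1" "G n"] by simp
    also have "G n (n + 2) = 0" by (simp add: G_def)
    also have "iqf2 (n + 1) 0 = I * I" by (simp add: iqf2_def I_def)
    also have "iqf2 n 0 = (1 - fps_X ^ (n + 1)) * I * ((1 - fps_X ^ (n + 1)) * I)"
      by (simp add: iqf2_def J)
    also have "(fps_X :: 'a fps) ^ (2 * n + 2) = fps_X ^ (n + 1) * fps_X ^ (n + 1)"
      by (simp flip: power_add add: mult_2)
    finally show ?thesis unfolding g1 by (simp add: algebra_simps power_add mult_2_right)
  qed
  have "qf_even n * a n = 1"
  proof (induction n)
    case (Suc n)
    have "qf_even (Suc n) * a (Suc n) = qf_even n * ((1 - fps_X ^ (2 * n + 2)) * a (n + 1))"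
      by (simp add: qf_even_Suc mult_ac)
    then show ?case using Suc unfolding step by simp
  qed (simp add: a_def iqf2_def)
  then show ?thesis
    unfolding a_def[symmetric] t_def[symmetric] by (metis fps_inverse_unique mult.commute)
qed

section \<open>A finite form of Jacobi's identity for the cube of f_1\<close>

definition jacobi_term :: "nat \<Rightarrow> nat \<Rightarrow> 'a::field fps" where
  "jacobi_term n k = (-1) ^ k * fps_X ^ (k * (k + 1) div 2) * qf (2 * n + 1) *
     (if k \<le> n then inverse (qf (n - k)) * inverse (qf (n + k + 1)) else 0)"

text \<open>These are the coefficients of \<open>z\<^sup>k\<^sup>+\<^sup>1\<close> in \<open>(1 - z)(1 - zq)(1 - q/z)\<dots>(1 - zq\<^sup>n)(1 - q\<^sup>n/z)\<close> up to
  sign. They are antisymmetric under \<open>k \<mapsto> -1 - k\<close>, which accounts for the case \<open>k = 0\<close>.\<close>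

lemma jacobi_term_Suc:
  "jacobi_term (n + 1) k = (1 + fps_X ^ (2 * n + 2)) * jacobi_term n k - fps_X ^ (n + 1) *
    ((if k = 0 then - jacobi_term n 0 else jacobi_term n (k - 1)) + (jacobi_term n (k + 1) :: 'a::field fps))"
proof (cases "k \<le> n + 1")
  case True
  define j where "j = n + 1 - k"
  have n: "n + 1 = k + j" using True by (simp add: j_def)
  define p where "p = (fps_X :: 'a fps) ^ (k * (k - 1) div 2)"
  define y where "y = (fps_X :: 'a fps) ^ k"
  define z where "z = (fps_X :: 'a fps) ^ j"
  define I where "I = inverse (qf j :: 'a fps)"
  define J where "J = inverse (qf (n + k + 2) :: 'a fps)"
  define K where "K = (qf (2 * n + 1) :: 'a fps)"
  define e where "e = (-1 :: 'a fps) ^ k"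
  have tri: "k * (k + 1) div 2 = k * (k - 1) div 2 + k" for k :: nat
    by (cases k) (auto simp: algebra_simps)
  have pw: "fps_X ^ (k * (k + 1) div 2) = p * y" "fps_X ^ ((k + 1) * (k + 1 + 1) div 2) = p * y * (y * fps_X)"
    unfolding tri[of "k + 1"] add_diff_cancel_right' mult.commute[of "k + 1" k] tri[of k]
    by (simp_all add: p_def y_def power_add mult_ac)
  have pw': "fps_X ^ (n + 1) = y * z" "fps_X ^ (2 * n + 2) = y ^ 2 * z ^ 2"
      "fps_X ^ (n + k + 1) = y ^ 2 * z" "fps_X ^ (n + k + 2) = y ^ 2 * z * fps_X"
      "fps_X ^ (2 * n + 3) = y ^ 2 * z ^ 2 * fps_X"
    using n by (simp_all add: y_def z_def algebra_simps flip: power_add power_mult power_Suc power_Suc2)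
  have J1: "inverse (qf (n + k + 1)) = (1 - y ^ 2 * z * fps_X) * J"
    using inverse_qf_Suc[of "n + k + 1", where ?'a = 'a] pw'(4) by (simp add: J_def del: power_Suc)
  have J2: "inverse (qf (n + k)) = (1 - y ^ 2 * z) * ((1 - y ^ 2 * z * fps_X) * J)"
    using inverse_qf_Suc[of "n + k", where ?'a = 'a] pw'(3) J1 by (simp del: power_Suc)
  have K: "qf (2 * (n + 1) + 1) = K * (1 - y ^ 2 * z ^ 2) * (1 - y ^ 2 * z ^ 2 * fps_X)"
    using qf_Suc[of "2 * n + 1", where ?'a = 'a] qf_Suc[of "2 * n + 2", where ?'a = 'a] pw'(2,5)
    by (simp add: K_def numeral_3_eq_3 del: power_Suc)
  have t1: "jacobi_term (n + 1) k = e * (p * y) * (K * (1 - y ^ 2 * z ^ 2) * (1 - y ^ 2 * z ^ 2 * fps_X)) * (I * J)"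
    using True unfolding jacobi_term_def pw K by (simp add: e_def I_def J_def j_def)
  have t0: "jacobi_term n k = e * (p * y) * K * ((1 - z) * (1 - y ^ 2 * z * fps_X) * (I * J))"
  proof (cases j)
    case 0
    then show ?thesis using n by (simp add: jacobi_term_def z_def)
  next
    case (Suc h)
    then have "inverse (qf h) = (1 - z) * I" "n - k = h" "k \<le> n"
      using inverse_qf_Suc[of h, where ?'a = 'a] n by (simp_all add: I_def z_def)
    then show ?thesis unfolding jacobi_term_def pw J1 by (simp add: e_def K_def mult_ac)
  qed
  have tm: "(if k = 0 then - jacobi_term n 0 else jacobi_term n (k - 1))
    = - (e * p * K * (I * ((1 - y ^ 2 * z) * ((1 - y ^ 2 * z * fps_X) * J))))"
  proof (cases k)
    case 0
    then show ?thesis using n t0 by (simp add: p_def y_def e_def)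
  next
    case (Suc l)
    then have F: "k - 1 \<le> n" "n - (k - 1) = j" "n + (k - 1) + 1 = n + k" "(k - 1) * (k - 1 + 1) div 2 = k * (k - 1) div 2"
       "(-1 :: 'a fps) ^ (k - 1) = - e"
      using True by (auto simp: j_def e_def mult.commute)
    have "k \<noteq> 0" using Suc by simp
    then show ?thesis
      unfolding jacobi_term_def F J2 if_not_P[OF \<open>k \<noteq> 0\<close>] if_P[OF F(1)] by (simp add: I_def K_def p_def)
  qed
  have tp: "fps_X ^ (n + 1) * jacobi_term n (k + 1)
      = - (e * p * y * (y * K * (fps_X - z) * (1 - z) * (I * J))) * (y * z)"
  proof (cases "k + 1 \<le> n")
    case False
    \<comment> \<open>Beyond the range of \<open>jacobi_term\<close> the factor
      \<open>(fps_X - z) * (1 - z)\<close> vanishes, in agreement with the default value 0.\<close>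
    then have "j = 0 \<or> j = 1" using n by auto
    then have "z = 1 \<or> z = fps_X" by (metis power_0 power_one_right z_def)
    then show ?thesis using False by (auto simp: jacobi_term_def)
  next
    case True
    define h where "h = n - (k + 1)"
    have j: "j = h + 2" "n + (k + 1) + 1 = n + k + 2" using True n by (auto simp: h_def)
    have "inverse (qf (h + 1)) = (1 - z) * I"
      using inverse_qf_Suc[of "h + 1", where ?'a = 'a] j by (simp add: I_def z_def)
    then have "inverse (qf h) = (1 - fps_X ^ (h + 1)) * ((1 - z) * I)"
      using inverse_qf_Suc[of h, where ?'a = 'a] by simp
    moreover have "fps_X - z = fps_X * (1 - fps_X ^ (h + 1))"
      by (simp add: z_def j algebra_simps)
    ultimately show ?thesis
      using True unfolding jacobi_term_def h_def[symmetric] j pw pw'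
      by (simp add: e_def K_def J_def mult_ac)
  qed
  have "(jacobi_term (n + 1) k :: 'a fps) = (1 + fps_X ^ (2 * n + 2)) * jacobi_term n k
     - fps_X ^ (n + 1) * (if k = 0 then - jacobi_term n 0 else jacobi_term n (k - 1))
     - fps_X ^ (n + 1) * jacobi_term n (k + 1)"
    unfolding t1 t0 tm tp unfolding pw' by (simp add: algebra_simps power_numeral_reduce)
  then show ?thesis by (simp only: distrib_left diff_diff_add)
next
  case False
  then show ?thesis by (auto simp: jacobi_term_def)
qed

text \<open>Up to sign this is the derivative at z = 1 of the product whose coefficients are the
  \<open>jacobi_term\<close>. The exponents k + 1 and -k belong to opposite coefficients, so a pair
  gets the weight (k + 1) + k. The induction avoids the variable z: the recurrence multiplies the
  sum by 1 + Q^2 - 2Q = (1 - Q)^2 with Q = q^(n+1).\<close>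

lemma jacobi_finite:
  "(\<Sum>k\<le>n. of_nat (2 * k + 1) * jacobi_term n k) = (qf n :: 'a::field fps) ^ 2"
proof (induction n)
  case (Suc n)
  let ?c = "jacobi_term n :: nat \<Rightarrow> 'a fps"
  let ?h = "\<lambda>k. if k = 0 then - ?c 0 else ?c (k - 1)"
  \<comment> \<open>The weights are linear in \<open>k\<close>, so the two shifts together double
    the sum up to boundary terms. At the left end the weight is 3 - 1 = 2, owing to the value
    \<open>- ?c 0\<close>.\<close>
  have *: "(\<Sum>k\<le>K. of_nat (2 * k + 1) * (?h k + ?c (k + 1)))
      = 2 * (\<Sum>k\<le>K. of_nat (2 * k + 1) * ?c k) + of_nat (2 * K + 1) * ?c (K + 1) - of_nat (2 * K + 3) * ?c K" for K
  proof (induction K)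
    case (Suc K)
    show ?case unfolding sum.atMost_Suc Suc by (simp add: algebra_simps)
  qed simp
  have rearr: "a * (b * c - d * e) = b * (a * c) - d * (a * e)" for a b c d e :: "'a fps"
    by (simp add: algebra_simps)
  have z: "?c (Suc n) = 0" "?c (Suc (Suc n)) = 0" by (simp_all add: jacobi_term_def)
  have "(\<Sum>k\<le>Suc n. of_nat (2 * k + 1) * jacobi_term (Suc n) k)
     = (\<Sum>k\<le>Suc n. (1 + fps_X ^ (2 * n + 2)) * (of_nat (2 * k + 1) * ?c k)
         - fps_X ^ (n + 1) * (of_nat (2 * k + 1) * (?h k + ?c (k + 1))))"
    by (intro sum.cong refl, subst rearr[symmetric], subst jacobi_term_Suc[symmetric]) simp
  also have "\<dots> = (1 + fps_X ^ (2 * n + 2)) * (\<Sum>k\<le>Suc n. of_nat (2 * k + 1) * ?c k)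
       - fps_X ^ (n + 1) * (2 * (\<Sum>k\<le>Suc n. of_nat (2 * k + 1) * ?c k))"
    unfolding sum_subtractf sum_distrib_left[symmetric] * using z by simp
  also have "(\<Sum>k\<le>Suc n. of_nat (2 * k + 1) * ?c k) = qf n ^ 2" using Suc z by simp
  also have "(fps_X :: 'a fps) ^ (2 * n + 2) = (fps_X ^ (n + 1)) ^ 2"
    by (simp only: power_mult[symmetric] distrib_right mult.commute[of n 2] mult_1)
  also have "(1 + (fps_X ^ (n + 1)) ^ 2) * qf n ^ 2 - fps_X ^ (n + 1) * (2 * qf n ^ 2)
      = (qf n * (1 - fps_X ^ (n + 1))) ^ 2" for n
    by (simp only: power2_eq_square algebra_simps mult_2 mult_1)
  finally show ?case by (simp add: qf_Suc)
qed (simp add: jacobi_term_def)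

subsection \<open>The generating function of \<open>spt_omega\<close>\<close>

definition parts_in :: "nat set \<Rightarrow> nat \<Rightarrow> nat multiset set" where
  "parts_in S n = {P. set_mset P \<subseteq> S \<and> sum_mset P = n}"

lemma finite_parts_in: "0 \<notin> S \<Longrightarrow> finite (parts_in S n)"
  by (rule finite_subset[OF _ finite_partitions[of n]]) (auto simp: parts_in_def partitions_def)

lemma parts_in_insert:
  assumes "k \<notin> S"
  shows "parts_in (insert k S) n = parts_in S n \<union> {P \<in> parts_in (insert k S) n. k \<in># P}"
    and "parts_in S n \<inter> {P \<in> parts_in (insert k S) n. k \<in># P} = {}"
  using assms by (auto simp: parts_in_def)

lemma bij_betw_add_part:
  "bij_betw (add_mset k) (parts_in (insert k S) n) {P \<in> parts_in (insert k S) (n + k). k \<in># P}"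
proof (rule bij_betwI[where g = "\<lambda>P. P - {#k#}"])
  show "(\<lambda>P. P - {#k#}) \<in> {P \<in> parts_in (insert k S) (n + k). k \<in># P} \<rightarrow> parts_in (insert k S) n"
    by (auto simp: parts_in_def dest!: multi_member_split)
qed (auto simp: parts_in_def)

definition parts_gf :: "nat set \<Rightarrow> 'a::field fps" where
  "parts_gf S = Abs_fps (\<lambda>n. of_nat (card (parts_in S n)))"

definition mult_gf :: "nat \<Rightarrow> nat set \<Rightarrow> 'a::field fps" where
  "mult_gf k S = Abs_fps (\<lambda>n. of_nat (\<Sum>P\<in>parts_in (insert k S) n. count P k))"

lemma parts_with_part_empty: "n < k \<Longrightarrow> {P \<in> parts_in S n. k \<in># P} = {}"
  by (auto simp: parts_in_def dest!: multi_member_split)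

lemma parts_gf_insert:
  assumes "k \<notin> S" "k > 0" "0 \<notin> S"
  shows "parts_gf (insert k S) = parts_gf S + fps_X ^ k * (parts_gf (insert k S) :: 'a::field fps)"
proof (rule fps_ext)
  fix n
  have "card (parts_in (insert k S) n) = card (parts_in S n) + card {P \<in> parts_in (insert k S) n. k \<in># P}"
    using assms parts_in_insert[OF assms(1), of n]
      finite_parts_in[of "insert k S" n] by (metis (no_types, lifting) card_Un_disjoint finite_Un insert_iff less_numeral_extra(3))
  moreover have "card {P \<in> parts_in (insert k S) n. k \<in># P} = (if k \<le> n then card (parts_in (insert k S) (n - k)) else 0)"
  proof (cases "k \<le> n")
    case True
    then show ?thesis using bij_betw_same_card[OF bij_betw_add_part[of k S "n - k"]] by simp
  qed (simp add: parts_with_part_empty)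
  ultimately show "parts_gf (insert k S) $ n = (parts_gf S + fps_X ^ k * parts_gf (insert k S) :: 'a fps) $ n"
    by (auto simp: parts_gf_def fps_X_power_mult_nth)
qed

lemma parts_gf_empty: "parts_gf {} = 1"
proof -
  have "parts_in {} n = (if n = 0 then {{#}} else {})" for n by (auto simp: parts_in_def)
  then show ?thesis by (auto simp: parts_gf_def fps_eq_iff)
qed

lemma parts_gf:
  assumes "finite S" "0 \<notin> S"
  shows "parts_gf S * (\<Prod>k\<in>S. 1 - fps_X ^ k) = (1 :: 'a::field fps)"
  using assms
proof (induction S)
  case (insert k S)
  then have "parts_gf (insert k S) * (1 - fps_X ^ k) = (parts_gf S :: 'a fps)"
    using parts_gf_insert[of k S, where ?'a = 'a] by (simp add: algebra_simps)
  then show ?case using insert by (simp flip: mult.assoc)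
qed (simp add: parts_gf_empty)

text \<open>Removing one copy of \<open>k\<close> is a bijection from the partitions containing
  \<open>k\<close> that lowers the multiplicity by one; so the series W of multiplicities and the
  series Q of partitions satisfy W = q^k (W + Q).\<close>

lemma mult_gf:
  assumes "k \<notin> S" "k > 0" "0 \<notin> S"
  shows "(1 - fps_X ^ k) * mult_gf k S = fps_X ^ k * (parts_gf (insert k S) :: 'a::field fps)"
proof -
  have "mult_gf k S = fps_X ^ k * (mult_gf k S + parts_gf (insert k S) :: 'a fps)"
  proof (rule fps_ext)
    fix n
    let ?A = "parts_in (insert k S)"
    have fin: "finite (?A n)" for n using assms by (intro finite_parts_in) auto
    have "(\<Sum>P\<in>?A n. count P k) = (\<Sum>P\<in>{P \<in> ?A n. k \<in># P}. count P k)"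
      by (rule sum.mono_neutral_right) (auto simp: fin not_in_iff)
    also have "\<dots> = (if k \<le> n then (\<Sum>P\<in>?A (n - k). count P k) + card (?A (n - k)) else 0)"
    proof (cases "k \<le> n")
      case True
      have "(\<Sum>P\<in>{P \<in> ?A n. k \<in># P}. count P k) = (\<Sum>P\<in>?A (n - k). count (add_mset k P) k)"
        using sum.reindex_bij_betw[OF bij_betw_add_part[of k S "n - k"], of "\<lambda>P. count P k"] True by simp
      then show ?thesis using True by (simp add: sum_Suc)
    next
      case False
      then show ?thesis by (subst parts_with_part_empty) auto
    qed
    finally show "mult_gf k S $ n = (fps_X ^ k * (mult_gf k S + parts_gf (insert k S) :: 'a fps)) $ n"
      by (auto simp: mult_gf_def parts_gf_def fps_X_power_mult_nth simp del: of_nat_sum simp flip: of_nat_add)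
  qed
  then show ?thesis by (simp add: algebra_simps)
qed

text \<open>Parts above \<open>2L\<close> do not matter for partitions of \<open>n \<le> L\<close>; an even bound keeps the product formula below exact.\<close>

definition large_parts :: "nat \<Rightarrow> nat \<Rightarrow> nat set" where
  "large_parts L m = {k. m < k \<and> k \<le> 2 * L \<and> (odd k \<longrightarrow> k < 2 * m)}"

lemma spt_omega_nth:
  assumes "n \<le> L"
  shows "of_nat (spt_omega n) = (\<Sum>m\<in>{1..L}. mult_gf m (large_parts L m) :: 'a::field fps) $ n"
proof -
  let ?A = "{P \<in> partitions n. \<forall>k\<in>#P. odd k \<longrightarrow> k < 2 * Min (set_mset P)}"
  let ?B = "\<lambda>m. {P \<in> parts_in (insert m (large_parts L m)) n. m \<in># P}"
  have le: "k \<le> n" if "P \<in> partitions n" "k \<in># P" for P k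
    using that by (auto simp: partitions_def dest!: multi_member_split)
  have MinB: "Min (set_mset P) = m" if "P \<in> ?B m" for P m
    using that by (intro Min_eqI) (auto simp: parts_in_def large_parts_def)
  have eq: "{P \<in> ?A. P \<noteq> {#}} = (\<Union>m\<in>{1..L}. ?B m)"
  proof (intro equalityI subsetI)
    fix P assume P: "P \<in> {P \<in> ?A. P \<noteq> {#}}"
    define m where "m = Min (set_mset P)"
    have m: "m \<in># P" "\<And>k. k \<in># P \<Longrightarrow> m \<le> k" using P by (auto simp: m_def)
    have "0 < m" using m(1) P by (auto simp: partitions_def intro!: gr0I)
    moreover have "P \<in> ?B m"
    proof -
      have "k = m \<or> k \<in> large_parts L m" if "k \<in># P" for k
        using that P m(2)[OF that] le[of P k] assms by (auto simp: large_parts_def m_def[symmetric])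
      then show ?thesis using P m(1) by (auto simp: parts_in_def partitions_def)
    qed
    moreover have "m \<le> L" using le[of P m] P m(1) assms by auto
    ultimately show "P \<in> (\<Union>m\<in>{1..L}. ?B m)" by auto
  next
    fix P assume "P \<in> (\<Union>m\<in>{1..L}. ?B m)"
    then obtain m where m: "m \<in> {1..L}" "P \<in> ?B m" by auto
    then show "P \<in> {P \<in> ?A. P \<noteq> {#}}"
      using MinB[OF m(2)] by (auto simp: parts_in_def partitions_def large_parts_def)
  qed
  have fin: "finite (?B m)" if "m \<in> {1..L}" for m
    using that by (auto intro!: finite_parts_in simp: large_parts_def)
  \<comment> \<open>The empty partition contributes a count of 0, whatever the minimum of the empty
    set is.\<close>
  have "spt_omega n = (\<Sum>P\<in>{P \<in> ?A. P \<noteq> {#}}. count P (Min (set_mset P)))"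
    unfolding spt_omega_def by (rule sum.mono_neutral_right) (auto simp: finite_partitions)
  also have "\<dots> = (\<Sum>m\<in>{1..L}. \<Sum>P\<in>?B m. count P (Min (set_mset P)))"
    unfolding eq by (rule sum.UNION_disjoint) (use fin MinB in \<open>blast+\<close>)
  also have "\<dots> = (\<Sum>m\<in>{1..L}. \<Sum>P\<in>?B m. count P m)"
    using MinB by (intro sum.cong refl) auto
  also have "\<dots> = (\<Sum>m\<in>{1..L}. \<Sum>P\<in>parts_in (insert m (large_parts L m)) n. count P m)"
    by (intro sum.cong refl sum.mono_neutral_left)
      (auto simp: not_in_iff large_parts_def intro!: finite_parts_in)
  finally show ?thesis by (simp add: fps_sum_nth mult_gf_def)
qed

text \<open>Parts in m+1..2m are unrestricted, as the odd ones are automatically below 2m; larger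
  parts must be even. This is (q^(m+1);q)_m (q^(2m+2);q^2)_(L-m) with denominators cleared.\<close>

lemma prod_large_parts:
  assumes "m \<le> L"
  shows "(\<Prod>k\<in>large_parts L m. 1 - fps_X ^ k) * qf m * qf_even m = (qf (2 * m) * qf_even L :: 'a::field fps)"
proof -
  have "large_parts L m = {m+1..2*m} \<union> (\<lambda>i. 2 * i) ` {m+1..L}"
  proof (intro equalityI subsetI)
    fix k assume k: "k \<in> large_parts L m"
    show "k \<in> {m+1..2*m} \<union> (\<lambda>i. 2 * i) ` {m+1..L}"
    proof (cases "k \<le> 2 * m")
      case False
      then obtain i where "k = 2 * i" using k by (auto simp: large_parts_def)
      then show ?thesis using k False by (auto simp: large_parts_def)
    qed (use k in \<open>auto simp: large_parts_def\<close>)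
  qed (use assms in \<open>auto simp: large_parts_def le_less\<close>)
  then have "(\<Prod>k\<in>large_parts L m. 1 - fps_X ^ k :: 'a fps)
    = (\<Prod>k\<in>{m+1..2*m}. 1 - fps_X ^ k) * (\<Prod>i\<in>{m+1..L}. 1 - fps_X ^ (2 * i))"
    by (simp, subst prod.union_disjoint) (auto simp: prod.reindex inj_on_def)
  moreover have "qf (2 * m) = qf m * (\<Prod>k\<in>{m+1..2*m}. 1 - fps_X ^ k :: 'a fps)"
    unfolding qf_def by (rule prod.ub_add_nat[of 1 m _ m, simplified mult_2[symmetric]]) simp
  moreover have "qf_even L = qf_even m * (\<Prod>i\<in>{m+1..L}. 1 - fps_X ^ (2 * i) :: 'a fps)"
    unfolding qf_even_def using prod.ub_add_nat[of 1 m _ "L - m"] assms by simp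
  ultimately show ?thesis by (simp add: mult_ac)
qed

lemma qf_double: "qf (2 * m) = qf_even m * qf_odd m"
proof (induction m)
  case (Suc m)
  have "2 * Suc m = Suc (Suc (2 * m))" by simp
  then show ?case using Suc by (simp add: qf_Suc qf_even_Suc qf_odd_Suc mult_ac)
qed simp

text \<open>The last factor is the beta_m of \<open>bailey_pair\<close>, and q^m (q)_(m-1)^2 is the
  weight that \<open>qGauss_partial_sum\<close> can sum against the kernel. Multiplying by
  \<open>qf_even L\<close> is what brings the summand to this form.\<close>

lemma spt_summand:
  assumes "m \<in> {1..L}"
  shows "qf_even L * mult_gf m (large_parts L m) = fps_X ^ m * qf (m - 1) ^ 2 * inverse (qf m * qf_odd m :: 'a::field fps)"
proof -
  let ?S = "large_parts L m"
  let ?W = "mult_gf m ?S :: 'a fps"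
  let ?P = "\<Prod>k\<in>?S. 1 - fps_X ^ k :: 'a fps"
  define u where "u = (1 - fps_X ^ m :: 'a fps)"
  have S: "m \<notin> ?S" "0 \<notin> ?S" "finite ?S" "0 < m" using assms by (auto simp: large_parts_def)
  have "parts_gf (insert m ?S) * (u * ?P) = 1"
    using parts_gf[of "insert m ?S", where ?'a = 'a] S by (simp add: u_def)
  then have W: "u ^ 2 * ?W * ?P = fps_X ^ m"
    using mult_gf[OF S(1,4,2), where ?'a = 'a] by (simp add: u_def[symmetric] power2_eq_square mult_ac)
  have qm: "qf m = qf (m - 1) * u" using qf_Suc[of "m - 1", where ?'a = 'a] S(4) by (simp add: u_def)
  have qne: "qf_even m \<noteq> (0 :: 'a fps)"
    by (metis fps_nonzero_nth qf_nth_0(2) zero_neq_one)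
  have "(qf m * qf_odd m) * (qf_even L * ?W) * (qf_even m * u ^ 2) = (qf (2 * m) * qf_even L) * ?W * qf m * u ^ 2"
    unfolding qf_double by (simp only: mult_ac)
  also have "\<dots> = (u ^ 2 * ?W * ?P) * qf m ^ 2 * qf_even m"
    using assms by (subst prod_large_parts[symmetric]) (auto simp: power2_eq_square)
  also have "\<dots> = fps_X ^ m * qf (m - 1) ^ 2 * (qf_even m * u ^ 2)"
    unfolding W qm by (simp add: power2_eq_square)
  finally have Z: "(qf m * qf_odd m) * (qf_even L * ?W) = fps_X ^ m * qf (m - 1) ^ 2"
    using fps_X_power_nonzero[OF S(4), where ?'a = 'a] qne by (auto simp: u_def)
  have "inverse (qf m * qf_odd m) * (qf m * qf_odd m) = (1 :: 'a fps)"
    by (intro inverse_mult_eq_1) simp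
  then have "qf_even L * ?W = inverse (qf m * qf_odd m) * ((qf m * qf_odd m) * (qf_even L * ?W))"
    by (simp only: mult.assoc[symmetric] mult_1)
  then show ?thesis unfolding Z by (simp only: mult.commute)
qed

text \<open>The Bailey lemma, exact for every \<open>L\<close>: replace beta_n by its expansion,
  exchange the sums, and evaluate the inner sum for index \<open>2 * k\<close> by
  \<open>qGauss_partial_sum\<close>. Index 0 is outside the scope of that lemma, and its terms
  reduce directly to q^n/(1 - q^n)^2.\<close>

lemma spt_finite:
  "qf_even L * (\<Sum>m\<in>{1..L}. mult_gf m (large_parts L m))
    = (\<Sum>n\<in>{1..L}. fps_X ^ n * inverse (1 - fps_X ^ n) ^ 2)
      + (\<Sum>k\<in>{1..L}. fps_X ^ (2 * k) * inverse (1 - fps_X ^ (2 * k)) ^ 2 * qf L ^ 2 * (bailey_term L k :: 'a::field fps))"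
proof -
  have b: "bailey_term n k = ((-1) ^ k * (fps_X ^ (k * (3 * k + 1)) + fps_X ^ (k * (3 * k - 1)))) * (iqf2 n (2 * k) :: 'a fps)" for n k
    by (simp add: bailey_term_def)
  have "qf_even L * (\<Sum>m\<in>{1..L}. mult_gf m (large_parts L m))
    = (\<Sum>n\<in>{1..L}. fps_X ^ n * qf (n - 1) ^ 2 * inverse (qf n * qf_odd n :: 'a fps))"
    unfolding sum_distrib_left by (intro sum.cong refl spt_summand)
  also have "\<dots> = (\<Sum>n\<in>{1..L}. fps_X ^ n * qf (n - 1) ^ 2 * (iqf2 n 0 + (\<Sum>k\<in>{1..L}. bailey_term n k)))"
  proof (intro sum.cong refl)
    fix n assume "n \<in> {1..L}"
    then have "(\<Sum>k\<in>{1..n}. bailey_term n k) = (\<Sum>k\<in>{1..L}. bailey_term n k :: 'a fps)"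
      by (intro sum.mono_neutral_left) (auto simp: bailey_term_def)
    then show "fps_X ^ n * qf (n - 1) ^ 2 * inverse (qf n * qf_odd n :: 'a fps)
        = fps_X ^ n * qf (n - 1) ^ 2 * (iqf2 n 0 + (\<Sum>k\<in>{1..L}. bailey_term n k))"
      by (simp add: bailey_pair[symmetric])
  qed
  also have "\<dots> = (\<Sum>n\<in>{1..L}. fps_X ^ n * qf (n - 1) ^ 2 * iqf2 n 0)
      + (\<Sum>n\<in>{1..L}. \<Sum>k\<in>{1..L}. fps_X ^ n * qf (n - 1) ^ 2 * bailey_term n k)"
    by (simp only: distrib_left sum.distrib sum_distrib_left)
  also have "(\<Sum>n\<in>{1..L}. \<Sum>k\<in>{1..L}. fps_X ^ n * qf (n - 1) ^ 2 * bailey_term n k)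
      = (\<Sum>k\<in>{1..L}. \<Sum>n\<in>{1..L}. fps_X ^ n * qf (n - 1) ^ 2 * (bailey_term n k :: 'a fps))"
    by (rule sum.swap)
  also have "(\<Sum>n\<in>{1..L}. fps_X ^ n * qf (n - 1) ^ 2 * iqf2 n 0)
      = (\<Sum>n\<in>{1..L}. fps_X ^ n * inverse (1 - fps_X ^ n) ^ 2 :: 'a fps)"
  proof (intro sum.cong refl)
    fix n assume n: "n \<in> {1..L}"
    then have q: "inverse (qf (n - 1)) = (1 - fps_X ^ n) * inverse (qf n :: 'a fps)"
      using inverse_qf_Suc[of "n - 1", where ?'a = 'a] by simp
    have "qf (n - 1) * inverse (qf n) = inverse (1 - fps_X ^ n) * (1 - fps_X ^ n) * (qf (n - 1) * inverse (qf n :: 'a fps))"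
      using n by simp
    also have "\<dots> = inverse (1 - fps_X ^ n) * (qf (n - 1) * ((1 - fps_X ^ n) * inverse (qf n :: 'a fps)))"
      by (simp only: mult_ac)
    also have "\<dots> = inverse (1 - fps_X ^ n)" unfolding q[symmetric] by simp
    finally show "fps_X ^ n * qf (n - 1) ^ 2 * iqf2 n 0 = fps_X ^ n * (inverse (1 - fps_X ^ n) :: 'a fps) ^ 2"
      by (simp add: iqf2_def power2_eq_square flip: mult.assoc)
  qed
  also have "(\<Sum>k\<in>{1..L}. \<Sum>n\<in>{1..L}. fps_X ^ n * qf (n - 1) ^ 2 * bailey_term n k)
    = (\<Sum>k\<in>{1..L}. fps_X ^ (2 * k) * inverse (1 - fps_X ^ (2 * k)) ^ 2 * qf L ^ 2 * (bailey_term L k :: 'a fps))"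
  proof (intro sum.cong refl)
    fix k assume k: "k \<in> {1..L}"
    define c where "c = (-1) ^ k * (fps_X ^ (k * (3 * k + 1)) + fps_X ^ (k * (3 * k - 1)) :: 'a fps)"
    have "(\<Sum>n\<in>{1..L}. fps_X ^ n * qf (n - 1) ^ 2 * bailey_term n k)
      = c * (\<Sum>n\<in>{1..L}. fps_X ^ n * qf (n - 1) ^ 2 * iqf2 n (2 * k))"
      unfolding b c_def[symmetric] sum_distrib_left by (simp only: mult_ac)
    also have "\<dots> = fps_X ^ (2 * k) * inverse (1 - fps_X ^ (2 * k)) ^ 2 * qf L ^ 2 * bailey_term L k"
      using k unfolding b c_def[symmetric] by (subst qGauss_partial_sum) (auto simp: mult_ac)
    finally show "(\<Sum>n\<in>{1..L}. fps_X ^ n * qf (n - 1) ^ 2 * bailey_term n k)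
        = fps_X ^ (2 * k) * inverse (1 - fps_X ^ (2 * k)) ^ 2 * qf L ^ 2 * (bailey_term L k :: 'a fps)" .
  qed
  finally show ?thesis .
qed

subsection \<open>Passing to the limit\<close>

lemma fps_summable_order:
  assumes "\<And>n. finite {k\<in>A. e k \<le> n}" "\<And>k i. k \<in> A \<Longrightarrow> i < e k \<Longrightarrow> t k $ i = 0"
  shows "fps_summable t A"
  unfolding fps_summable_def
proof
  fix n
  have "{k\<in>A. t k $ n \<noteq> 0} \<subseteq> {k\<in>A. e k \<le> n}" using assms(2) by (auto simp: not_less[symmetric])
  then show "finite {k\<in>A. t k $ n \<noteq> 0}" using assms(1) finite_subset by blast
qed

text \<open>Fits finite identities in which the kernel \<open>g N k\<close> has a limit independent
  of \<open>k\<close>. The coefficients \<open>c k\<close> alone supply the domination, since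
  multiplying by \<open>g N k\<close> cannot lower their order.\<close>

lemma fps_infsum_mult_tendsto:
  fixes c :: "'i \<Rightarrow> 'a::comm_ring_1 fps"
  assumes lim: "\<And>k. k \<in> A \<Longrightarrow> (\<lambda>N. g N k) \<longlonglongrightarrow> G"
    and ord: "\<And>n. finite {k\<in>A. e k \<le> n}" "\<And>k i. k \<in> A \<Longrightarrow> i < e k \<Longrightarrow> c k $ i = 0"
    and W: "\<And>N. finite (W N)" "\<And>N. W N \<subseteq> A" "\<And>k. k \<in> A \<Longrightarrow> \<forall>\<^sub>F N in sequentially. k \<in> W N"
  shows "(\<lambda>N. \<Sum>k\<in>W N. c k * g N k) \<longlonglongrightarrow> G * fps_infsum c A"
proof -
  have o: "(c k * h) $ i = 0" if "k \<in> A" "i < e k" for k h i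
    using that ord(2)[of k] by (auto simp: fps_mult_nth intro!: sum.neutral)
  have "(\<lambda>N. \<Sum>k\<in>W N. c k * g N k) \<longlonglongrightarrow> fps_infsum (\<lambda>k. c k * G) A"
  proof (rule fps_infsum_tendsto)
    show "(\<lambda>N. c k * g N k) \<longlonglongrightarrow> c k * G" if "k \<in> A" for k
      using lim[OF that] by (intro fps_tendsto_mult tendsto_const)
    show "finite {k \<in> A. \<exists>N. k \<in> W N \<and> (c k * g N k) $ n \<noteq> 0}" for n
      by (rule finite_subset[OF _ ord(1)[of n]]) (use o in \<open>auto simp: not_less[symmetric]\<close>)
  qed (use W in auto)
  also have "fps_infsum (\<lambda>k. c k * G) A = G * fps_infsum c A"
    by (subst fps_infsum_mult_left[OF fps_summable_order[OF ord]]) (auto simp: mult.commute)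
  finally show ?thesis .
qed

lemma sum_int_symmetric:
  fixes f :: "int \<Rightarrow> 'a::comm_monoid_add"
  shows "(\<Sum>k\<in>{- int n..int n} - {0}. f k) = (\<Sum>k\<in>{1..n}. f (int k) + f (- int k))"
proof (induction n)
  case (Suc n)
  have "{- int (Suc n)..int (Suc n)} - {0} = insert (int (Suc n)) (insert (- int (Suc n)) ({- int n..int n} - {0}))"
    by auto
  then show ?case using Suc by (simp add: add_ac)
qed simp

lemma finite_int_le:
  fixes e :: "int \<Rightarrow> nat"
  assumes "\<And>k. \<bar>k\<bar> \<le> int (e k) + c"
  shows "finite {k\<in>A. e k \<le> n}"
proof (rule finite_subset)
  show "{k\<in>A. e k \<le> n} \<subseteq> {- (int n + c)..int n + c}"
  proof safe
    fix k assume "e k \<le> n"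
    then show "k \<in> {- (int n + c)..int n + c}" using assms[of k] by auto
  qed
qed simp

definition alt_sign :: "int \<Rightarrow> 'a::comm_ring_1 fps" where
  "alt_sign k = (if even k then 1 else -1)"

lemma alt_sign_simps [simp]: "alt_sign 0 = 1" "alt_sign (- k) = alt_sign k" "alt_sign (int n) = (-1) ^ n"
  by (auto simp: alt_sign_def)

lemma alt_sign_mult_nth: "(alt_sign k * f) $ n = (if even k then f $ n else - f $ n)"
  by (simp add: alt_sign_def)

lemma tendsto_qf: "qf \<longlonglongrightarrow> qprod UNIV"
  unfolding qf_def by (rule tendsto_qprod) (auto intro: eventually_ge_at_top)

lemma tendsto_qf_even: "qf_even \<longlonglongrightarrow> qprod {k. even k}"
proof -
  have "qf_even n = (\<Prod>k\<in>(\<lambda>i. 2 * i) ` {1..n}. 1 - fps_X ^ k :: 'a fps)" for n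
    by (simp add: qf_even_def prod.reindex inj_on_def)
  then have eq: "qf_even = (\<lambda>n. \<Prod>k\<in>(\<lambda>i. 2 * i) ` {1..n}. 1 - fps_X ^ k :: 'a fps)" by blast
  show ?thesis
    unfolding eq
  proof (rule tendsto_qprod)
    fix k :: nat assume "k \<in> {k. even k}" "0 < k"
    then obtain i where "k = 2 * i" "1 \<le> i" "i \<le> k" by (auto elim: evenE)
    then show "\<forall>\<^sub>F n in sequentially. k \<in> (*) 2 ` {1..n}"
      using eventually_ge_at_top[of k] by (elim eventually_mono) auto
  qed auto
qed

lemma tendsto_qf_odd: "qf_odd \<longlonglongrightarrow> qprod {k. odd k}"
proof -
  have "inj_on (\<lambda>i. 2 * i - 1) {1..n}" for n :: nat by (auto simp: inj_on_def)
  then have "qf_odd n = (\<Prod>k\<in>(\<lambda>i. 2 * i - 1) ` {1..n}. 1 - fps_X ^ k :: 'a fps)" for n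
    by (simp add: qf_odd_def prod.reindex)
  then have eq: "qf_odd = (\<lambda>n. \<Prod>k\<in>(\<lambda>i. 2 * i - 1) ` {1..n}. 1 - fps_X ^ k :: 'a fps)" by blast
  show ?thesis
    unfolding eq
  proof (rule tendsto_qprod)
    fix k :: nat assume "k \<in> {k. odd k}" "0 < k"
    then obtain i where "k = 2 * i + 1" by (auto elim: oddE)
    then have "k = 2 * (i + 1) - 1" "i + 1 \<le> k" by auto
    then show "\<forall>\<^sub>F n in sequentially. k \<in> (\<lambda>i. 2 * i - 1) ` {1..n}"
      using eventually_ge_at_top[of k] by (elim eventually_mono) (auto intro!: image_eqI[of _ _ "i + 1"])
  qed auto
qed

section \<open>Theta series identities as limits of the finite identities\<close>

abbreviation euler :: "'a::field fps" where "euler \<equiv> qprod UNIV"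

lemma inverse_qprod [simp]: "inverse (qprod A) * qprod A = (1 :: 'a::field fps)" "qprod A * inverse (qprod A) = (1 :: 'a::field fps)"
  by (auto intro!: inverse_mult_eq_1 inverse_mult_eq_1')

lemma tendsto_iqf2: "(\<lambda>n. iqf2 n r) \<longlonglongrightarrow> (inverse euler ^ 2 :: 'a::field fps)"
proof -
  have f: "filterlim (\<lambda>n. n - r) at_top sequentially" "filterlim (\<lambda>n. n + r) at_top sequentially"
    by (simp_all add: filterlim_minus_const_nat_at_top filterlim_add_const_nat_at_top)
  have "(\<lambda>n. inverse (qf (n - r)) * inverse (qf (n + r))) \<longlonglongrightarrow> inverse euler * (inverse euler :: 'a fps)"
    by (intro fps_tendsto_mult fps_tendsto_inverse filterlim_compose[OF tendsto_qf] f) auto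
  moreover have "\<forall>\<^sub>F n in sequentially. inverse (qf (n - r)) * inverse (qf (n + r)) = (iqf2 n r :: 'a fps)"
    using eventually_ge_at_top[of r] by eventually_elim (simp add: iqf2_def)
  ultimately show ?thesis
    by (simp add: power2_eq_square filterlim_cong)
qed

lemma qprod_odd_even: "euler = qprod {k. even k} * (qprod {k. odd k} :: 'a::field fps)"
  by (subst qprod_Un[symmetric]) (auto intro!: arg_cong[of _ _ qprod])

lemma pent_abs_le: "\<bar>k\<bar> \<le> k * (3 * k - 1)" for k :: int
proof (cases k "0 :: int" rule: linorder_cases)
  case greater
  then have "k * 1 \<le> k * (3 * k - 1)" by (intro mult_left_mono) auto
  then show ?thesis using greater by simp
next
  case less
  then have "(- k) * 1 \<le> (- k) * (1 - 3 * k)" by (intro mult_left_mono) auto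
  then show ?thesis using less by (simp add: algebra_simps)
qed simp

lemma eventually_in_int_window: "\<forall>\<^sub>F N in sequentially. k \<in> {- int N..int N}"
  using eventually_ge_at_top[of "nat \<bar>k\<bar>"] by eventually_elim auto

text \<open>Euler's theorem in q^2, as the limit of \<open>bailey_pair\<close>: the kernel tends to
  1/f_1^2 and the right side to 1/(f_1 (q;q^2)_\<infinity>), so the series is
  f_1/(q;q^2)_\<infinity>.\<close>

lemma pentagonal:
  "fps_infsum (\<lambda>k. alt_sign k * fps_X ^ nat (k * (3 * k - 1))) UNIV = (qprod {k. even k} :: 'a::field fps)"
proof -
  let ?c = "\<lambda>k. alt_sign k * fps_X ^ nat (k * (3 * k - 1)) :: 'a fps"
  let ?f2 = "qprod {k. even k} :: 'a fps" and ?fo = "qprod {k. odd k} :: 'a fps"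
  have fin: "(\<Sum>k\<in>{- int n..int n}. ?c k * iqf2 n (nat (2 * \<bar>k\<bar>))) = inverse (qf n * qf_odd n)" for n
  proof -
    have e: "nat (int k * (3 * int k - 1)) = k * (3 * k - 1)" "nat (- int k * (3 * - int k - 1)) = k * (3 * k + 1)"
       "nat (2 * \<bar>int k\<bar>) = 2 * k" "nat (2 * \<bar>- int k\<bar>) = 2 * k" for k
      by (cases k; simp add: nat_mult_distrib nat_add_distrib algebra_simps flip: of_nat_mult of_nat_add)+
    have "(\<Sum>k\<in>{- int n..int n}. ?c k * iqf2 n (nat (2 * \<bar>k\<bar>)))
      = ?c 0 * iqf2 n 0 + (\<Sum>k\<in>{- int n..int n} - {0}. ?c k * iqf2 n (nat (2 * \<bar>k\<bar>)))"
      by (subst sum.remove[of _ 0]) auto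
    also have "\<dots> = iqf2 n 0 + (\<Sum>k\<in>{1..n}. bailey_term n k)"
      unfolding sum_int_symmetric e bailey_term_def by (simp add: distrib_left distrib_right add.commute)
    finally show ?thesis by (simp only: bailey_pair)
  qed
  have "(\<lambda>n. \<Sum>k\<in>{- int n..int n}. ?c k * iqf2 n (nat (2 * \<bar>k\<bar>))) \<longlonglongrightarrow> inverse euler ^ 2 * fps_infsum ?c UNIV"
  proof (rule fps_infsum_mult_tendsto[where e = "\<lambda>k. nat (k * (3 * k - 1))"])
    show "finite {k \<in> UNIV. nat (k * (3 * k - 1)) \<le> n}" for n
      by (rule finite_int_le[where c = 0]) (use pent_abs_le order_trans[OF abs_ge_zero pent_abs_le] in simp)
  qed (auto intro: tendsto_iqf2 eventually_in_int_window[simplified] simp: fps_X_power_nth alt_sign_mult_nth)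
  moreover have "(\<lambda>n. inverse (qf n * qf_odd n :: 'a fps)) \<longlonglongrightarrow> inverse (euler * ?fo)"
    by (intro fps_tendsto_inverse fps_tendsto_mult tendsto_qf tendsto_qf_odd) auto
  ultimately have "inverse euler ^ 2 * fps_infsum ?c UNIV = inverse (euler * ?fo)"
    unfolding fin by (rule LIMSEQ_unique)
  then have "(euler * ?fo) * euler * (inverse euler ^ 2 * fps_infsum ?c UNIV) = (euler * ?fo) * euler * inverse (euler * ?fo)"
    by simp
  also have "\<dots> = euler * ((euler * ?fo) * inverse (euler * ?fo))" by (simp only: mult_ac)
  also have "(euler * ?fo) * inverse (euler * ?fo) = 1" by (intro inverse_mult_eq_1') auto
  also have "(euler * ?fo) * euler * (inverse euler ^ 2 * fps_infsum ?c UNIV)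
      = (euler * inverse euler) * (euler * inverse euler) * ?fo * fps_infsum ?c UNIV"
    by (simp only: mult_ac power2_eq_square)
  finally have "?fo * fps_infsum ?c UNIV = euler" by simp
  also have "\<dots> = ?fo * ?f2" by (subst qprod_odd_even) (rule mult.commute)
  finally show ?thesis by simp
qed

text \<open>The limit of \<open>gauss_finite\<close>, where the kernel again tends to 1/f_1^2 for
  every fixed \<open>k\<close>.\<close>

lemma gauss_square:
  "euler ^ 2 = qprod {k. even k} * (fps_infsum (\<lambda>k. alt_sign k * fps_X ^ nat (k * k)) UNIV :: 'a::field fps)"
proof -
  let ?c = "\<lambda>k. alt_sign k * fps_X ^ nat (k * k) :: 'a fps"
  let ?f2 = "qprod {k. even k} :: 'a fps"
  have fin: "(\<Sum>k\<in>{- int n..int n}. ?c k * iqf2 n (nat \<bar>k\<bar>)) = inverse (qf_even n)" for n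
  proof -
    have e: "nat (int k * int k) = k * k" "nat (- int k * - int k) = k * k"
      "nat \<bar>int k\<bar> = k" "nat \<bar>- int k\<bar> = k" for k
      by (simp_all add: nat_mult_distrib)
    have "(\<Sum>k\<in>{- int n..int n}. ?c k * iqf2 n (nat \<bar>k\<bar>))
      = ?c 0 * iqf2 n 0 + (\<Sum>k\<in>{- int n..int n} - {0}. ?c k * iqf2 n (nat \<bar>k\<bar>))"
      by (subst sum.remove[of _ 0]) auto
    also have "\<dots> = iqf2 n 0 + (\<Sum>k\<in>{1..n}. 2 * (-1) ^ k * fps_X ^ (k * k) * iqf2 n k)"
      unfolding sum_int_symmetric e by (simp add: mult.assoc flip: mult_2)
    finally show ?thesis by (simp only: gauss_finite)
  qed
  have le: "\<bar>k\<bar> \<le> k * k" for k :: int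
    by (cases "k = 0") (use mult_left_mono[of 1 "\<bar>k\<bar>" "\<bar>k\<bar>"] in \<open>auto simp: abs_mult_self_eq\<close>)
  have "(\<lambda>n. \<Sum>k\<in>{- int n..int n}. ?c k * iqf2 n (nat \<bar>k\<bar>)) \<longlonglongrightarrow> inverse euler ^ 2 * fps_infsum ?c UNIV"
  proof (rule fps_infsum_mult_tendsto[where e = "\<lambda>k. nat (k * k)"])
    show "finite {k \<in> UNIV. nat (k * k) \<le> n}" for n
      by (rule finite_int_le[where c = 0]) (use le in simp)
  qed (auto intro: tendsto_iqf2 eventually_in_int_window[simplified] simp: fps_X_power_nth alt_sign_mult_nth)
  moreover have "(\<lambda>n. inverse (qf_even n :: 'a fps)) \<longlonglongrightarrow> inverse ?f2"
    by (intro fps_tendsto_inverse tendsto_qf_even) auto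
  ultimately have "inverse euler ^ 2 * fps_infsum ?c UNIV = inverse ?f2"
    unfolding fin by (rule LIMSEQ_unique)
  then have "(euler ^ 2 * ?f2) * (inverse euler ^ 2 * fps_infsum ?c UNIV) = (euler ^ 2 * ?f2) * inverse ?f2"
    by simp
  also have "(euler ^ 2 * ?f2) * (inverse euler ^ 2 * fps_infsum ?c UNIV)
      = (euler * inverse euler) * (euler * inverse euler) * (?f2 * fps_infsum ?c UNIV)"
    by (simp only: mult_ac power2_eq_square)
  also have "euler ^ 2 * ?f2 * inverse ?f2 = euler ^ 2" by (simp add: mult.assoc)
  finally show ?thesis by simp
qed

text \<open>The limit of \<open>jacobi_finite\<close>: the kernel (q)_(2n+1)/((q)_(n-k) (q)_(n+k+1))
  tends to 1/f_1, and the right side to f_1^2.\<close>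

lemma jacobi_cube:
  "euler ^ 3 = (fps_infsum (\<lambda>k. of_nat (2 * k + 1) * (-1) ^ k * fps_X ^ (k * (k + 1) div 2)) UNIV :: 'a::field fps)"
proof -
  let ?c = "\<lambda>k. of_nat (2 * k + 1) * (-1) ^ k * fps_X ^ (k * (k + 1) div 2) :: 'a fps"
  let ?g = "\<lambda>n k. qf (2 * n + 1) * (if k \<le> n then inverse (qf (n - k)) * inverse (qf (n + k + 1)) else 0) :: 'a fps"
  have fin: "(\<Sum>k\<in>{..n}. ?c k * ?g n k) = qf n ^ 2" for n
    unfolding jacobi_finite[symmetric] by (intro sum.cong) (auto simp: jacobi_term_def)
  have le: "k \<le> k * (k + 1) div 2" for k :: nat by (induction k) auto
  have "(\<lambda>n. \<Sum>k\<in>{..n}. ?c k * ?g n k) \<longlonglongrightarrow> (euler * (inverse euler * inverse euler)) * fps_infsum ?c UNIV"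
  proof (rule fps_infsum_mult_tendsto[where e = "\<lambda>k. k * (k + 1) div 2"])
    show "finite {k \<in> UNIV. k * (k + 1) div 2 \<le> n}" for n :: nat
    proof (rule finite_subset)
      show "{k \<in> UNIV. k * (k + 1) div 2 \<le> n} \<subseteq> {..n}"
      proof
        fix k :: nat assume "k \<in> {k \<in> UNIV. k * (k + 1) div 2 \<le> n}"
        then show "k \<in> {..n}" using le[of k] by simp
      qed
    qed simp
    show "?c k $ i = 0" if "i < k * (k + 1) div 2" for k i
      using that by (subst fps_mult_nth) (auto intro!: sum.neutral simp: fps_X_power_nth)
    show "(\<lambda>N. ?g N k) \<longlonglongrightarrow> euler * (inverse euler * inverse euler)" for k
    proof -
      have f: "filterlim (\<lambda>n. n - k) at_top sequentially" "filterlim (\<lambda>n. n + k + 1) at_top sequentially"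
        "filterlim (\<lambda>n. 2 * n + 1) at_top sequentially"
        by (rule filterlim_minus_const_nat_at_top, (rule filterlim_subseq, simp add: strict_mono_def)+)
      have "(\<lambda>n. qf (2 * n + 1) * (inverse (qf (n - k)) * inverse (qf (n + k + 1)))) \<longlonglongrightarrow> euler * (inverse euler * (inverse euler :: 'a fps))"
        by (intro fps_tendsto_mult fps_tendsto_inverse filterlim_compose[OF tendsto_qf] f) auto
      moreover have "\<forall>\<^sub>F n in sequentially. qf (2 * n + 1) * (inverse (qf (n - k)) * inverse (qf (n + k + 1))) = ?g n k"
        using eventually_ge_at_top[of k] by eventually_elim simp
      ultimately show ?thesis by (rule Lim_transform_eventually)
    qed
  qed auto
  moreover have "(\<lambda>n. qf n ^ 2 :: 'a fps) \<longlonglongrightarrow> euler ^ 2"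
    unfolding power2_eq_square by (intro fps_tendsto_mult tendsto_qf)
  ultimately have "(euler * (inverse euler * inverse euler)) * fps_infsum ?c UNIV = euler ^ 2"
    unfolding fin by (rule LIMSEQ_unique)
  then have "euler * ((euler * inverse euler) * inverse euler * fps_infsum ?c UNIV) = euler * euler ^ 2"
    by (simp only: mult_ac)
  moreover have "euler * (1 * inverse euler * fps_infsum ?c UNIV) = (euler * inverse euler) * fps_infsum ?c UNIV"
    by (simp only: mult_ac mult_1)
  ultimately show ?thesis by (simp add: power3_eq_cube power2_eq_square mult.assoc)
qed

definition spt_omega_gf :: "'a::field fps" where
  "spt_omega_gf = Abs_fps (\<lambda>n. of_nat (spt_omega n))"

definition divisor_gf :: "'a::field fps" where
  "divisor_gf = fps_infsum (\<lambda>n. fps_X ^ n * inverse (1 - fps_X ^ n) ^ 2) {1..}"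

text \<open>The indices \<open>k\<close> and \<open>- k\<close> supply the two powers in
  \<open>bailey_term\<close>. Since x/(1 - x)^2 is invariant under x -> 1/x, the absolute values do
  not change the Appell-Lerch sum; they keep all exponents natural.\<close>

definition mock_gf :: "'a::field fps" where
  "mock_gf = fps_infsum (\<lambda>k. alt_sign k * fps_X ^ nat (k * (3 * k - 1) + 2 * \<bar>k\<bar>) *
     inverse (1 - fps_X ^ nat (2 * \<bar>k\<bar>)) ^ 2) (UNIV - {0})"

lemma X_power_mult_order: "i < e \<Longrightarrow> (fps_X ^ e * f) $ i = 0" "i < e \<Longrightarrow> (alt_sign k * fps_X ^ e * f) $ i = 0"
  for f :: "'a::comm_ring_1 fps"
  by (simp_all add: fps_X_power_mult_nth mult.assoc alt_sign_mult_nth)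

lemma spt_omega_gf: "qprod {k. even k} * spt_omega_gf = divisor_gf + (mock_gf :: 'a::field fps)"
proof -
  let ?c = "\<lambda>k. alt_sign k * fps_X ^ nat (k * (3 * k - 1) + 2 * \<bar>k\<bar>) * inverse (1 - fps_X ^ nat (2 * \<bar>k\<bar>)) ^ 2 :: 'a fps"
  let ?g = "\<lambda>L k. qf L * qf L * iqf2 L (nat (2 * \<bar>k\<bar>)) :: 'a fps"
  have "(\<lambda>L. \<Sum>m\<in>{1..L}. mult_gf m (large_parts L m) :: 'a fps) \<longlonglongrightarrow> spt_omega_gf"
  proof (rule tendsto_fpsI)
    fix n
    show "\<forall>\<^sub>F L in sequentially. (\<Sum>m\<in>{1..L}. mult_gf m (large_parts L m) :: 'a fps) $ n = spt_omega_gf $ n"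
      using eventually_ge_at_top[of n] by eventually_elim (simp add: spt_omega_gf_def spt_omega_nth)
  qed
  then have "(\<lambda>L. qf_even L * (\<Sum>m\<in>{1..L}. mult_gf m (large_parts L m) :: 'a fps)) \<longlonglongrightarrow> qprod {k. even k} * spt_omega_gf"
    by (intro fps_tendsto_mult tendsto_qf_even)
  moreover have "(\<lambda>L. qf_even L * (\<Sum>m\<in>{1..L}. mult_gf m (large_parts L m) :: 'a fps)) \<longlonglongrightarrow> divisor_gf + mock_gf"
    unfolding spt_finite
  proof (rule fps_tendsto_add)
    show "(\<lambda>L. \<Sum>n\<in>{1..L}. fps_X ^ n * inverse (1 - fps_X ^ n) ^ 2 :: 'a fps) \<longlonglongrightarrow> divisor_gf"
      unfolding divisor_gf_def
    proof (rule fps_infsum_tendsto)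
      show "finite {k \<in> {1..}. \<exists>N. k \<in> {1..N} \<and> (fps_X ^ k * inverse (1 - fps_X ^ k) ^ 2 :: 'a fps) $ n \<noteq> 0}" for n
        by (rule finite_subset[of _ "{..n}"]) (auto simp: X_power_mult_order not_less[symmetric])
    qed (auto intro: eventually_ge_at_top)
    have "(\<lambda>L. \<Sum>k\<in>{- int L..int L} - {0}. ?c k * ?g L k) \<longlonglongrightarrow> (euler * euler * inverse euler ^ 2) * mock_gf"
      unfolding mock_gf_def
    proof (rule fps_infsum_mult_tendsto[where e = "\<lambda>k. nat (k * (3 * k - 1) + 2 * \<bar>k\<bar>)"])
      show "finite {k \<in> UNIV - {0}. nat (k * (3 * k - 1) + 2 * \<bar>k\<bar>) \<le> n}" for n
        by (rule finite_int_le[where c = 0]) (use pent_abs_le order_trans[OF abs_ge_zero pent_abs_le] in simp)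
      show "?c k $ i = 0" if "i < nat (k * (3 * k - 1) + 2 * \<bar>k\<bar>)" for k i
        by (rule X_power_mult_order(2)[OF that])
      show "\<forall>\<^sub>F N in sequentially. k \<in> {- int N..int N} - {0}" if "k \<in> UNIV - {0}" for k
        by (rule eventually_mono[OF eventually_in_int_window[of k]]) (use that in auto)
      show "(\<lambda>L. ?g L k) \<longlonglongrightarrow> euler * euler * inverse euler ^ 2" for k
        by (intro fps_tendsto_mult tendsto_qf tendsto_iqf2)
    qed auto
    also have "euler * euler * inverse euler ^ 2 = (euler * inverse euler) * (euler * inverse euler :: 'a fps)"
      by (simp only: power2_eq_square mult_ac)
    finally have lim: "(\<lambda>L. \<Sum>k\<in>{- int L..int L} - {0}. ?c k * ?g L k) \<longlonglongrightarrow> mock_gf"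
      by simp
    have eq: "(\<Sum>k\<in>{- int L..int L} - {0}. ?c k * ?g L k)
      = (\<Sum>k\<in>{1..L}. fps_X ^ (2 * k) * inverse (1 - fps_X ^ (2 * k)) ^ 2 * qf L ^ 2 * bailey_term L k)" for L
      unfolding sum_int_symmetric
    proof (rule sum.cong[OF refl])
      fix k assume "k \<in> {1..L}"
      have e: "nat (int k * (3 * int k - 1) + 2 * \<bar>int k\<bar>) = 2 * k + k * (3 * k - 1)"
        "nat (- int k * (3 * - int k - 1) + 2 * \<bar>- int k\<bar>) = 2 * k + k * (3 * k + 1)"
        by (cases k; simp add: nat_mult_distrib nat_add_distrib algebra_simps flip: of_nat_mult of_nat_add)+
      have a: "nat (2 * \<bar>int k\<bar>) = 2 * k" "nat (2 * \<bar>- int k\<bar>) = 2 * k" by auto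
      have gen: "s * (z * b) * i ^ 2 * (q * q * r) + s * (z * a) * i ^ 2 * (q * q * r)
          = z * i ^ 2 * q ^ 2 * (s * (a + b) * r)" for s z a b i q r :: "'a fps"
        by (simp add: algebra_simps power2_eq_square)
      show "?c (int k) * ?g L (int k) + ?c (- int k) * ?g L (- int k)
        = fps_X ^ (2 * k) * inverse (1 - fps_X ^ (2 * k)) ^ 2 * qf L ^ 2 * bailey_term L k"
        unfolding e a bailey_term_def power_add[of fps_X "2 * k"] alt_sign_simps by (rule gen)
    qed
    show "(\<lambda>L. \<Sum>k\<in>{1..L}. fps_X ^ (2 * k) * inverse (1 - fps_X ^ (2 * k)) ^ 2 * qf L ^ 2 * bailey_term L k :: 'a fps) \<longlonglongrightarrow> mock_gf"
      using lim unfolding eq .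
  qed
  ultimately show ?thesis by (rule LIMSEQ_unique)
qed

subsection \<open>The divisor part\<close>

lemma X_deriv_nth: "(fps_X * fps_deriv f) $ n = of_nat n * (f $ n :: 'a::comm_ring_1)"
  by (cases n) (auto simp: fps_X_mult_nth)

lemma inverse_one_minus_X_power_nth:
  assumes "k > 0"
  shows "inverse (1 - fps_X ^ k) = Abs_fps (\<lambda>n. of_bool (k dvd n) :: 'a::field)"
proof -
  have "(1 - fps_X ^ k) * Abs_fps (\<lambda>n. of_bool (k dvd n)) = (1 :: 'a fps)"
  proof (rule fps_ext)
    fix n show "((1 - fps_X ^ k) * Abs_fps (\<lambda>n. of_bool (k dvd n))) $ n = (1 :: 'a fps) $ n"
      using assms by (auto simp: left_diff_distrib fps_X_power_mult_nth dvd_minus_self dest: dvd_imp_le)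
  qed
  then show ?thesis by (rule fps_inverse_unique)
qed

lemma X_power_inverse_square_nth:
  assumes "k > 0"
  shows "fps_X ^ k * inverse (1 - fps_X ^ k) ^ 2 = Abs_fps (\<lambda>n. if k dvd n then of_nat (n div k) else 0 :: 'a::field)"
    (is "?l = ?r")
proof -
  have "?r * (1 - fps_X ^ k) = fps_X ^ k * (inverse (1 - fps_X ^ k) :: 'a fps)"
  proof (rule fps_ext)
    fix n
    have "of_nat (n div k) - of_nat ((n - k) div k) = (1 :: 'a)" if "k \<le> n"
    proof -
      have "n div k = Suc ((n - k) div k)" using that assms by (simp add: le_div_geq)
      then show ?thesis by simp
    qed
    then show "(?r * (1 - fps_X ^ k)) $ n = (fps_X ^ k * (inverse (1 - fps_X ^ k) :: 'a fps)) $ n"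
      using assms unfolding inverse_one_minus_X_power_nth[OF assms]
      by (auto simp: right_diff_distrib fps_X_power_mult_nth fps_X_power_mult_right_nth dvd_minus_self not_less)
  qed
  then have "?r * (1 - fps_X ^ k) * inverse (1 - fps_X ^ k) = ?l"
    by (simp only: power2_eq_square mult.assoc)
  moreover have "?r * (1 - fps_X ^ k) * inverse (1 - fps_X ^ k) = ?r * (inverse (1 - fps_X ^ k) * (1 - fps_X ^ k))"
    by (simp only: mult_ac)
  ultimately show ?thesis using assms by simp
qed

text \<open>Both series have the divisor sum sigma(n) as n-th coefficient; the involution d -> n/d
  exchanges the two ways to write it.\<close>

lemma divisor_gf_alt:
  "fps_summable (\<lambda>n. of_nat n * fps_X ^ n * inverse (1 - fps_X ^ n) :: 'a::field fps) {1..}"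
  "divisor_gf = (fps_infsum (\<lambda>n. of_nat n * fps_X ^ n * inverse (1 - fps_X ^ n)) {1..} :: 'a::field fps)"
proof -
  have z: "(of_nat k * fps_X ^ k * inverse (1 - fps_X ^ k) :: 'a fps) $ n = 0" if "n < k" for k n
    using that by (simp add: mult.assoc fps_mult_of_nat_nth fps_X_power_mult_nth)
  show "fps_summable (\<lambda>n. of_nat n * fps_X ^ n * inverse (1 - fps_X ^ n) :: 'a fps) {1..}"
    by (rule fps_summable_order[where e = "\<lambda>n. n"]) (auto simp: z)
  show "divisor_gf = (fps_infsum (\<lambda>n. of_nat n * fps_X ^ n * inverse (1 - fps_X ^ n)) {1..} :: 'a fps)"
  proof (rule fps_ext)
    fix n
    have "divisor_gf $ n = (\<Sum>k\<in>{1..n}. (fps_X ^ k * inverse (1 - fps_X ^ k) ^ 2) $ n :: 'a)"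
      unfolding divisor_gf_def by (rule fps_infsum_nth) (auto simp: X_power_mult_order)
    also have "\<dots> = (\<Sum>k\<in>{1..n}. if k dvd n then of_nat (n div k) else 0)"
      by (intro sum.cong refl, subst X_power_inverse_square_nth) auto
    also have "\<dots> = (\<Sum>k\<in>{k\<in>{1..n}. k dvd n}. of_nat (n div k))"
      by (simp only: sum.inter_filter[OF finite_atLeastAtMost])
    also have "\<dots> = (\<Sum>k\<in>{k\<in>{1..n}. k dvd n}. of_nat k)"
      by (rule sum.reindex_bij_witness[of _ "\<lambda>k. n div k" "\<lambda>k. n div k"])
         (auto elim!: dvdE simp: Suc_le_eq)
    also have "\<dots> = (\<Sum>k\<in>{1..n}. (of_nat k * fps_X ^ k * inverse (1 - fps_X ^ k)) $ n)"
      unfolding sum.inter_filter[OF finite_atLeastAtMost]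
    proof (intro sum.cong refl)
      fix k assume "k \<in> {1..n}"
      then show "(if k dvd n then of_nat k else 0) = (of_nat k * fps_X ^ k * inverse (1 - fps_X ^ k) :: 'a fps) $ n"
        by (simp add: inverse_one_minus_X_power_nth mult.assoc fps_mult_of_nat_nth fps_X_power_mult_nth dvd_minus_self)
    qed
    also have "\<dots> = fps_infsum (\<lambda>n. of_nat n * fps_X ^ n * inverse (1 - fps_X ^ n)) {1..} $ n"
      by (rule fps_infsum_nth[symmetric]) (auto simp: z)
    finally show "divisor_gf $ n = (fps_infsum (\<lambda>n. of_nat n * fps_X ^ n * inverse (1 - fps_X ^ n)) {1..} :: 'a fps) $ n" .
  qed
qed

text \<open>The logarithmic derivative of the product, in the second form of
  \<open>divisor_gf\<close>, proved for finite products and passed to the limit.\<close>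

lemma X_deriv_euler: "fps_X * fps_deriv euler = - euler * (divisor_gf :: 'a::field fps)"
proof -
  let ?t = "\<lambda>n. of_nat n * fps_X ^ n * inverse (1 - fps_X ^ n) :: 'a fps"
  have fin: "fps_X * fps_deriv (qf n) = - qf n * (\<Sum>k\<in>{1..n}. ?t k)" for n
  proof (induction n)
    case (Suc n)
    let ?u = "1 - fps_X ^ Suc n :: 'a fps"
    have d: "fps_X * fps_deriv ?u = - (?t (Suc n) * ?u)"
    proof -
      have "?t (Suc n) * ?u = of_nat (Suc n) * fps_X ^ Suc n * (inverse ?u * ?u)"
        by (simp only: mult_ac)
      also have "inverse ?u * ?u = 1" by (rule inverse_one_minus_X_power) simp
      finally have "?t (Suc n) * ?u = of_nat (Suc n) * fps_X ^ Suc n" by (simp only: mult_1_right)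
      moreover have "fps_X * fps_deriv ?u = - (of_nat (Suc n) * (fps_X ^ Suc n :: 'a fps))"
        unfolding fps_deriv_sub fps_deriv_power by (simp add: fps_of_nat mult_ac del: of_nat_Suc)
      ultimately show ?thesis by simp
    qed
    have "fps_X * fps_deriv (qf (Suc n)) = (fps_X * fps_deriv (qf n)) * ?u + qf n * (fps_X * fps_deriv ?u)"
      unfolding qf_Suc fps_deriv_mult by (simp add: algebra_simps del: power_Suc)
    also have "\<dots> = - qf (Suc n) * ((\<Sum>k\<in>{1..n}. ?t k) + ?t (Suc n))"
      unfolding Suc d qf_Suc by (simp add: algebra_simps del: power_Suc of_nat_Suc)
    finally show ?case by simp
  qed simp
  have "(\<lambda>n. fps_X * fps_deriv (qf n) :: 'a fps) \<longlonglongrightarrow> fps_X * fps_deriv euler"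
    by (intro fps_tendsto_mult tendsto_const fps_tendsto_deriv tendsto_qf)
  moreover have "(\<lambda>n. - 1 * qf n * (\<Sum>k\<in>{1..n}. ?t k)) \<longlonglongrightarrow> - 1 * euler * divisor_gf"
    unfolding divisor_gf_alt(2)
  proof (intro fps_tendsto_mult tendsto_const tendsto_qf fps_infsum_tendsto)
    show "finite {k \<in> {1..}. \<exists>N. k \<in> {1..N} \<and> ?t k $ n \<noteq> 0}" for n
      by (rule finite_subset[OF _ divisor_gf_alt(1)[unfolded fps_summable_def, rule_format, of n]]) auto
  qed (auto intro: eventually_ge_at_top)
  ultimately show ?thesis unfolding fin by (simp add: LIMSEQ_unique)
qed

section \<open>Exponent classes modulo 5\<close>

definition fps_supp5 :: "nat \<Rightarrow> 'a::zero fps \<Rightarrow> bool" where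
  "fps_supp5 r f \<longleftrightarrow> (\<forall>n. n mod 5 \<noteq> r mod 5 \<longrightarrow> f $ n = 0)"

definition fps_vanish5 :: "nat \<Rightarrow> 'a::zero fps \<Rightarrow> bool" where
  "fps_vanish5 r f \<longleftrightarrow> (\<forall>n. n mod 5 = r mod 5 \<longrightarrow> f $ n = 0)"

lemma fps_supp5_mult:
  fixes f g :: "'a::comm_ring_1 fps"
  assumes "fps_supp5 r f" "fps_supp5 s g"
  shows "fps_supp5 (r + s) (f * g)"
  unfolding fps_supp5_def fps_mult_nth
proof (intro allI impI sum.neutral ballI)
  fix n i assume n: "n mod 5 \<noteq> (r + s) mod 5" and "i \<in> {0..n}"
  then have "(i + (n - i)) mod 5 = n mod 5" by simp
  then have "i mod 5 \<noteq> r mod 5 \<or> (n - i) mod 5 \<noteq> s mod 5" using n by (metis mod_add_cong)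
  then show "f $ i * g $ (n - i) = 0" using assms by (auto simp: fps_supp5_def)
qed

lemma fps_supp5_1: "fps_supp5 0 (1 :: 'a::zero_neq_one fps)"
  by (auto simp: fps_supp5_def)

lemma fps_supp5_prod:
  fixes f :: "'i \<Rightarrow> 'a::comm_ring_1 fps"
  assumes "\<And>i. i \<in> A \<Longrightarrow> fps_supp5 0 (f i)"
  shows "fps_supp5 0 (prod f A)"
  using assms
proof (induction A rule: infinite_finite_induct)
  case (insert x F)
  then show ?case using fps_supp5_mult[of 0 "f x" 0 "prod f F"] by simp
qed (simp_all add: fps_supp5_1)

lemma fps_supp5_X_power: "fps_supp5 n (fps_X ^ n :: 'a::comm_ring_1 fps)"
  by (auto simp: fps_supp5_def fps_X_power_nth)

lemma fps_supp5_one_minus: "5 dvd k \<Longrightarrow> fps_supp5 0 (1 - fps_X ^ k :: 'a::comm_ring_1 fps)"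
  by (auto simp: fps_supp5_def fps_X_power_nth)

lemma fps_supp5_qprod:
  assumes "\<And>k. k \<in> A \<Longrightarrow> 5 dvd k"
  shows "fps_supp5 0 (qprod A :: 'a::comm_ring_1 fps)"
  unfolding fps_supp5_def
proof (intro allI impI)
  fix n :: nat assume n: "n mod 5 \<noteq> 0 mod 5"
  have "fps_supp5 0 (\<Prod>k\<in>A \<inter> {1..n}. 1 - fps_X ^ k :: 'a fps)"
    by (intro fps_supp5_prod fps_supp5_one_minus) (use assms in auto)
  then show "(qprod A :: 'a fps) $ n = 0" using n by (simp add: qprod_def fps_supp5_def)
qed

lemma fps_tendsto_power:
  fixes g :: "'a::ring_1 fps"
  assumes "(f \<longlongrightarrow> g) F"
  shows "((\<lambda>x. f x ^ n) \<longlongrightarrow> g ^ n) F"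
  by (induction n) (auto intro: fps_tendsto_mult assms)

text \<open>The Frobenius map: each factor (1 - q^k)^5 equals 1 - q^(5k).\<close>

lemma fps_supp5_power5:
  assumes "(5 :: 'a::field) = 0"
  shows "fps_supp5 0 (qprod A ^ 5 :: 'a fps)"
  unfolding fps_supp5_def
proof (intro allI impI)
  fix n :: nat assume n: "n mod 5 \<noteq> 0 mod 5"
  have five: "(5 :: 'a fps) = 0" using assms by (simp add: numeral_fps_const)
  have p5: "(1 - x) ^ 5 = 1 - x ^ 5" for x :: "'a fps"
  proof -
    have "(1 - x) ^ 5 = 1 - x ^ 5 + 5 * (2 * x ^ 2 - x - 2 * x ^ 3 + x ^ 4)"
      by (simp add: algebra_simps power_numeral_reduce)
    then show ?thesis by (simp add: five)
  qed
  have "(\<lambda>N. (\<Prod>k\<in>A \<inter> {1..N}. 1 - fps_X ^ k)) \<longlonglongrightarrow> (qprod A :: 'a fps)"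
    by (rule tendsto_qprod) (auto intro: eventually_ge_at_top)
  then have "(\<lambda>N. (\<Prod>k\<in>A \<inter> {1..N}. 1 - fps_X ^ k) ^ 5) \<longlonglongrightarrow> (qprod A ^ 5 :: 'a fps)"
    by (rule fps_tendsto_power)
  then have "\<forall>\<^sub>F N in sequentially. (qprod A ^ 5 :: 'a fps) $ n = ((\<Prod>k\<in>A \<inter> {1..N}. 1 - fps_X ^ k) ^ 5) $ n"
    by (simp add: tendsto_fps_iff eq_commute)
  then obtain N where "(qprod A ^ 5 :: 'a fps) $ n = ((\<Prod>k\<in>A \<inter> {1..N}. 1 - fps_X ^ k) ^ 5) $ n"
    by (auto simp: eventually_sequentially)
  also have "fps_supp5 0 ((\<Prod>k\<in>A \<inter> {1..N}. 1 - fps_X ^ k) ^ 5 :: 'a fps)"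
    unfolding prod_power_distrib p5 power_mult[symmetric]
    by (intro fps_supp5_prod fps_supp5_one_minus) simp
  then have "((\<Prod>k\<in>A \<inter> {1..N}. 1 - fps_X ^ k) ^ 5 :: 'a fps) $ n = 0"
    using n by (simp add: fps_supp5_def)
  finally show "(qprod A ^ 5 :: 'a fps) $ n = 0" .
qed

text \<open>Multiplication by a unit in q^5 maps each class of exponents to itself invertibly; the
  induction recovers the coefficients of \<open>g\<close> one by one. This is how fifth powers are
  introduced and discarded.\<close>

lemma fps_vanish5_cancel:
  fixes f g :: "'a::field fps"
  assumes f: "fps_supp5 0 f" "f $ 0 \<noteq> 0" and fg: "fps_vanish5 r (f * g)"
  shows "fps_vanish5 r g"
  unfolding fps_vanish5_def
proof (intro allI impI)
  fix n :: nat assume "n mod 5 = r mod 5"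
  then show "g $ n = 0"
  proof (induction n rule: less_induct)
    case (less n)
    have "0 = (f * g) $ n" using fg less.prems by (simp add: fps_vanish5_def)
    also have "\<dots> = (\<Sum>i\<in>{0..n}. f $ i * g $ (n - i))" by (simp add: fps_mult_nth)
    also have "\<dots> = (\<Sum>i\<in>{0}. f $ i * g $ (n - i))"
    proof (rule sum.mono_neutral_right)
      show "\<forall>i\<in>{0..n} - {0}. f $ i * g $ (n - i) = 0"
      proof
        fix i assume i: "i \<in> {0..n} - {0}"
        show "f $ i * g $ (n - i) = 0"
        proof (cases "i mod 5 = 0")
          case True
          then obtain j where "i = 5 * j" by auto
          then have "n - i < n" "(n - i) mod 5 = r mod 5"
            using i less.prems mod_mult_self1[of "n - i" j 5] by auto
          then show ?thesis using less.IH by simp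
        next
          case False
          then show ?thesis using f(1) by (simp add: fps_supp5_def)
        qed
      qed
    qed auto
    finally show ?case using f(2) by simp
  qed
qed

lemma fps_supp5_inverse:
  fixes f :: "'a::field fps"
  assumes "fps_supp5 0 f" "f $ 0 \<noteq> 0"
  shows "fps_supp5 0 (inverse f)"
proof -
  have "fps_vanish5 r (inverse f)" if "r mod 5 \<noteq> 0" for r
  proof (rule fps_vanish5_cancel[OF assms])
    have "f * inverse f = 1" using assms(2) by (rule inverse_mult_eq_1')
    then show "fps_vanish5 r (f * inverse f)" using that by (auto simp: fps_vanish5_def)
  qed
  then show ?thesis by (auto simp: fps_supp5_def fps_vanish5_def)
qed

lemma of_nat_eq_0_5: "(5 :: 'a::field) = 0 \<Longrightarrow> 5 dvd n \<Longrightarrow> of_nat n = (0 :: 'a)"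
  by (elim dvdE) simp

text \<open>\<open>S/f\<^sub>2\<close> is \<open>- \<theta>(f\<^sub>1\<^sup>3) \<phi> / (3 f\<^sub>1\<^sup>5)\<close>; a contribution to \<open>q\<^sup>5\<^sup>n\<^sup>+\<^sup>3\<close> from
  \<open>q\<^bsup>k(k+1)/2\<^esup>\<close> and \<open>q\<^bsup>j\<^sup>2\<^esup>\<close> satisfies \<open>(2k+1)\<^sup>2 + 8 j\<^sup>2 \<equiv> 0\<close>, and \<open>-8\<close> is not a square modulo \<open>5\<close>.\<close>

lemma divisor_part_vanishes:
  assumes five: "(5 :: 'a::field) = 0"
  shows "fps_vanish5 3 (inverse (qprod {k. even k}) * divisor_gf :: 'a fps)"
proof (rule fps_vanish5_cancel[OF fps_supp5_power5[OF five, of UNIV]])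
  let ?f2 = "qprod {k. even k} :: 'a fps"
  let ?phi = "fps_infsum (\<lambda>k. alt_sign k * fps_X ^ nat (k * k)) UNIV :: 'a fps"
  let ?D = "fps_X * fps_deriv (euler ^ 3) :: 'a fps"
  show "euler ^ 5 $ 0 \<noteq> (0 :: 'a)" by (simp add: fps_power_zeroth)
  have "?D = 3 * euler ^ 2 * (fps_X * fps_deriv euler)"
    by (simp add: fps_deriv_power numeral_fps_const mult_ac)
  then have D: "?D = - 3 * (euler ^ 3 * divisor_gf)"
    by (simp add: X_deriv_euler power2_eq_square power3_eq_cube mult_ac)
  have "euler ^ 5 * (inverse ?f2 * divisor_gf) = euler ^ 3 * (inverse ?f2 * euler ^ 2) * divisor_gf"
    by (simp add: power_numeral_reduce mult_ac)
  also have "inverse ?f2 * euler ^ 2 = ?phi" unfolding gauss_square by (simp flip: mult.assoc)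
  \<comment> \<open>The derivative brings in the factor -3, and 6 = (-2)(-3) equals 1 in
    characteristic 5.\<close>
  also have "euler ^ 3 * ?phi * divisor_gf = (6 - 5) * (euler ^ 3 * ?phi * divisor_gf)" by simp
  also have "(5 :: 'a fps) = 0" using five by (simp add: numeral_fps_const)
  also have "(6 - 0) * (euler ^ 3 * ?phi * divisor_gf) = - 2 * (?D * ?phi)"
    unfolding D by (simp add: mult_ac)
  finally have eq: "euler ^ 5 * (inverse ?f2 * divisor_gf) = - 2 * (?D * ?phi)" .
  have phi: "?phi $ n = 0" if "n mod 5 \<noteq> 0" "n mod 5 \<noteq> 1" "n mod 5 \<noteq> 4" for n
  proof -
    have "nat (k * k) \<noteq> n" for k
    proof
      assume "nat (k * k) = n"
      then have "k * k mod 5 = int (n mod 5)" by (auto simp: zmod_int)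
      moreover have "k mod 5 = 0 \<or> k mod 5 = 1 \<or> k mod 5 = 2 \<or> k mod 5 = 3 \<or> k mod 5 = 4" by presburger
      then have "k * k mod 5 = 0 \<or> k * k mod 5 = 1 \<or> k * k mod 5 = 4"
        by (elim disjE) (simp_all add: mod_mult_eq[symmetric, of k k])
      ultimately show False using that by auto
    qed
    then show ?thesis by (subst fps_infsum_nth[of "{}"]) (auto simp: alt_sign_mult_nth fps_X_power_nth)
  qed
  \<comment> \<open>Triangular numbers are 0, 1 or 3 modulo 5, and 3 occurs only if k is 2 modulo 5,
    where the weight 2k + 1 is divisible by 5.\<close>
  have cube: "euler ^ 3 $ n = (0 :: 'a)" if n: "n mod 5 \<noteq> 0" "n mod 5 \<noteq> 1" for n
  proof -
    have "(of_nat (2 * k + 1) * (-1) ^ k * fps_X ^ (k * (k + 1) div 2) :: 'a fps) $ n = 0" for k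
    proof (cases "k * (k + 1) div 2 = n")
      case True
      have "2 dvd k * (k + 1)" by simp
      then have kn: "k * (k + 1) = 2 * n" using True by auto
      define r where "r = k mod 5"
      have m: "2 * n mod 5 = r * (r + 1) mod 5" unfolding kn[symmetric] r_def by (intro mod_mult_cong mod_add_cong) simp_all
      have "r < 5" by (simp add: r_def)
      then consider "r = 0" | "r = 1" | "r = 2" | "r = 3" | "r = 4" by linarith
      then have "r = 2"
      proof cases
        case 1
        then have "2 * n mod 5 = 0" using m by simp
        then show ?thesis using n by presburger
      next
        case 2
        then have "2 * n mod 5 = 2" using m by simp
        then show ?thesis using n by presburger
      next
        case 4
        then have "2 * n mod 5 = 2" using m by simp
        then show ?thesis using n by presburger
      next
        case 5
        then have "2 * n mod 5 = 0" using m by simp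
        then show ?thesis using n by presburger
      qed
      then have "k mod 5 = 2" by (simp add: r_def)
      then have "5 dvd 2 * k + 1" by presburger
      then have "of_nat (2 * k + 1) = (0 :: 'a fps)"
        using of_nat_eq_0_5[OF five, of "2 * k + 1"] by (metis fps_const_0_eq_0 fps_of_nat)
      then show ?thesis by simp
    next
      case False
      have "(of_nat (2 * k + 1) * (-1) ^ k :: 'a fps) = fps_const (of_nat (2 * k + 1) * (-1) ^ k)"
        by (simp only: fps_const_mult[symmetric] fps_const_power[symmetric] fps_const_neg[symmetric]
              fps_const_1_eq_1 fps_of_nat)
      then show ?thesis using False by (simp only: fps_mult_left_const_nth fps_X_power_nth) simp
    qed
    then show ?thesis unfolding jacobi_cube by (subst fps_infsum_nth[of "{}"]) auto
  qed
  show "fps_vanish5 3 (euler ^ 5 * (inverse ?f2 * divisor_gf))"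
    unfolding fps_vanish5_def
  proof (intro allI impI)
    fix n :: nat assume n: "n mod 5 = 3 mod 5"
    have "(?D * ?phi) $ n = 0"
      unfolding fps_mult_nth[of ?D]
    proof (intro sum.neutral ballI)
      fix i assume i: "i \<in> {0..n}"
      \<comment> \<open>The derivation kills exponents divisible by 5 and \<open>cube\<close> leaves
        only class 1. The theta factor would then need an exponent of class 2, which is not a
        square.\<close>
      consider "5 dvd i" | "i mod 5 = 1" | "i mod 5 \<noteq> 0" "i mod 5 \<noteq> 1" by (auto simp: dvd_eq_mod_eq_0)
      then show "?D $ i * ?phi $ (n - i) = 0"
      proof cases
        case 1
        then show ?thesis using of_nat_eq_0_5[OF five, of i] by (simp only: X_deriv_nth) simp
      next
        case 2
        moreover have "(i + (n - i)) mod 5 = 3" using n i by simp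
        moreover have "m mod 5 = 2" if "l mod 5 = 1" "(l + m) mod 5 = 3" for l m :: nat
        proof -
          have "(1 + m mod 5) mod 5 = 3" using that mod_add_eq[of l 5 m] by simp
          moreover have "m mod 5 = 0 \<or> m mod 5 = 1 \<or> m mod 5 = 2 \<or> m mod 5 = 3 \<or> m mod 5 = 4"
            using mod_less_divisor[of 5 m] by linarith
          ultimately show ?thesis by (elim disjE) simp_all
        qed
        ultimately have "(n - i) mod 5 = 2" by blast
        then show ?thesis using phi[of "n - i"] by simp
      next
        case 3
        then show ?thesis using cube[of i] by (simp only: X_deriv_nth) simp
      qed
    qed
    then show "(euler ^ 5 * (inverse ?f2 * divisor_gf)) $ n = 0"
      unfolding eq by (simp add: numeral_fps_const fps_const_neg[symmetric] del: fps_const_neg)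
  qed
qed

subsection \<open>Partial fractions\<close>

lemma lagrange_interpolation:
  fixes x :: "'i \<Rightarrow> 'b::field"
  assumes "finite M" "inj_on x M" "degree p < card M"
  shows "poly p t = (\<Sum>m\<in>M. poly p (x m) * (\<Prod>j\<in>M - {m}. (t - x j) / (x m - x j)))"
proof -
  define l where "l m = (\<Prod>j\<in>M - {m}. Polynomial.smult (1 / (x m - x j)) [:- x j, 1:])" for m
  define q where "q = (\<Sum>m\<in>M. Polynomial.smult (poly p (x m)) (l m))"
  have l: "poly (l m) t = (\<Prod>j\<in>M - {m}. (t - x j) / (x m - x j))" for m t
    by (simp add: l_def poly_prod diff_divide_distrib)
  have "card M > 0" using assms(3) by simp
  have degl: "degree (l m) \<le> card M - 1" if "m \<in> M" for m
  proof -
    have "degree (l m) \<le> (\<Sum>j\<in>M - {m}. degree (Polynomial.smult (1 / (x m - x j)) [:- x j, 1:]))"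
      unfolding l_def using degree_prod_sum_le[of "M - {m}" "\<lambda>j. Polynomial.smult (1 / (x m - x j)) [:- x j, 1:]"] assms(1)
      by (simp only: o_def finite_Diff)
    also have "\<dots> \<le> (\<Sum>j\<in>M - {m}. 1)"
      by (intro sum_mono order_trans[OF degree_smult_le]) simp
    finally show ?thesis using that assms(1) by simp
  qed
  have degq: "degree q \<le> card M - 1"
    unfolding q_def by (intro degree_sum_le assms(1) order_trans[OF degree_smult_le] degl)
  have "p = q"
  proof (rule poly_eqI_degree)
    fix z assume "z \<in> x ` M"
    then obtain i where i: "i \<in> M" "z = x i" by auto
    have "poly (l m) (x i) = (if m = i then 1 else 0)" if "m \<in> M" for m
    proof (cases "m = i")
      case True
      have "x i \<noteq> x j" if "j \<in> M - {i}" for j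
        using assms(2) i(1) that by (auto dest: inj_onD)
      then show ?thesis using True unfolding l by (auto intro!: prod.neutral)
    next
      case False
      then show ?thesis using assms(1) i(1) unfolding l by (auto intro!: prod_zero)
    qed
    then have "poly q z = (\<Sum>m\<in>M. poly p (x m) * (if m = i then 1 else 0))"
      unfolding q_def i(2) by (simp add: poly_sum)
    also have "\<dots> = (\<Sum>m\<in>M. if m = i then poly p (x m) else 0)" by (intro sum.cong) auto
    also have "\<dots> = poly p z" using i assms(1) by simp
    finally show "poly p z = poly q z" by simp
  qed (use assms degq \<open>card M > 0\<close> in \<open>simp_all add: card_image\<close>)
  then have "poly p t = poly q t" by simp
  then show ?thesis by (simp add: q_def poly_sum l)
qed

definition below :: "int set \<Rightarrow> int \<Rightarrow> int set" where "below M m = {j\<in>M. j < m}"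

text \<open>The power of \<open>u\<close> released when the factors with negative exponents, which
  belong to the nodes below \<open>m\<close>, are rewritten with positive ones; the number of these
  nodes gives the sign.\<close>

definition dist_below :: "int set \<Rightarrow> int \<Rightarrow> int" where "dist_below M m = (\<Sum>j\<in>below M m. m - j)"

lemma one_minus_powi_neg:
  fixes u :: "'b::field"
  assumes "u \<noteq> 0" "n < 0"
  shows "inverse (1 - u powi n) = - (u powi (- n) * inverse (1 - u ^ nat \<bar>n\<bar>))"
proof -
  have "u powi n * u powi (- n) = 1" using assms by (simp flip: power_int_add)
  moreover have n: "u ^ nat \<bar>n\<bar> = u powi (- n)" using assms by (simp add: power_int_def)
  ultimately have "1 - u powi n = - (u powi n * (1 - u ^ nat \<bar>n\<bar>))" by (simp add: algebra_simps)
  then have "inverse (1 - u powi n) = - (inverse (u powi n) * inverse (1 - u ^ nat \<bar>n\<bar>))"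
    by (simp add: inverse_mult_distrib)
  then show ?thesis by (simp add: power_int_minus)
qed

lemma prod_inverse_one_minus_powi:
  fixes u :: "'b::field"
  assumes "u \<noteq> 0" "finite M"
  shows "(\<Prod>j\<in>M - {m}. inverse (1 - u powi (j - m)))
    = (-1) ^ card (below M m) * u powi dist_below M m * (\<Prod>j\<in>M - {m}. inverse (1 - u ^ nat \<bar>j - m\<bar>))"
proof -
  let ?A = "below M m" and ?B = "{j\<in>M. j > m}"
  have AB: "M - {m} = ?A \<union> ?B" "?A \<inter> ?B = {}" "finite ?A" "finite ?B"
    using assms(2) by (auto simp: below_def)
  have pw: "(\<Prod>j\<in>S. u powi (m - j)) = u powi (\<Sum>j\<in>S. m - j)" if "finite S" for S
    using that by induction (use assms(1) in \<open>auto simp: power_int_add\<close>)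
  have B: "(\<Prod>j\<in>?B. inverse (1 - u powi (j - m))) = (\<Prod>j\<in>?B. inverse (1 - u ^ nat \<bar>j - m\<bar>))"
    by (rule prod.cong) (auto simp: power_int_def)
  have "(\<Prod>j\<in>?A. inverse (1 - u powi (j - m))) = (\<Prod>j\<in>?A. (-1) * u powi (m - j) * inverse (1 - u ^ nat \<bar>j - m\<bar>))"
    by (rule prod.cong) (use assms(1) in \<open>auto simp: below_def one_minus_powi_neg\<close>)
  also have "\<dots> = (-1) ^ card ?A * (\<Prod>j\<in>?A. u powi (m - j)) * (\<Prod>j\<in>?A. inverse (1 - u ^ nat \<bar>j - m\<bar>))"
    by (simp only: prod.distrib prod_constant)
  also have "(\<Prod>j\<in>?A. u powi (m - j)) = u powi dist_below M m"
    unfolding dist_below_def by (rule pw[OF AB(3)])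
  finally have A: "(\<Prod>j\<in>?A. inverse (1 - u powi (j - m)))
    = (-1) ^ card ?A * u powi dist_below M m * (\<Prod>j\<in>?A. inverse (1 - u ^ nat \<bar>j - m\<bar>))" .
  show ?thesis
    unfolding AB(1) prod.union_disjoint[OF AB(3,4,2)] A B by (simp add: mult_ac)
qed

text \<open>Lagrange interpolation of \<open>x\<^sup>K\<close> at the nodes \<open>u\<^bsup>-m\<^esup>\<close>, evaluated at \<open>x = 0\<close> and at \<open>x = 1\<close>.\<close>

lemma partial_fractions:
  fixes u :: "'b::field"
  assumes u: "u \<noteq> 0" "\<And>n. n > 0 \<Longrightarrow> u ^ n \<noteq> 1" and M: "finite M" "0 \<notin> M" and K: "K < card M"
  defines "P \<equiv> \<lambda>m. (-1) ^ card (below M m) * u powi (dist_below M m - int K * m)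
      * (\<Prod>j\<in>M - {m}. inverse (1 - u ^ nat \<bar>j - m\<bar>))"
  shows "K > 0 \<Longrightarrow> (\<Sum>m\<in>M. P m) = 0"
    and "(\<Sum>m\<in>M. P m * inverse (1 - u powi m))
       = (-1) ^ card (below M 0) * u powi dist_below M 0 * (\<Prod>j\<in>M. inverse (1 - u ^ nat \<bar>j\<bar>))"
proof -
  define x where "x j = u powi (- j)" for j
  have u1: "u powi n \<noteq> 1" if "n \<noteq> 0" for n
    using that u(2)[of "nat \<bar>n\<bar>"] by (cases "n > 0") (auto simp: power_int_def power_inverse)
  have inj: "inj_on x M"
  proof
    fix i j assume "x i = x j"
    then have "u powi (j - i) = 1" using u(1) by (simp add: x_def power_int_diff power_int_minus)
    then show "i = j" using u1[of "j - i"] by fastforce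
  qed
  have P: "P m = x m ^ K * (\<Prod>j\<in>M - {m}. inverse (1 - u powi (j - m)))" for m
  proof -
    have "x m ^ K = u powi (- (int K * m))" by (simp add: x_def power_int_mult[symmetric] mult.commute flip: power_int_of_nat)
    then show ?thesis
      unfolding P_def prod_inverse_one_minus_powi[OF u(1) M(1)] by (simp add: power_int_add[OF disjI1[OF u(1)], of _ "- (int K * m)", simplified])
  qed
  have deg: "degree (Polynomial.monom (1 :: 'b) K) < card M" using K by (simp add: degree_monom_eq)
  have xne: "x j \<noteq> 0" for j using u(1) by (simp add: x_def)
  have xdiv: "x m / x j = u powi (j - m)" for m j
    using u(1) by (simp add: x_def power_int_diff power_int_minus field_simps)
  show "(\<Sum>m\<in>M. P m) = 0" if "K > 0"
  proof -
    have "(0 - x j) / (x m - x j) = inverse (1 - u powi (j - m))" for m j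
    proof -
      have "x m - x j = (0 - x j) * (1 - u powi (j - m))" using xne[of j] by (simp add: algebra_simps flip: xdiv)
      then show ?thesis using xne[of j] by (simp add: inverse_eq_divide)
    qed
    then have "(\<Sum>m\<in>M. P m) = (\<Sum>m\<in>M. x m ^ K * (\<Prod>j\<in>M - {m}. (0 - x j) / (x m - x j)))"
      by (simp only: P)
    also have "\<dots> = 0"
      using lagrange_interpolation[OF M(1) inj deg, of 0] that by (simp only: poly_monom zero_power mult_1 mult_zero_right)
    finally show ?thesis .
  qed
  have q: "(1 - x j) / (x m - x j) = (1 - u powi j) * inverse (1 - u powi (j - m))" for m j
  proof -
    have "u powi j * x j = 1" using u(1) by (simp add: x_def power_int_minus)
    then have "1 - x j = (- x j) * (1 - u powi j)" by (simp add: algebra_simps)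
    moreover have "x m - x j = (- x j) * (1 - u powi (j - m))" using xne[of j] by (simp add: algebra_simps flip: xdiv)
    ultimately show ?thesis using xne[of j] by (simp add: inverse_eq_divide)
  qed
  have one: "(\<Sum>m\<in>M. x m ^ K * (\<Prod>j\<in>M - {m}. (1 - u powi j) * inverse (1 - u powi (j - m)))) = 1"
    using lagrange_interpolation[OF M(1) inj deg, of 1, symmetric] unfolding q poly_monom power_one mult_1 .
  \<comment> \<open>Dividing the interpolation identity at 1 by the full product turns the missing
    factor of each term into the pole \<open>inverse (1 - u powi m)\<close>.\<close>
  have "(\<Prod>j\<in>M. inverse (1 - u powi j))
      = (\<Sum>m\<in>M. x m ^ K * (\<Prod>j\<in>M - {m}. (1 - u powi j) * inverse (1 - u powi (j - m)))) * (\<Prod>j\<in>M. inverse (1 - u powi j))"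
    by (simp only: one mult_1)
  also have "\<dots> = (\<Sum>m\<in>M. x m ^ K * ((\<Prod>j\<in>M - {m}. 1 - u powi j) * (\<Prod>j\<in>M - {m}. inverse (1 - u powi (j - m)))) * (\<Prod>j\<in>M. inverse (1 - u powi j)))"
    unfolding prod.distrib sum_distrib_right ..
  also have "\<dots> = (\<Sum>m\<in>M. P m * inverse (1 - u powi m))"
  proof (rule sum.cong[OF refl])
    fix m assume m: "m \<in> M"
    have ne: "1 - u powi j \<noteq> 0" if "j \<in> M" for j using u1[of j] that M(2) by auto
    have "(\<Prod>j\<in>M. inverse (1 - u powi j)) = inverse (1 - u powi m) * (\<Prod>j\<in>M - {m}. inverse (1 - u powi j))"
      using m M(1) by (rule prod.remove[rotated])
    moreover have i1: "(\<Prod>j\<in>M - {m}. 1 - u powi j) * (\<Prod>j\<in>M - {m}. inverse (1 - u powi j)) = 1"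
      unfolding prod.distrib[symmetric] by (rule prod.neutral) (use ne in auto)
    moreover have ac: "y * (b * c) * (v * w) = y * c * v" if "b * w = 1" for y b c v w :: 'b
    proof -
      have "y * (b * c) * (v * w) = (y * c * v) * (b * w)" by (simp only: mult_ac)
      then show ?thesis using that by simp
    qed
    ultimately show "x m ^ K * ((\<Prod>j\<in>M - {m}. 1 - u powi j) * (\<Prod>j\<in>M - {m}. inverse (1 - u powi (j - m)))) * (\<Prod>j\<in>M. inverse (1 - u powi j))
       = P m * inverse (1 - u powi m)"
      unfolding P using ac[OF i1] by simp
  qed
  finally show "(\<Sum>m\<in>M. P m * inverse (1 - u powi m))
       = (-1) ^ card (below M 0) * u powi dist_below M 0 * (\<Prod>j\<in>M. inverse (1 - u ^ nat \<bar>j\<bar>))"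
    using prod_inverse_one_minus_powi[OF u(1) M(1), of 0] M(2) by simp
qed

lemma fps_tendsto_sum:
  fixes g :: "'i \<Rightarrow> 'a::ab_group_add fps"
  assumes "\<And>i. i \<in> I \<Longrightarrow> (f i \<longlongrightarrow> g i) F"
  shows "((\<lambda>x. \<Sum>i\<in>I. f i x) \<longlongrightarrow> (\<Sum>i\<in>I. g i)) F"
  using assms by (induction I rule: infinite_finite_induct) (auto intro: fps_tendsto_add)

section \<open>Periodic node sets and their limits\<close>

definition window :: "int set \<Rightarrow> nat \<Rightarrow> int set" where
  "window C N = {m\<in>{- 5 * int N..<5 * int N}. m mod 5 \<in> C}"

lemma finite_window [simp]: "finite (window C N)"
  unfolding window_def by (rule finite_subset[of _ "{- 5 * int N..<5 * int N}"]) auto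

text \<open>The hypothesis says that \<open>e\<close> is a second discrete antiderivative of the
  indicator of the nodes. Counting nodes below \<open>m\<close> sums the indicator once, adding
  their distances sums it twice, so both are given by \<open>e\<close> up to constants and a linear
  term fixed at the left end.\<close>

lemma window_below:
  assumes sd: "\<And>m. e (m + 1) - 2 * e m + e (m - 1) = (of_bool (m mod 5 \<in> C) :: int)"
    and m: "- 5 * int N \<le> m" "m \<le> 5 * int N"
  defines "L \<equiv> - 5 * int N"
  shows "int (card (below (window C N) m)) = e (L - 1) - e L + e m - e (m - 1) \<and>
    dist_below (window C N) m = (m - L) * (e (L - 1) - e L) + e m - e L"
  using m
proof (induction m rule: int_ge_induct)
  case base
  have "below (window C N) (- 5 * int N) = {}" by (auto simp: below_def window_def)
  then show ?case by (simp add: dist_below_def L_def)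
next
  case (step m)
  let ?W = "window C N"
  let ?B = "if m mod 5 \<in> C then {m} else {}"
  have fin: "finite (below ?W m)" by (auto simp: below_def)
  have W: "below ?W (m + 1) = below ?W m \<union> ?B" "below ?W m \<inter> ?B = {}"
  proof -
    have "x \<in> below ?W (m + 1) \<longleftrightarrow> x \<in> below ?W m \<union> ?B" for x
      by (cases "x = m") (use step.hyps step.prems in \<open>auto simp: below_def window_def\<close>)
    then show "below ?W (m + 1) = below ?W m \<union> ?B" by blast
  qed (simp add: below_def)
  have c: "int (card (below ?W (m + 1))) = int (card (below ?W m)) + of_bool (m mod 5 \<in> C)"
    unfolding W(1) using W(2) fin by (subst card_Un_disjoint) auto
  have "dist_below ?W (m + 1) = (\<Sum>j\<in>below ?W (m + 1). (m - j) + 1)"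
    unfolding dist_below_def by (intro sum.cong) auto
  also have "\<dots> = (\<Sum>j\<in>below ?W (m + 1). m - j) + int (card (below ?W (m + 1)))"
    by (simp add: sum.distrib)
  also have "(\<Sum>j\<in>below ?W (m + 1). m - j) = dist_below ?W m"
    unfolding dist_below_def W(1) using W(2) fin by (subst sum.union_disjoint) auto
  finally have d: "dist_below ?W (m + 1) = dist_below ?W m + int (card (below ?W (m + 1)))" .
  have IH: "int (card (below ?W m)) = e (L - 1) - e L + e m - e (m - 1)"
      "dist_below ?W m = (m - L) * (e (L - 1) - e L) + e m - e L"
    using step by auto
  have "int (card (below ?W (m + 1))) = e (L - 1) - e L + e (m + 1) - e m"
    unfolding c IH sd[symmetric] by simp
  then show ?case unfolding d IH by (simp add: algebra_simps)
qed

text \<open>The expansion of 1/(1 - q^(dm)) in nonnegative powers of q; for \<open>m < 0\<close> it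
  uses 1/(1 - 1/x) = -x/(1 - x).\<close>

definition geom :: "nat \<Rightarrow> int \<Rightarrow> 'a::field fps" where
  "geom d m = (if m > 0 then inverse (1 - fps_X ^ (d * nat \<bar>m\<bar>))
     else - (fps_X ^ (d * nat \<bar>m\<bar>) * inverse (1 - fps_X ^ (d * nat \<bar>m\<bar>))))"

lemma fps_to_fls_prod: "fps_to_fls (prod f A) = (\<Prod>i\<in>A. fps_to_fls (f i :: 'a::field fps))"
  by (induction A rule: infinite_finite_induct) (simp_all add: fls_times_fps_to_fls)

lemma fps_to_fls_sum: "fps_to_fls (sum f A) = (\<Sum>i\<in>A. fps_to_fls (f i :: 'a::field fps))"
  by (induction A rule: infinite_finite_induct) simp_all

text \<open>There are 6N nodes. Interpolating the power of degree 3N + k, about half of that,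
  cancels the part of \<open>dist_below\<close> that is linear in \<open>m\<close> with slope 3N;
  the remaining exponent \<open>e m - k * m\<close> is independent of \<open>N\<close>, which makes
  a limit possible. The shift \<open>l\<close> makes exponents nonnegative.\<close>

lemma partial_fractions_fps:
  fixes e :: "int \<Rightarrow> int"
  assumes sd: "\<And>m. e (m + 1) - 2 * e m + e (m - 1) = of_bool (m mod 5 \<in> C)"
    and e: "0 \<notin> C" "e 0 = 0" "e (- 1) = 0" "e (- 5 * int N - 1) - e (- 5 * int N) = 3 * int N"
      "e (5 * int N) - e (5 * int N - 1) = 3 * int N"
    and d: "d > 0" and N: "N > 0"
  defines "P \<equiv> \<lambda>m. \<Prod>j\<in>window C N - {m}. inverse (1 - fps_X ^ (d * nat \<bar>j - m\<bar>) :: 'a::field fps)"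
  shows "k < 3 * N \<Longrightarrow> (\<And>m. e m - int k * m + l \<ge> 0) \<Longrightarrow>
       (\<Sum>m\<in>window C N. alt_sign (e m - e (m - 1)) * fps_X ^ (d * nat (e m - int k * m + l)) * P m) = 0"
    and "(\<And>m. e m \<ge> 0) \<Longrightarrow>
       (\<Sum>m\<in>window C N. alt_sign (e m - e (m - 1)) * fps_X ^ (d * nat (e m)) * geom d m * P m) = P 0"
proof -
  let ?W = "window C N"
  define L where "L = - 5 * int N"
  define u where "u = (fls_X ^ d :: 'a fls)"
  have X: "fps_to_fls (fps_X ^ (d * n)) = u ^ n" for n
    by (simp add: u_def fps_to_fls_power power_mult)
  have u: "u \<noteq> 0" "u ^ n \<noteq> 1" if "n > 0" for n
  proof -
    show "u \<noteq> 0" by (simp add: u_def)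
    have "fps_X ^ (d * n) \<noteq> (1 :: 'a fps)" using fps_X_power_nonzero[of "d * n", where ?'a = 'a] that d by auto
    then show "u ^ n \<noteq> 1" using fps_to_fls_eq_1_iff[of "fps_X ^ (d * n) :: 'a fps"] unfolding X by simp
  qed
  have u0: "u \<noteq> 0" using u(1)[of 1] by simp
  have inv: "fps_to_fls (inverse (1 - fps_X ^ (d * n))) = inverse (1 - u ^ n)" if "n > 0" for n
  proof -
    have "fps_to_fls ((1 - fps_X ^ (d * n)) * inverse (1 - fps_X ^ (d * n) :: 'a fps)) = 1"
      using that d inverse_one_minus_X_power[of "d * n", where ?'a = 'a] by (simp add: mult.commute)
    then show ?thesis
      unfolding fls_times_fps_to_fls fps_to_fls_minus X fps_one_to_fls by (rule inverse_unique[symmetric])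
  qed
  have P: "fps_to_fls (P m) = (\<Prod>j\<in>?W - {m}. inverse (1 - u ^ nat \<bar>j - m\<bar>))" for m
    unfolding P_def fps_to_fls_prod by (intro prod.cong refl inv) auto
  have W0: "0 \<notin> ?W" using e(1) by (simp add: window_def)
  have cb: "int (card (below ?W m)) = 3 * int N + (e m - e (m - 1))"
      "dist_below ?W m = 3 * int N * (m - L) + e m - e L" if "- 5 * int N \<le> m" "m \<le> 5 * int N" for m
    using window_below[OF sd that] e(4) by (simp_all add: L_def)
  have cardW: "card ?W = 6 * N"
  proof -
    have "below ?W (5 * int N) = ?W" by (auto simp: below_def window_def)
    then show ?thesis using cb(1)[of "5 * int N"] e(5) by simp
  qed
  have sgn: "(-1 :: 'a fls) ^ card (below ?W m) = (-1) ^ (3 * N) * fps_to_fls (alt_sign (e m - e (m - 1)))"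
    if "- 5 * int N \<le> m" "m \<le> 5 * int N" for m
  proof -
    have "even (card (below ?W m)) \<longleftrightarrow> (even (3 * N) \<longleftrightarrow> even (e m - e (m - 1)))"
      using cb(1)[OF that] by (metis even_add even_of_nat of_nat_mult of_nat_numeral)
    then show ?thesis by (cases "even (3 * N)") (auto simp: alt_sign_def)
  qed
  have inW: "- 5 * int N \<le> m" "m \<le> 5 * int N" if "m \<in> ?W" for m
    using that by (auto simp: window_def)
  show "(\<Sum>m\<in>?W. alt_sign (e m - e (m - 1)) * fps_X ^ (d * nat (e m - int k * m + l)) * P m) = 0"
    if k: "k < 3 * N" "\<And>m. e m - int k * m + l \<ge> 0"
  proof -
    \<comment> \<open>The part of the exponent that does not depend on \<open>m\<close>. It may be
      negative, but as a power of the Laurent unit \<open>u\<close> it cancels at the end.\<close>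
    let ?Z = "- (3 * int N * L) - e L - l"
    have "0 = (\<Sum>m\<in>?W. (-1) ^ card (below ?W m) * u powi (dist_below ?W m - int (3 * N + k) * m)
        * (\<Prod>j\<in>?W - {m}. inverse (1 - u ^ nat \<bar>j - m\<bar>)))"
      by (rule partial_fractions(1)[OF u0 u(2) finite_window W0, symmetric]) (use k(1) N in \<open>auto simp: cardW\<close>)
    also have "\<dots> = (\<Sum>m\<in>?W. (-1) ^ (3 * N) * u powi ?Z *
        fps_to_fls (alt_sign (e m - e (m - 1)) * fps_X ^ (d * nat (e m - int k * m + l)) * P m))"
    proof (rule sum.cong[OF refl])
      fix m assume m: "m \<in> ?W"
      have "dist_below ?W m - int (3 * N + k) * m = ?Z + int (nat (e m - int k * m + l))"
        unfolding cb(2)[OF inW[OF m]] using k(2)[of m] by (simp add: algebra_simps)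
      then have "u powi (dist_below ?W m - int (3 * N + k) * m) = u powi ?Z * u ^ nat (e m - int k * m + l)"
        by (simp only: power_int_add[OF disjI1[OF u0]] power_int_of_nat)
      then show "(-1) ^ card (below ?W m) * u powi (dist_below ?W m - int (3 * N + k) * m)
          * (\<Prod>j\<in>?W - {m}. inverse (1 - u ^ nat \<bar>j - m\<bar>))
        = (-1) ^ (3 * N) * u powi ?Z *
          fps_to_fls (alt_sign (e m - e (m - 1)) * fps_X ^ (d * nat (e m - int k * m + l)) * P m)"
        unfolding sgn[OF inW[OF m]] fls_times_fps_to_fls P X by (simp only: mult_ac)
    qed
    also have "\<dots> = (-1) ^ (3 * N) * u powi ?Z *
        fps_to_fls (\<Sum>m\<in>?W. alt_sign (e m - e (m - 1)) * fps_X ^ (d * nat (e m - int k * m + l)) * P m)"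
      by (simp only: sum_distrib_left fps_to_fls_sum)
    finally show ?thesis using u0 by simp
  qed
  show "(\<Sum>m\<in>?W. alt_sign (e m - e (m - 1)) * fps_X ^ (d * nat (e m)) * geom d m * P m) = P 0"
    if k: "\<And>m. e m \<ge> 0"
  proof -
    let ?Z = "- (3 * int N * L) - e L"
    have geom: "inverse (1 - u powi m) = fps_to_fls (geom d m)" if "m \<noteq> 0" for m
    proof (cases "m > 0")
      case True
      then show ?thesis using inv[of "nat \<bar>m\<bar>"] by (simp add: geom_def power_int_def)
    next
      case False
      then have "u powi (- m) = u ^ nat \<bar>m\<bar>" by (simp add: power_int_def)
      then show ?thesis
        using one_minus_powi_neg[OF u0, of m] False that inv[of "nat \<bar>m\<bar>"] X
        by (simp add: geom_def fls_times_fps_to_fls)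
    qed
    have bnd: "- 5 * int N \<le> 0" "0 \<le> 5 * int N" by auto
    have "(-1) ^ (3 * N) * u powi ?Z * fps_to_fls (P 0)
       = (-1) ^ card (below ?W 0) * u powi dist_below ?W 0 * (\<Prod>j\<in>?W. inverse (1 - u ^ nat \<bar>j\<bar>))"
      unfolding sgn[OF bnd] cb(2)[OF bnd] P using W0 e by (simp add: algebra_simps)
    also have "\<dots> = (\<Sum>m\<in>?W. (-1) ^ card (below ?W m) * u powi (dist_below ?W m - int (3 * N) * m)
        * (\<Prod>j\<in>?W - {m}. inverse (1 - u ^ nat \<bar>j - m\<bar>)) * inverse (1 - u powi m))"
      by (rule partial_fractions(2)[OF u0 u(2) finite_window W0, symmetric]) (use N in \<open>auto simp: cardW\<close>)
    also have "\<dots> = (\<Sum>m\<in>?W. (-1) ^ (3 * N) * u powi ?Z *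
        fps_to_fls (alt_sign (e m - e (m - 1)) * fps_X ^ (d * nat (e m)) * geom d m * P m))"
    proof (rule sum.cong[OF refl])
      fix m assume m: "m \<in> ?W"
      have "dist_below ?W m - int (3 * N) * m = ?Z + int (nat (e m))"
        unfolding cb(2)[OF inW[OF m]] using k[of m] by (simp add: algebra_simps)
      then have "u powi (dist_below ?W m - int (3 * N) * m) = u powi ?Z * u ^ nat (e m)"
        by (simp only: power_int_add[OF disjI1[OF u0]] power_int_of_nat)
      moreover have "inverse (1 - u powi m) = fps_to_fls (geom d m)" by (rule geom) (use m W0 in auto)
      ultimately show "(-1) ^ card (below ?W m) * u powi (dist_below ?W m - int (3 * N) * m)
          * (\<Prod>j\<in>?W - {m}. inverse (1 - u ^ nat \<bar>j - m\<bar>)) * inverse (1 - u powi m)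
        = (-1) ^ (3 * N) * u powi ?Z *
          fps_to_fls (alt_sign (e m - e (m - 1)) * fps_X ^ (d * nat (e m)) * geom d m * P m)"
        unfolding sgn[OF inW[OF m]] fls_times_fps_to_fls P X by (simp only: mult_ac)
    qed
    also have "\<dots> = (-1) ^ (3 * N) * u powi ?Z *
        fps_to_fls (\<Sum>m\<in>?W. alt_sign (e m - e (m - 1)) * fps_X ^ (d * nat (e m)) * geom d m * P m)"
      by (simp only: sum_distrib_left fps_to_fls_sum)
    finally show ?thesis using u0 by simp
  qed
qed

text \<open>The limit of the product over all nodes other than \<open>m\<close>, by distance to the
  right and to the left of \<open>m\<close>. Distance 0, the node itself, is dropped because
  \<open>qprod\<close> ignores 0.\<close>

definition two_sided_prod :: "int set \<Rightarrow> nat \<Rightarrow> int \<Rightarrow> 'a::comm_ring_1 fps" where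
  "two_sided_prod C d m = qprod ((*) d ` {k. (m + int k) mod 5 \<in> C}) * qprod ((*) d ` {k. (m - int k) mod 5 \<in> C})"

lemma two_sided_prod_mod: "two_sided_prod C d (m mod 5) = two_sided_prod C d m"
  by (simp add: two_sided_prod_def mod_add_left_eq mod_diff_left_eq)

lemma two_sided_prod_nth_0 [simp]: "two_sided_prod C d m $ 0 = 1"
  by (simp add: two_sided_prod_def)

lemma tendsto_window_prod:
  assumes "d > 0"
  shows "(\<lambda>N. \<Prod>j\<in>window C N - {m}. inverse (1 - fps_X ^ (d * nat \<bar>j - m\<bar>)))
    \<longlonglongrightarrow> inverse (two_sided_prod C d m :: 'a::field fps)"
proof -
  let ?A = "\<lambda>N. {j\<in>window C N. j > m}" and ?B = "\<lambda>N. {j\<in>window C N. j < m}"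
  let ?f = "\<lambda>j. d * nat \<bar>j - m\<bar>"
  have inj: "inj_on ?f (?A N)" "inj_on ?f (?B N)" for N
    using assms by (auto simp: inj_on_def)
  have "(\<Prod>j\<in>window C N - {m}. inverse (1 - fps_X ^ ?f j))
    = inverse ((\<Prod>k\<in>?f ` ?A N. 1 - fps_X ^ k) * (\<Prod>k\<in>?f ` ?B N. 1 - fps_X ^ k) :: 'a fps)" for N
  proof -
    have AB: "window C N - {m} = ?A N \<union> ?B N" "?A N \<inter> ?B N = {}" by auto
    have "(\<Prod>k\<in>?f ` ?A N. 1 - fps_X ^ k) * (\<Prod>k\<in>?f ` ?B N. 1 - fps_X ^ k :: 'a fps)
       = (\<Prod>j\<in>window C N - {m}. 1 - fps_X ^ ?f j)"
      unfolding AB(1) prod.reindex[OF inj(1)] prod.reindex[OF inj(2)] o_def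
      by (rule prod.union_disjoint[symmetric]) auto
    moreover have "(\<Prod>j\<in>window C N - {m}. 1 - fps_X ^ ?f j) * (\<Prod>j\<in>window C N - {m}. inverse (1 - fps_X ^ ?f j)) = (1 :: 'a fps)"
      unfolding prod.distrib[symmetric]
      by (rule prod.neutral) (use assms inverse_one_minus_X_power[where ?'a = 'a] in \<open>auto simp: mult.commute\<close>)
    ultimately show ?thesis by (simp add: fps_inverse_unique)
  qed
  moreover have "(\<lambda>N. \<Prod>k\<in>?f ` ?A N. 1 - fps_X ^ k) \<longlonglongrightarrow> (qprod ((*) d ` {k. (m + int k) mod 5 \<in> C}) :: 'a fps)"
  proof (rule tendsto_qprod)
    show "?f ` ?A N \<subseteq> (*) d ` {k. (m + int k) mod 5 \<in> C}" for N
    proof safe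
      fix j assume "j \<in> window C N" "m < j"
      then show "?f j \<in> (*) d ` {k. (m + int k) mod 5 \<in> C}"
        by (intro imageI) (auto simp: window_def)
    qed
    show "0 \<notin> ?f ` ?A N" for N using assms by auto
    fix k assume "k \<in> (*) d ` {k. (m + int k) mod 5 \<in> C}" "0 < k"
    then obtain i where i: "k = d * i" "(m + int i) mod 5 \<in> C" "i > 0" by auto
    show "\<forall>\<^sub>F N in sequentially. k \<in> ?f ` ?A N"
      using eventually_ge_at_top[of "nat \<bar>m\<bar> + i + 1"]
    proof eventually_elim
      case (elim N)
      then show ?case using i by (intro image_eqI[of _ _ "m + int i"]) (auto simp: window_def)
    qed
  qed auto
  moreover have "(\<lambda>N. \<Prod>k\<in>?f ` ?B N. 1 - fps_X ^ k) \<longlonglongrightarrow> (qprod ((*) d ` {k. (m - int k) mod 5 \<in> C}) :: 'a fps)"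
  proof (rule tendsto_qprod)
    show "?f ` ?B N \<subseteq> (*) d ` {k. (m - int k) mod 5 \<in> C}" for N
    proof safe
      fix j assume "j \<in> window C N" "j < m"
      then show "?f j \<in> (*) d ` {k. (m - int k) mod 5 \<in> C}"
        by (intro imageI) (auto simp: window_def)
    qed
    show "0 \<notin> ?f ` ?B N" for N using assms by auto
    fix k assume "k \<in> (*) d ` {k. (m - int k) mod 5 \<in> C}" "0 < k"
    then obtain i where i: "k = d * i" "(m - int i) mod 5 \<in> C" "i > 0" by auto
    show "\<forall>\<^sub>F N in sequentially. k \<in> ?f ` ?B N"
      using eventually_ge_at_top[of "nat \<bar>m\<bar> + i + 1"]
    proof eventually_elim
      case (elim N)
      then show ?case using i by (intro image_eqI[of _ _ "m - int i"]) (auto simp: window_def)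
    qed
  qed auto
  ultimately show ?thesis
    unfolding two_sided_prod_def by (simp only:) (intro fps_tendsto_inverse fps_tendsto_mult, auto)
qed

text \<open>The product attached to \<open>m\<close> has a limit that depends on the residue class only, so the limit of
  a sum over windows is taken class by class.\<close>

lemma tendsto_window_sum:
  fixes c :: "int \<Rightarrow> 'a::field fps"
  assumes d: "d > 0" and C: "finite C"
    and ord: "\<And>n. finite {m. f m \<le> n}" "\<And>m i. i < f m \<Longrightarrow> c m $ i = 0"
  shows "(\<lambda>N. \<Sum>m\<in>window C N. c m * (\<Prod>j\<in>window C N - {m}. inverse (1 - fps_X ^ (d * nat \<bar>j - m\<bar>))))
    \<longlonglongrightarrow> (\<Sum>r\<in>C. inverse (two_sided_prod C d r) * fps_infsum c {m. m mod 5 = r})"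
proof -
  let ?P = "\<lambda>N m. \<Prod>j\<in>window C N - {m}. inverse (1 - fps_X ^ (d * nat \<bar>j - m\<bar>)) :: 'a fps"
  have "(\<lambda>N. \<Sum>m\<in>{m\<in>window C N. m mod 5 = r}. c m * ?P N m)
      \<longlonglongrightarrow> inverse (two_sided_prod C d r) * fps_infsum c {m. m mod 5 = r}" if "r \<in> C" for r
  proof (rule fps_infsum_mult_tendsto[where e = f])
    fix m assume "m \<in> {m. m mod 5 = r}"
    then have r: "m mod 5 = r" by simp
    then show "(\<lambda>N. ?P N m) \<longlonglongrightarrow> inverse (two_sided_prod C d r)"
      using tendsto_window_prod[OF d, where C = C and m = m] two_sided_prod_mod[where C = C and d = d and m = m and ?'a = 'a] by simp
    show "\<forall>\<^sub>F N in sequentially. m \<in> {m \<in> window C N. m mod 5 = r}"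
      using eventually_ge_at_top[of "nat \<bar>m\<bar> + 1"]
      by eventually_elim (use r that in \<open>auto simp: window_def\<close>)
  qed (use ord in \<open>auto intro: finite_subset[OF _ ord(1)]\<close>)
  moreover have "(\<Sum>m\<in>window C N. c m * ?P N m) = (\<Sum>r\<in>C. \<Sum>m\<in>{m\<in>window C N. m mod 5 = r}. c m * ?P N m)" for N
    by (rule sum.group[OF finite_window C, symmetric]) (auto simp: window_def)
  ultimately show ?thesis by (simp only: fps_tendsto_sum)
qed

text \<open>Partial fractions of a reciprocal theta product with simple poles at the nodes: the
  first identity comes from evaluation at 0, the second from evaluation at 1. The bound
  \<open>b\<close> guarantees that the exponents tend to infinity, hence summability.\<close>

lemma window_identities:
  fixes e :: "int \<Rightarrow> int"
  assumes sd: "\<And>m. e (m + 1) - 2 * e m + e (m - 1) = of_bool (m mod 5 \<in> C)"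
    and e: "0 \<notin> C" "e 0 = 0" "e (- 1) = 0" "\<And>N::nat. e (- 5 * int N - 1) - e (- 5 * int N) = 3 * int N"
      "\<And>N::nat. e (5 * int N) - e (5 * int N - 1) = 3 * int N"
    and C: "finite C" and d: "d > 0"
  shows "k < 2 \<Longrightarrow> (\<And>m. e m - int k * m + l \<ge> 0) \<Longrightarrow> (\<And>m. \<bar>m\<bar> \<le> e m - int k * m + l + b) \<Longrightarrow>
       (\<Sum>r\<in>C. inverse (two_sided_prod C d r) *
          fps_infsum (\<lambda>m. alt_sign (e m - e (m - 1)) * fps_X ^ (d * nat (e m - int k * m + l))) {m. m mod 5 = r})
        = (0 :: 'a::field fps)"
    and "(\<And>m. e m \<ge> 0) \<Longrightarrow> (\<And>m. \<bar>m\<bar> \<le> e m + b) \<Longrightarrow>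
       (\<Sum>r\<in>C. inverse (two_sided_prod C d r) *
          fps_infsum (\<lambda>m. alt_sign (e m - e (m - 1)) * fps_X ^ (d * nat (e m)) * geom d m) {m. m mod 5 = r})
        = (inverse (two_sided_prod C d 0) :: 'a::field fps)"
proof -
  let ?P = "\<lambda>N m. \<Prod>j\<in>window C N - {m}. inverse (1 - fps_X ^ (d * nat \<bar>j - m\<bar>)) :: 'a fps"
  have fin: "finite {m. d * nat (E m) \<le> n}" if "\<And>m. E m \<ge> 0" "\<And>m. \<bar>m\<bar> \<le> E m + b" for E :: "int \<Rightarrow> int" and b n
  proof -
    have "\<bar>m\<bar> \<le> int (d * nat (E m)) + b" for m
    proof -
      have "nat (E m) \<le> d * nat (E m)" using d by simp
      then have "E m \<le> int (d * nat (E m))" using that(1)[of m] by linarith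
      then show ?thesis using that(2)[of m] by linarith
    qed
    from finite_int_le[of "\<lambda>m. d * nat (E m)" b UNIV n, OF this] show ?thesis by simp
  qed
  show "(\<Sum>r\<in>C. inverse (two_sided_prod C d r) *
          fps_infsum (\<lambda>m. alt_sign (e m - e (m - 1)) * fps_X ^ (d * nat (e m - int k * m + l))) {m. m mod 5 = r})
        = (0 :: 'a::field fps)"
    if k: "k < 2" "\<And>m. e m - int k * m + l \<ge> 0" "\<And>m. \<bar>m\<bar> \<le> e m - int k * m + l + b"
  proof (rule LIMSEQ_unique)
    let ?c = "\<lambda>m. alt_sign (e m - e (m - 1)) * fps_X ^ (d * nat (e m - int k * m + l)) :: 'a fps"
    show "(\<lambda>N. \<Sum>m\<in>window C N. ?c m * ?P N m) \<longlonglongrightarrow> (\<Sum>r\<in>C. inverse (two_sided_prod C d r) * fps_infsum ?c {m. m mod 5 = r})"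
      by (rule tendsto_window_sum[OF d C, where f = "\<lambda>m. d * nat (e m - int k * m + l)"])
         (use fin[OF k(2,3)] in \<open>auto simp: alt_sign_mult_nth fps_X_power_nth\<close>)
    have "\<forall>\<^sub>F N in sequentially. 0 = (\<Sum>m\<in>window C N. ?c m * ?P N m)"
      using eventually_ge_at_top[of 1]
    proof eventually_elim
      case (elim N)
      then show ?case
        using partial_fractions_fps(1)[OF sd e(1-3) e(4,5)[of N] d, of k l, where ?'a = 'a] k by simp
    qed
    then show "(\<lambda>N. \<Sum>m\<in>window C N. ?c m * ?P N m) \<longlonglongrightarrow> 0"
      by (rule Lim_transform_eventually[OF tendsto_const])
  qed
  show "(\<Sum>r\<in>C. inverse (two_sided_prod C d r) *
          fps_infsum (\<lambda>m. alt_sign (e m - e (m - 1)) * fps_X ^ (d * nat (e m)) * geom d m) {m. m mod 5 = r})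
        = (inverse (two_sided_prod C d 0) :: 'a::field fps)"
    if k: "\<And>m. e m \<ge> 0" "\<And>m. \<bar>m\<bar> \<le> e m + b"
  proof (rule LIMSEQ_unique)
    let ?c = "\<lambda>m. alt_sign (e m - e (m - 1)) * fps_X ^ (d * nat (e m)) * geom d m :: 'a fps"
    show "(\<lambda>N. \<Sum>m\<in>window C N. ?c m * ?P N m) \<longlonglongrightarrow> (\<Sum>r\<in>C. inverse (two_sided_prod C d r) * fps_infsum ?c {m. m mod 5 = r})"
      by (rule tendsto_window_sum[OF d C, where f = "\<lambda>m. d * nat (e m)"])
         (use fin[OF k] in \<open>auto simp: X_power_mult_order\<close>)
    have "\<forall>\<^sub>F N in sequentially. ?P N 0 = (\<Sum>m\<in>window C N. ?c m * ?P N m)"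
      using eventually_ge_at_top[of 1]
    proof eventually_elim
      case (elim N)
      then show ?case
        using partial_fractions_fps(2)[OF sd e(1-3) e(4,5)[of N] d, where ?'a = 'a] k(1) by simp
    qed
    then show "(\<lambda>N. \<Sum>m\<in>window C N. ?c m * ?P N m) \<longlonglongrightarrow> inverse (two_sided_prod C d 0)"
      by (rule Lim_transform_eventually[OF tendsto_window_prod[OF d]])
  qed
qed

section \<open>The exponent functions of the two node sets {1, 2, 4} and {1, 2, 3}\<close>

definition exp1 :: "int \<Rightarrow> int" where "exp1 m = m * (3 * m + 1) div 10"

definition exp2 :: "int \<Rightarrow> int" where "exp2 m = 3 * m * (m + 1) div 10"

text \<open>Three nodes per period of 5 force the leading term (3/5) m^2/2. The linear term is
  chosen so that 10 \<open>exp1 m\<close> is the exponent m(3m+1) of f_2 up to a constant on each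
  class; \<open>exp2\<close> does the same for m(3m+1) + 2m.\<close>

lemma exp1: "10 * exp1 m = m * (3 * m + 1) -
  (if m mod 5 = 1 \<or> m mod 5 = 2 then 4 else if m mod 5 = 4 then 2 else 0)"
proof -
  define i where "i = m mod 10"
  have m: "m * (3 * m + 1) mod 10 = i * (3 * i + 1) mod 10" and m5: "m mod 5 = i mod 5"
    unfolding i_def by (intro mod_mult_cong mod_add_cong; simp) (simp add: mod_mod_cancel)
  have "0 \<le> i" "i < 10" by (simp_all add: i_def)
  then have "i = 0 \<or> i = 1 \<or> i = 2 \<or> i = 3 \<or> i = 4 \<or> i = 5 \<or> i = 6 \<or> i = 7 \<or> i = 8 \<or> i = 9"
    by presburger
  then have "m * (3 * m + 1) mod 10 = (if m mod 5 = 1 \<or> m mod 5 = 2 then 4 else if m mod 5 = 4 then 2 else 0)"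
    unfolding m m5 by (elim disjE) simp_all
  then show ?thesis
    unfolding exp1_def by (simp add: minus_mod_eq_mult_div[symmetric])
qed

lemma exp2: "10 * exp2 m = 3 * m * (m + 1) -
  (if m mod 5 = 1 \<or> m mod 5 = 3 then 6 else if m mod 5 = 2 then 8 else 0)"
proof -
  define i where "i = m mod 10"
  have m: "3 * m * (m + 1) mod 10 = 3 * i * (i + 1) mod 10" and m5: "m mod 5 = i mod 5"
    unfolding i_def by (intro mod_mult_cong mod_add_cong; simp) (simp add: mod_mod_cancel)
  have "0 \<le> i" "i < 10" by (simp_all add: i_def)
  then have "i = 0 \<or> i = 1 \<or> i = 2 \<or> i = 3 \<or> i = 4 \<or> i = 5 \<or> i = 6 \<or> i = 7 \<or> i = 8 \<or> i = 9"
    by presburger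
  then have "3 * m * (m + 1) mod 10 = (if m mod 5 = 1 \<or> m mod 5 = 3 then 6 else if m mod 5 = 2 then 8 else 0)"
    unfolding m m5 by (elim disjE) simp_all
  then show ?thesis
    unfolding exp2_def by (simp add: minus_mod_eq_mult_div[symmetric])
qed

lemma mod_5_cases: "m mod 5 = 0 \<or> m mod 5 = 1 \<or> m mod 5 = 2 \<or> m mod 5 = 3 \<or> m mod 5 = (4 :: int)"
  by presburger

lemma exp1_diff:
  "exp1 m - exp1 (m - 1) = (if m mod 5 = 0 then 3 * (m div 5) else if m mod 5 = 1 then 3 * (m div 5)
    else if m mod 5 = 2 then 3 * (m div 5) + 1 else 3 * (m div 5) + 2)"
proof -
  have "m * (3 * m + 1) - (m - 1) * (3 * (m - 1) + 1) = 6 * m - 2" by (simp add: algebra_simps)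
  moreover have "(m - 1) mod 5 = (m mod 5 - 1) mod 5" by (simp add: mod_diff_left_eq)
  moreover have "m = 5 * (m div 5) + m mod 5" by simp
  ultimately show ?thesis
    using mod_5_cases[of m] exp1[of m] exp1[of "m - 1"] by (elim disjE; simp only:; simp; linarith?)
qed

lemma exp2_diff:
  "exp2 m - exp2 (m - 1) = (if m mod 5 = 0 then 3 * (m div 5) else if m mod 5 = 1 then 3 * (m div 5)
    else if m mod 5 = 2 then 3 * (m div 5) + 1 else if m mod 5 = 3 then 3 * (m div 5) + 2 else 3 * (m div 5) + 3)"
proof -
  have "3 * m * (m + 1) - 3 * (m - 1) * (m - 1 + 1) = 6 * m" by (simp add: algebra_simps)
  moreover have "(m - 1) mod 5 = (m mod 5 - 1) mod 5" by (simp add: mod_diff_left_eq)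
  moreover have "m = 5 * (m div 5) + m mod 5" by simp
  ultimately show ?thesis
    using mod_5_cases[of m] exp2[of m] exp2[of "m - 1"] by (elim disjE; simp only:; simp; linarith?)
qed

lemma exp1_properties:
  "exp1 (m + 1) - 2 * exp1 m + exp1 (m - 1) = of_bool (m mod 5 \<in> {1, 2, 4})"
  "exp1 0 = 0" "exp1 (- 1) = 0"
  "exp1 (- 5 * int N - 1) - exp1 (- 5 * int N) = 3 * int N"
  "exp1 (5 * int N) - exp1 (5 * int N - 1) = 3 * int N"
proof -
  have m1: "(m + 1) div 5 = m div 5 + (if m mod 5 = 4 then 1 else 0)" by presburger
  have "exp1 (m + 1) - 2 * exp1 m + exp1 (m - 1) = (exp1 (m + 1) - exp1 m) - (exp1 m - exp1 (m - 1))" by simp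
  also have "\<dots> = of_bool (m mod 5 \<in> {1, 2, 4})"
    using exp1_diff[of "m + 1"] exp1_diff[of m]
      mod_5_cases[of m] mod_add_left_eq[of m 5 1] m1 by (elim disjE; simp)
  finally show "exp1 (m + 1) - 2 * exp1 m + exp1 (m - 1) = of_bool (m mod 5 \<in> {1, 2, 4})" .
  show "exp1 0 = 0" "exp1 (- 1) = 0" by (simp_all add: exp1_def)
  show "exp1 (- 5 * int N - 1) - exp1 (- 5 * int N) = 3 * int N"
    using exp1_diff[of "- 5 * int N"] nonzero_mult_div_cancel_left[of 5 "- int N"] by simp
  show "exp1 (5 * int N) - exp1 (5 * int N - 1) = 3 * int N"
    using exp1_diff[of "5 * int N"] by simp
qed

lemma exp2_properties:
  "exp2 (m + 1) - 2 * exp2 m + exp2 (m - 1) = of_bool (m mod 5 \<in> {1, 2, 3})"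
  "exp2 0 = 0" "exp2 (- 1) = 0"
  "exp2 (- 5 * int N - 1) - exp2 (- 5 * int N) = 3 * int N"
  "exp2 (5 * int N) - exp2 (5 * int N - 1) = 3 * int N"
proof -
  have m1: "(m + 1) div 5 = m div 5 + (if m mod 5 = 4 then 1 else 0)" by presburger
  have "exp2 (m + 1) - 2 * exp2 m + exp2 (m - 1) = (exp2 (m + 1) - exp2 m) - (exp2 m - exp2 (m - 1))" by simp
  also have "\<dots> = of_bool (m mod 5 \<in> {1, 2, 3})"
    using exp2_diff[of "m + 1"] exp2_diff[of m]
      mod_5_cases[of m] mod_add_left_eq[of m 5 1] m1 by (elim disjE; simp)
  finally show "exp2 (m + 1) - 2 * exp2 m + exp2 (m - 1) = of_bool (m mod 5 \<in> {1, 2, 3})" .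
  show "exp2 0 = 0" "exp2 (- 1) = 0" by (simp_all add: exp2_def)
  show "exp2 (- 5 * int N - 1) - exp2 (- 5 * int N) = 3 * int N"
    using exp2_diff[of "- 5 * int N"] nonzero_mult_div_cancel_left[of 5 "- int N"] by simp
  show "exp2 (5 * int N) - exp2 (5 * int N - 1) = 3 * int N"
    using exp2_diff[of "5 * int N"] by simp
qed

lemma exp_bounds:
  "\<bar>m\<bar> \<le> exp1 m + 6" "\<bar>m\<bar> \<le> exp2 m + 6" "\<bar>m\<bar> \<le> exp2 m - m + 1 + 6"
  "0 \<le> exp1 m" "0 \<le> exp2 m" "0 \<le> exp2 m - m + 1"
proof -
  \<comment> \<open>Completing the square shows that 3n^2 - 21n + 46 is positive. At n =
    \<bar>m\<bar> it is a common lower bound for ten times the slack in each of the three growth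
    estimates.\<close>
  have sq: "12 * (3 * (n * n) - 21 * n + 46) = (6 * n - 21) ^ 2 + 111" for n :: int
    by (simp add: algebra_simps power2_eq_square)
  have nonneg: "x \<ge> 0" if "12 * x = y ^ 2 + 111" for x y :: int
    using that zero_le_power2[of y] by linarith
  have q: "3 * (\<bar>m\<bar> * \<bar>m\<bar>) - 21 * \<bar>m\<bar> + 46 \<ge> 0"
    by (rule nonneg[OF sq])
  have mm: "\<bar>m\<bar> * \<bar>m\<bar> = m * m" by (rule abs_mult_self_eq)
  have e1: "10 * exp1 m \<ge> 3 * (m * m) + m - 4" and e2: "10 * exp2 m \<ge> 3 * (m * m) + 3 * m - 8"
    unfolding exp1 exp2 by (auto simp: algebra_simps)
  show "\<bar>m\<bar> \<le> exp1 m + 6" "\<bar>m\<bar> \<le> exp2 m + 6" "\<bar>m\<bar> \<le> exp2 m - m + 1 + 6"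
    using q e1 e2 unfolding mm by linarith+
  have a: "\<bar>m\<bar> \<le> m * m"
    by (cases "m = 0") (use mult_left_mono[of 1 "\<bar>m\<bar>" "\<bar>m\<bar>"] in \<open>auto simp: abs_mult_self_eq\<close>)
  show "0 \<le> exp1 m" using a e1 by linarith
  show "0 \<le> exp2 m" using a e2 by linarith
  show "0 \<le> exp2 m - m + 1"
  proof (cases "m \<le> 1")
    case True
    then show ?thesis using \<open>0 \<le> exp2 m\<close> by linarith
  next
    case False
    then consider "m = 2" | "m \<ge> 3" by linarith
    then show ?thesis
    proof cases
      case 2
      then have "3 * m \<le> m * m" by (intro mult_right_mono) auto
      then show ?thesis using e2 2 by linarith
    qed (simp add: exp2_def)
  qed
qed

subsection \<open>Relations between the residue classes modulo 5\<close>

text \<open>Class 0 gives (q^50;q^50)_\<infinity>; \<open>P1\<close> and \<open>P2\<close> are the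
  two products of Rogers-Ramanujan type in q^10, with residues 1, 4 and 2, 3 modulo 5.\<close>

definition class_prod :: "nat \<Rightarrow> 'a::comm_ring_1 fps" where
  "class_prod i = qprod ((*) 10 ` {k. k mod 5 = i})"

definition P1 :: "'a::comm_ring_1 fps" where "P1 = class_prod 1 * class_prod 4"

definition P2 :: "'a::comm_ring_1 fps" where "P2 = class_prod 2 * class_prod 3"

definition residue_class :: "int \<Rightarrow> int set" where "residue_class r = {m. m mod 5 = r}"

definition pent :: "int \<Rightarrow> 'a::comm_ring_1 fps" where
  "pent m = alt_sign m * fps_X ^ nat (m * (3 * m + 1))"

definition lambert :: "int \<Rightarrow> int \<Rightarrow> 'a::field fps" where
  "lambert b m = alt_sign m * fps_X ^ nat (m * (3 * m + 1) + 2 * b * m) * geom 10 m"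

abbreviation Theta :: "int \<Rightarrow> 'a::comm_ring_1 fps" where "Theta r \<equiv> fps_infsum pent (residue_class r)"

abbreviation Lambert :: "int \<Rightarrow> int \<Rightarrow> 'a::field fps" where
  "Lambert b r \<equiv> fps_infsum (lambert b) (residue_class r)"

lemma class_prod_nth_0 [simp]: "class_prod i $ 0 = 1" "P1 $ 0 = 1" "P2 $ 0 = 1"
  by (simp_all add: class_prod_def P1_def P2_def)

lemma qprod_classes:
  assumes "finite S"
  shows "qprod ((*) 10 ` {k. k mod 5 \<in> S}) = (\<Prod>i\<in>S. class_prod i :: 'a::comm_ring_1 fps)"
  using assms
proof (induction S)
  case empty
  then show ?case by (simp add: qprod_def fps_eq_iff)
next
  case (insert i S)
  have "(*) 10 ` {k::nat. k mod 5 \<in> insert i S} = (*) 10 ` {k. k mod 5 = i} \<union> (*) 10 ` {k. k mod 5 \<in> S}"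
    by auto
  moreover have "(*) 10 ` {k::nat. k mod 5 = i} \<inter> (*) 10 ` {k. k mod 5 \<in> S} \<subseteq> {0}"
    using insert.hyps(2) by auto
  ultimately show ?case
    using insert by (simp add: qprod_Un class_prod_def)
qed

lemma int_add_mod_5: "(r + int k) mod 5 = (r + int (k mod 5)) mod 5" "(r - int k) mod 5 = (r - int (k mod 5)) mod 5"
  by (simp_all add: zmod_int mod_add_right_eq mod_diff_right_eq)

lemma nat_mod_5_cases: "k mod 5 = 0 \<or> k mod 5 = 1 \<or> k mod 5 = 2 \<or> k mod 5 = 3 \<or> k mod 5 = (4 :: nat)"
  by presburger

lemma two_sided_prod_classes:
  assumes "finite S" "finite T"
    and "\<And>k. k \<in> {0,1,2,3,4} \<Longrightarrow> (r + int k) mod 5 \<in> C \<longleftrightarrow> k \<in> S"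
    and "\<And>k. k \<in> {0,1,2,3,4} \<Longrightarrow> (r - int k) mod 5 \<in> C \<longleftrightarrow> k \<in> T"
  shows "two_sided_prod C 10 r = (\<Prod>i\<in>S. class_prod i) * (\<Prod>i\<in>T. class_prod i :: 'a::comm_ring_1 fps)"
proof -
  have k: "k mod 5 \<in> {0,1,2,3,4}" for k :: nat using nat_mod_5_cases[of k] by auto
  have "{k. (r + int k) mod 5 \<in> C} = {k. k mod 5 \<in> S}" "{k. (r - int k) mod 5 \<in> C} = {k. k mod 5 \<in> T}"
    using assms(3,4)[OF k] by (simp_all only: int_add_mod_5[of r, symmetric])
  then show ?thesis using assms(1,2) by (simp add: two_sided_prod_def qprod_classes)
qed

text \<open>The residues involved are c - r and r - c for c in \<open>C\<close>; opposite ones pair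
  up to \<open>P1\<close> or \<open>P2\<close>, and residue 0 occurs twice exactly when
  \<open>r\<close> is a node. Both node sets are symmetric modulo 5, under m -> 3 - m and m -> 4 -
  m, so two of the three node classes share their product.\<close>

lemma two_sided_prods:
  "two_sided_prod {1, 2, 4} 10 4 = (class_prod 0 * P2 :: 'a::comm_ring_1 fps) ^ 2"
  "two_sided_prod {1, 2, 4} 10 1 = class_prod 0 ^ 2 * P1 * (P2 :: 'a fps)"
  "two_sided_prod {1, 2, 4} 10 2 = class_prod 0 ^ 2 * P1 * (P2 :: 'a fps)"
  "two_sided_prod {1, 2, 4} 10 0 = P1 ^ 2 * (P2 :: 'a fps)"
  "two_sided_prod {1, 2, 3} 10 2 = (class_prod 0 * P1 :: 'a fps) ^ 2"
  "two_sided_prod {1, 2, 3} 10 1 = class_prod 0 ^ 2 * P1 * (P2 :: 'a fps)"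
  "two_sided_prod {1, 2, 3} 10 3 = class_prod 0 ^ 2 * P1 * (P2 :: 'a fps)"
  "two_sided_prod {1, 2, 3} 10 0 = P1 * (P2 :: 'a fps) ^ 2"
proof -
  have *: "two_sided_prod C 10 r = (\<Prod>i\<in>S. class_prod i) * (\<Prod>i\<in>T. class_prod i :: 'a fps)"
    if "finite S" "finite T" "\<forall>k\<in>{0,1,2,3,4}. (r + int k) mod 5 \<in> C \<longleftrightarrow> k \<in> S"
      "\<forall>k\<in>{0,1,2,3,4}. (r - int k) mod 5 \<in> C \<longleftrightarrow> k \<in> T" for C r S T
    using that by (intro two_sided_prod_classes) blast+
  show "two_sided_prod {1, 2, 4} 10 4 = (class_prod 0 * P2 :: 'a fps) ^ 2"
    by (subst *[of "{0,2,3}" "{0,2,3}"]) (auto simp: P1_def P2_def power2_eq_square)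
  show "two_sided_prod {1, 2, 4} 10 1 = class_prod 0 ^ 2 * P1 * (P2 :: 'a fps)"
    by (subst *[of "{0,1,3}" "{0,2,4}"]) (auto simp: P1_def P2_def power2_eq_square)
  show "two_sided_prod {1, 2, 4} 10 2 = class_prod 0 ^ 2 * P1 * (P2 :: 'a fps)"
    by (subst *[of "{0,2,4}" "{0,1,3}"]) (auto simp: P1_def P2_def power2_eq_square)
  show "two_sided_prod {1, 2, 4} 10 0 = P1 ^ 2 * (P2 :: 'a fps)"
    by (subst *[of "{1,2,4}" "{1,3,4}"]) (auto simp: P1_def P2_def power2_eq_square)
  show "two_sided_prod {1, 2, 3} 10 2 = (class_prod 0 * P1 :: 'a fps) ^ 2"
    by (subst *[of "{0,1,4}" "{0,1,4}"]) (auto simp: P1_def P2_def power2_eq_square)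
  show "two_sided_prod {1, 2, 3} 10 1 = class_prod 0 ^ 2 * P1 * (P2 :: 'a fps)"
    by (subst *[of "{0,1,2}" "{0,3,4}"]) (auto simp: P1_def P2_def power2_eq_square)
  show "two_sided_prod {1, 2, 3} 10 3 = class_prod 0 ^ 2 * P1 * (P2 :: 'a fps)"
    by (subst *[of "{0,3,4}" "{0,1,2}"]) (auto simp: P1_def P2_def power2_eq_square)
  show "two_sided_prod {1, 2, 3} 10 0 = P1 * (P2 :: 'a fps) ^ 2"
    by (subst *[of "{1,2,3}" "{2,3,4}"]) (auto simp: P1_def P2_def power2_eq_square)
qed

lemma fps_mult_inverse_cancel:
  fixes t :: "'a::field fps"
  assumes "t $ 0 \<noteq> 0" "g = t * h"
  shows "g * inverse t = h"
proof -
  have "g * inverse t = h * (t * inverse t)" unfolding assms(2) by (simp only: mult_ac)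
  then show ?thesis using assms(1) by (simp add: inverse_mult_eq_1')
qed

text \<open>\<open>(B * P1 * P2) ^ 2\<close> is a common multiple of all the products in
  \<open>two_sided_prods\<close>.\<close>

lemma cleared_inverses:
  defines "B \<equiv> class_prod 0 :: 'a::field fps"
  shows "(B * P1 * P2) ^ 2 * inverse ((B * P2) ^ 2) = P1 ^ 2"
    and "(B * P1 * P2) ^ 2 * inverse ((B * P1) ^ 2) = P2 ^ 2"
    and "(B * P1 * P2) ^ 2 * inverse (B ^ 2 * P1 * P2) = P1 * P2"
    and "(B * P1 * P2) ^ 2 * inverse (P1 ^ 2 * P2) = B ^ 2 * P2"
    and "(B * P1 * P2) ^ 2 * inverse (P1 * P2 ^ 2) = B ^ 2 * P1"
  by (rule fps_mult_inverse_cancel; auto simp: B_def fps_power_zeroth power2_eq_square mult_ac)+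

text \<open>Interpolation produces the parity of the number of nodes below \<open>m\<close>, that
  is, of the slope of the exponent function. The slope is 3 (m div 5) plus a class constant, so on
  each class it agrees with (-1)^m up to a fixed sign.\<close>

lemma alt_sign_exp:
  "m mod 5 = 4 \<Longrightarrow> alt_sign (exp1 m - exp1 (m - 1)) = alt_sign m"
  "m mod 5 = 1 \<or> m mod 5 = 2 \<Longrightarrow> alt_sign (exp1 m - exp1 (m - 1)) = - alt_sign m"
  "m mod 5 = 1 \<or> m mod 5 = 2 \<or> m mod 5 = 3 \<Longrightarrow> alt_sign (exp2 m - exp2 (m - 1)) = - alt_sign m"
proof -
  have ev: "even m \<longleftrightarrow> (even (m div 5) \<longleftrightarrow> even (m mod 5))" by presburger
  show "m mod 5 = 4 \<Longrightarrow> alt_sign (exp1 m - exp1 (m - 1)) = alt_sign m"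
    using ev by (simp add: exp1_diff alt_sign_def)
  show "m mod 5 = 1 \<or> m mod 5 = 2 \<Longrightarrow> alt_sign (exp1 m - exp1 (m - 1)) = - alt_sign m"
    using ev by (auto simp: exp1_diff alt_sign_def)
  show "m mod 5 = 1 \<or> m mod 5 = 2 \<or> m mod 5 = 3 \<Longrightarrow> alt_sign (exp2 m - exp2 (m - 1)) = - alt_sign m"
    using ev by (auto simp: exp2_diff alt_sign_def)
qed

lemma X_power_combine:
  "M = 10 * e + int c \<Longrightarrow> e \<ge> 0 \<Longrightarrow> fps_X ^ nat M = fps_X ^ c * (fps_X :: 'a::comm_ring_1 fps) ^ (10 * nat e)"
  by (simp add: nat_add_distrib nat_mult_distrib power_add mult.commute)

lemma X_power_exp1:
  "m mod 5 = 4 \<Longrightarrow> fps_X ^ nat (m * (3 * m + 1)) = fps_X ^ 2 * (fps_X :: 'a::comm_ring_1 fps) ^ (10 * nat (exp1 m))"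
  "m mod 5 = 1 \<or> m mod 5 = 2 \<Longrightarrow>
    fps_X ^ nat (m * (3 * m + 1)) = fps_X ^ 4 * (fps_X :: 'a fps) ^ (10 * nat (exp1 m))"
  by (rule X_power_combine[OF _ exp_bounds(4)]; use exp1[of m] in auto)+

lemma X_power_exp2:
  "m mod 5 = 2 \<Longrightarrow>
    fps_X ^ nat (m * (3 * m + 1) + 2 * 1 * m) = fps_X ^ 8 * (fps_X :: 'a::comm_ring_1 fps) ^ (10 * nat (exp2 m))"
  "m mod 5 = 1 \<or> m mod 5 = 3 \<Longrightarrow>
    fps_X ^ nat (m * (3 * m + 1) + 2 * 1 * m) = fps_X ^ 6 * (fps_X :: 'a fps) ^ (10 * nat (exp2 m))"
  by (rule X_power_combine[OF _ exp_bounds(5)]; use exp2[of m] in \<open>auto simp: algebra_simps\<close>)+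

lemma pent_exp1:
  "m mod 5 = 4 \<Longrightarrow> pent m = fps_X ^ 2 * (alt_sign (exp1 m - exp1 (m - 1)) * (fps_X :: 'a::comm_ring_1 fps) ^ (10 * nat (exp1 m)))"
  "m mod 5 = 1 \<or> m mod 5 = 2 \<Longrightarrow>
    pent m = - (fps_X ^ 4) * (alt_sign (exp1 m - exp1 (m - 1)) * (fps_X :: 'a fps) ^ (10 * nat (exp1 m)))"
  unfolding pent_def
  by (simp_all only: X_power_exp1 alt_sign_exp)
    (simp_all only: minus_mult_minus mult_minus_left mult_minus_right minus_minus mult_ac)

lemma lambert_exp1:
  "m mod 5 = 4 \<Longrightarrow> lambert 0 m
    = fps_X ^ 2 * (alt_sign (exp1 m - exp1 (m - 1)) * (fps_X :: 'a::field fps) ^ (10 * nat (exp1 m)) * geom 10 m)"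
  "m mod 5 = 1 \<or> m mod 5 = 2 \<Longrightarrow> lambert 0 m
    = - (fps_X ^ 4) * (alt_sign (exp1 m - exp1 (m - 1)) * (fps_X :: 'a fps) ^ (10 * nat (exp1 m)) * geom 10 m)"
  unfolding lambert_def mult_zero_left mult_zero_right add_0_right
  by (simp_all only: X_power_exp1 alt_sign_exp)
    (simp_all only: minus_mult_minus mult_minus_left mult_minus_right minus_minus mult_ac)

lemma lambert_exp2:
  "m mod 5 = 2 \<Longrightarrow> lambert 1 m
    = - (fps_X ^ 8) * (alt_sign (exp2 m - exp2 (m - 1)) * (fps_X :: 'a::field fps) ^ (10 * nat (exp2 m)) * geom 10 m)"
  "m mod 5 = 1 \<or> m mod 5 = 3 \<Longrightarrow> lambert 1 m
    = - (fps_X ^ 6) * (alt_sign (exp2 m - exp2 (m - 1)) * (fps_X :: 'a fps) ^ (10 * nat (exp2 m)) * geom 10 m)"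
proof -
  assume m: "m mod 5 = 2"
  show "lambert 1 m
    = - (fps_X ^ 8) * (alt_sign (exp2 m - exp2 (m - 1)) * (fps_X :: 'a fps) ^ (10 * nat (exp2 m)) * geom 10 m)"
    unfolding lambert_def X_power_exp2(1)[OF m] alt_sign_exp(3)[OF disjI2[OF disjI1[OF m]]]
    by (simp only: minus_mult_minus mult_minus_left mult_minus_right minus_minus mult_ac)
next
  assume m: "m mod 5 = 1 \<or> m mod 5 = 3"
  then have m': "m mod 5 = 1 \<or> m mod 5 = 2 \<or> m mod 5 = 3" by blast
  show "lambert 1 m
    = - (fps_X ^ 6) * (alt_sign (exp2 m - exp2 (m - 1)) * (fps_X :: 'a fps) ^ (10 * nat (exp2 m)) * geom 10 m)"
    unfolding lambert_def X_power_exp2(2)[OF m] alt_sign_exp(3)[OF m']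
    by (simp only: minus_mult_minus mult_minus_left mult_minus_right minus_minus mult_ac)
qed

lemma fps_infsum_mult_cong:
  fixes t t' :: "'i \<Rightarrow> 'a::comm_ring_1 fps"
  assumes "\<And>k. k \<in> A \<Longrightarrow> t' k = c * t k" "fps_summable t A"
  shows "fps_infsum t' A = c * fps_infsum t A"
  unfolding fps_infsum_mult_left[OF assms(2)] by (rule fps_infsum_cong) (rule assms(1))

lemma summable_exp:
  fixes E :: "int \<Rightarrow> int" and g :: "int \<Rightarrow> 'a::comm_ring_1 fps"
  assumes "\<And>m. E m \<ge> 0" "\<And>m. \<bar>m\<bar> \<le> E m + b"
  shows "fps_summable (\<lambda>m. alt_sign (s m) * fps_X ^ (10 * nat (E m)) * g m) A"
proof (rule fps_summable_order[where e = "\<lambda>m. 10 * nat (E m)"])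
  show "finite {k \<in> A. 10 * nat (E k) \<le> n}" for n
  proof (rule finite_int_le[where c = b])
    show "\<bar>k\<bar> \<le> int (10 * nat (E k)) + b" for k
      using assms(1)[of k] assms(2)[of k] by simp
  qed
qed (simp add: X_power_mult_order)

lemmas summable_exp' = summable_exp[where g = "\<lambda>_. 1", unfolded mult_1_right]

text \<open>Nodes {1, 2, 4}, evaluation at 0 with \<open>k = 0\<close>. The classes 1 and 2 have the
  same product, so their theta series enter only through the sum.\<close>

lemma Theta_relation_1: "P2 * (Theta 1 + Theta 2) = fps_X ^ 2 * P1 * (Theta 4 :: 'a::field fps)"
proof -
  let ?t = "\<lambda>m. alt_sign (exp1 m - exp1 (m - 1)) * fps_X ^ (10 * nat (exp1 m - int 0 * m + 0)) :: 'a fps"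
  let ?Y = "\<lambda>r. fps_infsum ?t (residue_class r)"
  let ?B = "class_prod 0 :: 'a fps"
  have sm: "fps_summable ?t A" for A
    using summable_exp'[of exp1 6 "\<lambda>m. exp1 m - exp1 (m - 1)" A, OF exp_bounds(4,1), where ?'a = 'a] by simp
  have Y: "Theta 4 = fps_X ^ 2 * ?Y 4" "Theta 1 = (- (fps_X ^ 4)) * ?Y 1" "Theta 2 = (- (fps_X ^ 4)) * ?Y 2"
    by (rule fps_infsum_mult_cong[OF _ sm]; simp add: residue_class_def pent_exp1)+
  have "(\<Sum>r\<in>{1,2,4}. inverse (two_sided_prod {1,2,4} 10 r) * ?Y r) = 0"
    unfolding residue_class_def
    by (rule window_identities(1)[OF exp1_properties(1) _ exp1_properties(2-5), of 10 0 0 6]) (auto simp: exp_bounds)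
  then have "0 = (?B * P1 * P2) ^ 2 * (\<Sum>r\<in>{1,2,4}. inverse (two_sided_prod {1,2,4} 10 r) * ?Y r)"
    by simp
  also have "\<dots> = ((?B * P1 * P2) ^ 2 * inverse ((?B * P2) ^ 2)) * ?Y 4
     + ((?B * P1 * P2) ^ 2 * inverse (?B ^ 2 * P1 * P2)) * (?Y 1 + ?Y 2)"
    by (simp add: two_sided_prods algebra_simps)
  also have "(?B * P1 * P2) ^ 2 * inverse ((?B * P2) ^ 2) = P1 ^ 2"
    by (rule cleared_inverses)
  also have "(?B * P1 * P2) ^ 2 * inverse (?B ^ 2 * P1 * P2) = P1 * P2"
    by (rule cleared_inverses)
  finally have "P1 * (P1 * ?Y 4 + P2 * (?Y 1 + ?Y 2)) = 0" by (simp add: algebra_simps power2_eq_square)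
  moreover have "P1 \<noteq> (0 :: 'a fps)" by (metis class_prod_nth_0(2) fps_zero_nth zero_neq_one)
  ultimately have "P1 * ?Y 4 + P2 * (?Y 1 + ?Y 2) = 0" by simp
  moreover have "fps_X ^ 2 * P1 * Theta 4 - P2 * (Theta 1 + Theta 2) = fps_X ^ 4 * (P1 * ?Y 4 + P2 * (?Y 1 + ?Y 2))"
  proof -
    have "x ^ 2 * p * (x ^ 2 * y) - q * (- (x ^ 4) * y1 + - (x ^ 4) * y2) = x ^ 4 * (p * y + q * (y1 + y2))"
      for x p q y y1 y2 :: "'a fps" by (simp add: algebra_simps power_numeral_reduce)
    then show ?thesis unfolding Y .
  qed
  ultimately show ?thesis by simp
qed

text \<open>Nodes {1, 2, 3}, evaluation at 0 with \<open>k = 1\<close>. The reflection m -> 1 - m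
  carries the node classes 1, 2, 3 to 0, 4, 3, and (1 - m)(4 - 3m) = 3m(m + 1) - 10m + 4 explains
  both \<open>k = 1\<close> and the shift \<open>l = 1\<close>.\<close>

lemma Theta_relation_2: "fps_X ^ 2 * P1 * (Theta 0 + Theta 3) = - P2 * (Theta 4 :: 'a::field fps)"
proof -
  let ?t = "\<lambda>m. alt_sign (exp2 m - exp2 (m - 1)) * fps_X ^ (10 * nat (exp2 m - int 1 * m + 1)) :: 'a fps"
  let ?Y = "\<lambda>r. fps_infsum ?t (residue_class r)"
  let ?B = "class_prod 0 :: 'a fps"
  have b: "exp2 m - int 1 * m + 1 \<ge> 0" "\<bar>m\<bar> \<le> exp2 m - int 1 * m + 1 + 6" for m
    using exp_bounds(3,6)[of m] by simp_all
  have sm: "fps_summable ?t A" for A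
    using summable_exp'[of "\<lambda>m. exp2 m - int 1 * m + 1" 6 "\<lambda>m. exp2 m - exp2 (m - 1)" A, OF b, where ?'a = 'a] .
  have bij: "bij_betw (\<lambda>m. 1 - m) (residue_class r) (residue_class ((1 - r) mod 5))" if "r \<in> {0..4}" for r
  proof (rule bij_betwI[where g = "\<lambda>m. 1 - m"])
    show "(\<lambda>m. 1 - m) \<in> residue_class r \<rightarrow> residue_class ((1 - r) mod 5)"
    proof
      fix m assume "m \<in> residue_class r"
      then show "1 - m \<in> residue_class ((1 - r) mod 5)"
        using mod_diff_right_eq[of 1 m 5] by (simp add: residue_class_def)
    qed
    show "(\<lambda>m. 1 - m) \<in> residue_class ((1 - r) mod 5) \<rightarrow> residue_class r"
    proof
      fix m assume "m \<in> residue_class ((1 - r) mod 5)"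
      then have "(1 - m) mod 5 = (1 - (1 - r) mod 5) mod 5"
        using mod_diff_right_eq[of 1 m 5] by (simp add: residue_class_def)
      also have "\<dots> = r" using mod_diff_right_eq[of 1 "1 - r" 5] that by simp
      finally show "1 - m \<in> residue_class r" by (simp add: residue_class_def)
    qed
  qed simp_all
  have e: "(1 - m) * (3 * (1 - m) + 1) = 10 * (exp2 m - int 1 * m + 1) + (if m mod 5 = 2 then 2 else 0)"
    if "m mod 5 = 1 \<or> m mod 5 = 2 \<or> m mod 5 = 3" for m
    using exp2[of m] that by (auto simp: algebra_simps)
  have sg: "alt_sign (1 - m) = - alt_sign m" for m by (simp add: alt_sign_def)
  have Y: "Theta 4 = fps_X ^ 2 * ?Y 2" "Theta 0 = fps_X ^ 0 * ?Y 1" "Theta 3 = fps_X ^ 0 * ?Y 3"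
  proof -
    have T: "fps_infsum (\<lambda>m. pent (1 - m)) (residue_class r) = fps_X ^ c * ?Y r"
      if r: "r = 1 \<or> r = 2 \<or> r = 3" and c: "c = (if r = 2 then 2 else 0)" for r :: int and c :: nat
    proof (rule fps_infsum_mult_cong[OF _ sm])
      fix m assume "m \<in> residue_class r"
      then have mr: "m mod 5 = r" by (simp add: residue_class_def)
      then have m5: "m mod 5 = 1 \<or> m mod 5 = 2 \<or> m mod 5 = 3" using r by simp
      have X: "fps_X ^ nat ((1 - m) * (3 * (1 - m) + 1)) = fps_X ^ c * (fps_X :: 'a fps) ^ (10 * nat (exp2 m - int 1 * m + 1))"
        by (rule X_power_combine[OF _ b(1)]) (use e[OF m5] mr c in simp)
      show "pent (1 - m) = fps_X ^ c * ?t m"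
        unfolding pent_def sg X alt_sign_exp(3)[OF m5] by (simp only: mult_ac)
    qed
    show "Theta 4 = fps_X ^ 2 * ?Y 2" "Theta 0 = fps_X ^ 0 * ?Y 1" "Theta 3 = fps_X ^ 0 * ?Y 3"
      using fps_infsum_reindex[OF bij[of 2], of "pent :: int \<Rightarrow> 'a fps"] fps_infsum_reindex[OF bij[of 1], of "pent :: int \<Rightarrow> 'a fps"]
        fps_infsum_reindex[OF bij[of 3], of "pent :: int \<Rightarrow> 'a fps"] T[of 2 2] T[of 1 0] T[of 3 0] by simp_all
  qed
  have "(\<Sum>r\<in>{1,2,3}. inverse (two_sided_prod {1,2,3} 10 r) * ?Y r) = 0"
    unfolding residue_class_def
    by (rule window_identities(1)[OF exp2_properties(1) _ exp2_properties(2-5), of 10 1 1 6]) (use b in auto)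
  then have "0 = (?B * P1 * P2) ^ 2 * (\<Sum>r\<in>{1,2,3}. inverse (two_sided_prod {1,2,3} 10 r) * ?Y r)"
    by simp
  also have "\<dots> = ((?B * P1 * P2) ^ 2 * inverse ((?B * P1) ^ 2)) * ?Y 2
     + ((?B * P1 * P2) ^ 2 * inverse (?B ^ 2 * P1 * P2)) * (?Y 1 + ?Y 3)"
    by (simp add: two_sided_prods algebra_simps)
  also have "(?B * P1 * P2) ^ 2 * inverse ((?B * P1) ^ 2) = P2 ^ 2"
    by (rule cleared_inverses)
  also have "(?B * P1 * P2) ^ 2 * inverse (?B ^ 2 * P1 * P2) = P1 * P2"
    by (rule cleared_inverses)
  finally have "P2 * (P2 * ?Y 2 + P1 * (?Y 1 + ?Y 3)) = 0" by (simp add: algebra_simps power2_eq_square)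
  moreover have "P2 \<noteq> (0 :: 'a fps)" by (metis class_prod_nth_0(3) fps_zero_nth zero_neq_one)
  ultimately have "P2 * ?Y 2 + P1 * (?Y 1 + ?Y 3) = 0" by simp
  moreover have "fps_X ^ 2 * P1 * (Theta 0 + Theta 3) - - P2 * Theta 4 = fps_X ^ 2 * (P2 * ?Y 2 + P1 * (?Y 1 + ?Y 3))"
  proof -
    have "x ^ 2 * p * (x ^ 0 * y1 + x ^ 0 * y2) - - q * (x ^ 2 * y) = x ^ 2 * (q * y + p * (y1 + y2))"
      for x p q y y1 y2 :: "'a fps" by (simp add: algebra_simps)
    then show ?thesis unfolding Y .
  qed
  ultimately show ?thesis
    by (subst eq_iff_diff_eq_0) (simp only: mult_zero_right)
qed

text \<open>The nodes of \<open>Theta_relation_1\<close>, now evaluated at 1: every theta term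
  acquires a pole factor, and the product at \<open>r = 0\<close> supplies the inhomogeneous
  term.\<close>

lemma Lambert_relation_1:
  "fps_X ^ 2 * P1 ^ 2 * Lambert 0 4 - P1 * P2 * (Lambert 0 1 + Lambert 0 2)
    = fps_X ^ 4 * class_prod 0 ^ 2 * (P2 :: 'a::field fps)"
proof -
  let ?t = "\<lambda>m. alt_sign (exp1 m - exp1 (m - 1)) * fps_X ^ (10 * nat (exp1 m)) * geom 10 m :: 'a fps"
  let ?Y = "\<lambda>r. fps_infsum ?t (residue_class r)"
  let ?B = "class_prod 0 :: 'a fps"
  have sm: "fps_summable ?t A" for A
    by (rule summable_exp[of exp1 6, OF exp_bounds(4,1)])
  have Y: "Lambert 0 4 = fps_X ^ 2 * ?Y 4" "Lambert 0 1 = (- (fps_X ^ 4)) * ?Y 1" "Lambert 0 2 = (- (fps_X ^ 4)) * ?Y 2"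
    by (rule fps_infsum_mult_cong[OF _ sm]; simp add: residue_class_def lambert_exp1)+
  have "(\<Sum>r\<in>{1,2,4}. inverse (two_sided_prod {1,2,4} 10 r) * ?Y r) = inverse (two_sided_prod {1,2,4} 10 0)"
    unfolding residue_class_def
    by (rule window_identities(2)[OF exp1_properties(1) _ exp1_properties(2-5), of 10 6]) (auto simp: exp_bounds)
  then have "(?B * P1 * P2) ^ 2 * inverse (P1 ^ 2 * P2) = (?B * P1 * P2) ^ 2 * (\<Sum>r\<in>{1,2,4}. inverse (two_sided_prod {1,2,4} 10 r) * ?Y r)"
    by (simp add: two_sided_prods)
  also have "\<dots> = ((?B * P1 * P2) ^ 2 * inverse ((?B * P2) ^ 2)) * ?Y 4
     + ((?B * P1 * P2) ^ 2 * inverse (?B ^ 2 * P1 * P2)) * (?Y 1 + ?Y 2)"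
    by (simp add: two_sided_prods algebra_simps)
  also have "(?B * P1 * P2) ^ 2 * inverse ((?B * P2) ^ 2) = P1 ^ 2"
    by (rule cleared_inverses)
  also have "(?B * P1 * P2) ^ 2 * inverse (?B ^ 2 * P1 * P2) = P1 * P2"
    by (rule cleared_inverses)
  also have "(?B * P1 * P2) ^ 2 * inverse (P1 ^ 2 * P2) = ?B ^ 2 * P2"
    by (rule cleared_inverses)
  finally have "fps_X ^ 4 * (?B ^ 2 * P2) = fps_X ^ 4 * (P1 ^ 2 * ?Y 4 + P1 * P2 * (?Y 1 + ?Y 2))" by simp
  moreover have "x ^ 2 * p ^ 2 * (x ^ 2 * y) - p * q * (- (x ^ 4) * y1 + - (x ^ 4) * y2)
      = x ^ 4 * (p ^ 2 * y + p * q * (y1 + y2))"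
      for x p q y y1 y2 :: "'a fps" by (simp add: algebra_simps power_numeral_reduce)
  ultimately show ?thesis unfolding Y by (simp only: mult.assoc)
qed

text \<open>The counterpart for the nodes {1, 2, 3}; no reflection is required because m(3m+1) + 2m
  = 3m(m+1) is directly the exponent behind \<open>exp2\<close>.\<close>

lemma Lambert_relation_2:
  "P2 ^ 2 * Lambert 1 2 + fps_X ^ 2 * P1 * P2 * (Lambert 1 1 + Lambert 1 3)
    = - (fps_X ^ 8 * class_prod 0 ^ 2 * (P1 :: 'a::field fps))"
proof -
  let ?t = "\<lambda>m. alt_sign (exp2 m - exp2 (m - 1)) * fps_X ^ (10 * nat (exp2 m)) * geom 10 m :: 'a fps"
  let ?Y = "\<lambda>r. fps_infsum ?t (residue_class r)"
  let ?B = "class_prod 0 :: 'a fps"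
  have sm: "fps_summable ?t A" for A
    by (rule summable_exp[of exp2 6, OF exp_bounds(5,2)])
  have Y: "Lambert 1 2 = (- (fps_X ^ 8)) * ?Y 2" "Lambert 1 1 = (- (fps_X ^ 6)) * ?Y 1" "Lambert 1 3 = (- (fps_X ^ 6)) * ?Y 3"
    by (rule fps_infsum_mult_cong[OF _ sm]; simp add: residue_class_def lambert_exp2)+
  have "(\<Sum>r\<in>{1,2,3}. inverse (two_sided_prod {1,2,3} 10 r) * ?Y r) = inverse (two_sided_prod {1,2,3} 10 0)"
    unfolding residue_class_def
    by (rule window_identities(2)[OF exp2_properties(1) _ exp2_properties(2-5), of 10 6]) (auto simp: exp_bounds)
  then have "(?B * P1 * P2) ^ 2 * inverse (P1 * P2 ^ 2) = (?B * P1 * P2) ^ 2 * (\<Sum>r\<in>{1,2,3}. inverse (two_sided_prod {1,2,3} 10 r) * ?Y r)"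
    by (simp add: two_sided_prods)
  also have "\<dots> = ((?B * P1 * P2) ^ 2 * inverse ((?B * P1) ^ 2)) * ?Y 2
     + ((?B * P1 * P2) ^ 2 * inverse (?B ^ 2 * P1 * P2)) * (?Y 1 + ?Y 3)"
    by (simp add: two_sided_prods algebra_simps)
  also have "(?B * P1 * P2) ^ 2 * inverse ((?B * P1) ^ 2) = P2 ^ 2"
    by (rule cleared_inverses)
  also have "(?B * P1 * P2) ^ 2 * inverse (?B ^ 2 * P1 * P2) = P1 * P2"
    by (rule cleared_inverses)
  also have "(?B * P1 * P2) ^ 2 * inverse (P1 * P2 ^ 2) = ?B ^ 2 * P1"
    by (rule cleared_inverses)
  finally have "fps_X ^ 8 * (?B ^ 2 * P1) = fps_X ^ 8 * (P2 ^ 2 * ?Y 2 + P1 * P2 * (?Y 1 + ?Y 3))" by simp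
  moreover have "q ^ 2 * (- (x ^ 8) * y) + x ^ 2 * p * q * (- (x ^ 6) * y1 + - (x ^ 6) * y2)
      = - (x ^ 8 * (q ^ 2 * y + p * q * (y1 + y2)))"
      for x p q y y1 y2 :: "'a fps" by (simp add: algebra_simps power_numeral_reduce)
  ultimately show ?thesis unfolding Y by (simp only: mult.assoc)
qed

subsection \<open>The mock part\<close>

lemma fps_infsum_classes:
  fixes t :: "int \<Rightarrow> 'a::ab_group_add fps"
  assumes "fps_summable t A"
  shows "fps_infsum t A = (\<Sum>r\<in>{0,1,2,3,4}. fps_infsum t (A \<inter> residue_class r))"
proof -
  have "fps_infsum t (A \<inter> {m. m mod 5 \<in> R}) = (\<Sum>r\<in>R. fps_infsum t (A \<inter> residue_class r))" if "finite R" for R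
    using that
  proof (induction R)
    case empty
    then show ?case by (simp add: fps_infsum_def fps_eq_iff)
  next
    case (insert r R)
    have "A \<inter> {m. m mod 5 \<in> insert r R} = (A \<inter> residue_class r) \<union> (A \<inter> {m. m mod 5 \<in> R})"
      by (auto simp: residue_class_def)
    moreover have "fps_summable t ((A \<inter> residue_class r) \<union> (A \<inter> {m. m mod 5 \<in> R}))"
      by (rule fps_summable_subset[OF assms]) auto
    ultimately show ?case
      using insert fps_infsum_Un[of t "A \<inter> residue_class r" "A \<inter> {m. m mod 5 \<in> R}"]
      by (auto simp: residue_class_def)
  qed
  from this[of "{0,1,2,3,4}"] show ?thesis
    using mod_5_cases by (simp add: Collect_cong[of "\<lambda>m. _ m" "\<lambda>m. True"])
qed

lemma summable_pent: "fps_summable (pent :: int \<Rightarrow> 'a::comm_ring_1 fps) A"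
proof (rule fps_summable_order[where e = "\<lambda>m. nat (m * (3 * m + 1))"])
  show "finite {k \<in> A. nat (k * (3 * k + 1)) \<le> n}" for n
    by (rule finite_int_le[where c = 0])
       (use pent_abs_le[of "- _"] order_trans[OF abs_ge_zero pent_abs_le[of "- _"]] in \<open>simp add: algebra_simps\<close>)
qed (simp add: pent_def alt_sign_mult_nth fps_X_power_nth)

text \<open>The grouping is by exponents: m(3m+1) modulo 5 is 0 on the classes 0 and 3, 2 on the
  class 4, and 4 on the classes 1 and 2.\<close>

lemma euler_even_dissection:
  "qprod {k. even k} = (Theta 0 + Theta 3) + Theta 4 + (Theta 1 + Theta 2 :: 'a::field fps)"
proof -
  have "bij_betw uminus (UNIV :: int set) UNIV" by (rule bij_uminus)
  then have "qprod {k. even k} = (fps_infsum pent UNIV :: 'a fps)"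
    unfolding pentagonal[symmetric]
    by (subst fps_infsum_reindex[of uminus UNIV UNIV pent]) (auto simp: pent_def algebra_simps)
  also have "\<dots> = (\<Sum>r\<in>{0,1,2,3,4}. Theta r)"
    using fps_infsum_classes[OF summable_pent[where ?'a = 'a], of UNIV] by simp
  finally show ?thesis by (simp add: algebra_simps)
qed

definition mock_exp :: "int \<Rightarrow> int \<Rightarrow> int" where
  "mock_exp b k = (if k > 0 then k * (3 * k + 1) + 2 * b * k else k * (3 * k + 1) + 2 * b * k - 10 * k)"

text \<open>This is \<open>(-1)\<^sup>k q\<^bsup>k(3k+1)+2bk\<^esup> / (1 - q\<^sup>1\<^sup>0\<^sup>k)\<close>, with the denominator rewritten in terms of \<open>\<bar>k\<bar>\<close>.\<close>

definition mock_term :: "int \<Rightarrow> int \<Rightarrow> 'a::field fps" where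
  "mock_term b k = alt_sign k * fps_X ^ nat (mock_exp b k) *
     (inverse (1 - fps_X ^ (10 * nat \<bar>k\<bar>)) * (if k > 0 then 1 else - 1))"

lemma mock_exp_ge: "b \<in> {0,1,2,3} \<Longrightarrow> \<bar>k\<bar> \<le> mock_exp b k"
proof -
  assume b: "b \<in> {0,1,2,3}"
  have kk: "0 \<le> k * k" by simp
  have e: "k * (3 * k + 1) = 3 * (k * k) + k" by (simp add: algebra_simps)
  show ?thesis
    using b kk unfolding mock_exp_def e
    by (elim insertE emptyE; hypsubst; cases "k > 0"; simp only: if_True if_False simp_thms; linarith)
qed

lemma summable_mock_term:
  assumes "b \<in> {0,1,2,3}"
  shows "fps_summable (mock_term b :: int \<Rightarrow> 'a::field fps) A"
proof (rule fps_summable_order[where e = "\<lambda>k. nat (mock_exp b k)"])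
  show "finite {k \<in> A. nat (mock_exp b k) \<le> n}" for n
  proof (rule finite_int_le[where c = 0])
    show "\<bar>k\<bar> \<le> int (nat (mock_exp b k)) + 0" for k using mock_exp_ge[OF assms, of k] order_trans[OF abs_ge_zero mock_exp_ge[OF assms, of k]] by simp
  qed
qed (simp add: mock_term_def X_power_mult_order)

text \<open>With x = q^(2k), inverting x turns x^b/(1 - x^5) into -x^(5-b)/(1 - x^5), and k(3k+1)
  drops by 2k, one further power of x. Consequently the sum for b = 3 is minus that for b = 1, and
  twice the sum for b = 2 vanishes.\<close>

lemma mock_term_uminus: "k \<noteq> 0 \<Longrightarrow> mock_term b (- k) = - mock_term (4 - b) k"
proof -
  assume k: "k \<noteq> 0"
  then have "mock_exp b (- k) = mock_exp (4 - b) k" by (auto simp: mock_exp_def algebra_simps)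
  then show ?thesis using k by (auto simp: mock_term_def)
qed

lemma mock_term_sum_uminus:
  assumes "b \<in> {1,2,3}"
  shows "fps_infsum (mock_term b) (UNIV - {0}) = - (fps_infsum (mock_term (4 - b)) (UNIV - {0}) :: 'a::field fps)"
proof -
  have "bij_betw uminus (UNIV - {0 :: int}) (UNIV - {0})"
    by (rule bij_betwI[where g = uminus]) auto
  then have "fps_infsum (mock_term b) (UNIV - {0}) = (fps_infsum (\<lambda>k. mock_term b (- k)) (UNIV - {0}) :: 'a fps)"
    by (rule fps_infsum_reindex)
  also have "\<dots> = - 1 * fps_infsum (mock_term (4 - b)) (UNIV - {0})"
    by (rule fps_infsum_mult_cong) (use assms in \<open>auto simp: mock_term_uminus intro!: summable_mock_term\<close>)
  finally show ?thesis by simp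
qed

lemma mock_term_lambert:
  assumes "k \<noteq> 0" "b \<in> {0, 1}"
  shows "mock_term b k = (lambert b k :: 'a::field fps)"
proof (cases "k > 0")
  case True
  then show ?thesis by (simp add: mock_term_def lambert_def geom_def mock_exp_def mult_ac)
next
  case False
  have kk: "\<bar>k\<bar> \<le> k * k"
    using assms(1) mult_left_mono[of 1 "\<bar>k\<bar>" "\<bar>k\<bar>"] by (simp add: abs_mult_self_eq)
  have "0 \<le> k * (3 * k + 1) + 2 * b * k" using assms(2) kk by (auto simp: algebra_simps)
  then have "nat (mock_exp b k) = nat (k * (3 * k + 1) + 2 * b * k) + 10 * nat \<bar>k\<bar>"
    using False by (simp add: mock_exp_def nat_add_distrib nat_diff_distrib flip: nat_mult_distrib)
  then show ?thesis using False assms(1) by (simp add: mock_term_def lambert_def geom_def power_add mult_ac)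
qed

text \<open>The cube (1 - z)^3 gives the coefficients 1, -3, 3, -1 for b = 0, 1, 2, 3, and the
  reflection k -> -k folds the sums for b = 2 and b = 3 away.\<close>

lemma mock_gf_char_5:
  assumes five: "(5 :: 'a::field) = 0"
  shows "mock_gf = (fps_infsum (mock_term 0) (UNIV - {0}) - 2 * fps_infsum (mock_term 1) (UNIV - {0}) :: 'a fps)"
proof -
  let ?M = "\<lambda>k. alt_sign k * fps_X ^ nat (k * (3 * k - 1) + 2 * \<bar>k\<bar>) * inverse (1 - fps_X ^ nat (2 * \<bar>k\<bar>)) ^ 2 :: 'a fps"
  let ?S = "\<lambda>b. fps_infsum (mock_term b) (UNIV - {0}) :: 'a fps"
  have five': "(5 :: 'a fps) = 0" using five by (simp add: numeral_fps_const)
  have M: "?M k = 1 * mock_term 0 k + (- 3) * mock_term 1 k + (3 * mock_term 2 k + (- 1) * mock_term 3 k)" if "k \<in> UNIV - {0}" for k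
  proof -
    define z where "z = (fps_X :: 'a fps) ^ nat (2 * \<bar>k\<bar>)"
    define J where "J = inverse (1 - fps_X ^ (10 * nat \<bar>k\<bar>) :: 'a fps)"
    have k: "k \<noteq> 0" using that by simp
    have z5: "fps_X ^ (10 * nat \<bar>k\<bar>) = z ^ 5" by (simp add: z_def nat_mult_distrib flip: power_mult)
    have "(1 - z) ^ 5 = 1 - z ^ 5 + 5 * (2 * z ^ 2 - z - 2 * z ^ 3 + z ^ 4)"
      by (simp add: algebra_simps power_numeral_reduce)
    then have p5: "(1 - z) ^ 5 = 1 - z ^ 5" by (simp add: five')
    have iz: "inverse (1 - z) * (1 - z) = 1" unfolding z_def by (rule inverse_one_minus_X_power) (use k in simp)
    have "J * (1 - z ^ 5) = 1" unfolding J_def z5[symmetric] by (rule inverse_one_minus_X_power) (use k in simp)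
    then have "inverse (1 - z) ^ 2 = inverse (1 - z) ^ 2 * (J * (1 - z) ^ 5)" by (simp add: p5)
    also have "\<dots> = (inverse (1 - z) * (1 - z)) ^ 2 * (J * (1 - z) ^ 3)"
      by (simp add: power_numeral_reduce mult_ac)
    finally have sq: "inverse (1 - z) ^ 2 = J * (1 - z) ^ 3" by (simp add: iz)
    have E: "0 \<le> k * (3 * k - 1) + 2 * \<bar>k\<bar>"
      using order_trans[OF abs_ge_zero pent_abs_le[of k]] by simp
    define X0 where "X0 = (fps_X :: 'a fps) ^ nat (k * (3 * k - 1) + 2 * \<bar>k\<bar>)"
    have X: "fps_X ^ nat (mock_exp b k) = X0 * z ^ c" if "mock_exp b k = k * (3 * k - 1) + 2 * \<bar>k\<bar> + int c * (2 * \<bar>k\<bar>)" for b c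
    proof -
      have "nat (mock_exp b k) = nat (k * (3 * k - 1) + 2 * \<bar>k\<bar>) + nat (2 * \<bar>k\<bar>) * c"
        unfolding that using E by (subst nat_add_distrib) (auto simp: nat_mult_distrib)
      then show ?thesis by (simp only: X0_def z_def power_add power_mult)
    qed
    show ?thesis
    proof (cases "k > 0")
      case True
      then have X': "fps_X ^ nat (mock_exp 0 k) = X0 * z ^ 0" "fps_X ^ nat (mock_exp 1 k) = X0 * z ^ 1"
        "fps_X ^ nat (mock_exp 2 k) = X0 * z ^ 2" "fps_X ^ nat (mock_exp 3 k) = X0 * z ^ 3"
        by (intro X; simp add: mock_exp_def algebra_simps)+
      show ?thesis
        unfolding mock_term_def X' z_def[symmetric] X0_def[symmetric] sq J_def[symmetric] using True
        by (simp add: algebra_simps power_numeral_reduce)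
    next
      case False
      \<comment> \<open>For negative \<open>k\<close> the index b goes with
        \<open>z ^ (3 - b)\<close>. The sign in \<open>mock_term\<close> restores (1 - z)^3, whose
        coefficients are antisymmetric.\<close>
      then have X': "fps_X ^ nat (mock_exp 0 k) = X0 * z ^ 3" "fps_X ^ nat (mock_exp 1 k) = X0 * z ^ 2"
        "fps_X ^ nat (mock_exp 2 k) = X0 * z ^ 1" "fps_X ^ nat (mock_exp 3 k) = X0 * z ^ 0"
        by (intro X; simp add: mock_exp_def algebra_simps)+
      show ?thesis
        unfolding mock_term_def X' z_def[symmetric] X0_def[symmetric] sq J_def[symmetric] using False
        by (simp add: algebra_simps power_numeral_reduce)
    qed
  qed
  have s: "fps_summable (\<lambda>k. c * mock_term b k) (UNIV - {0})" "fps_summable (mock_term b :: _ \<Rightarrow> 'a fps) (UNIV - {0})"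
    if "b \<in> {0,1,2,3}" for c :: "'a fps" and b
    by (intro fps_summable_mult_left summable_mock_term that)+
  have lin: "fps_infsum (\<lambda>k. c * mock_term b k + c' * mock_term b' k) (UNIV - {0}) = c * ?S b + c' * ?S b'"
    if "b \<in> {0,1,2,3}" "b' \<in> {0,1,2,3}" for c c' and b b'
    unfolding fps_infsum_add[OF s(1)[OF that(1)] s(1)[OF that(2)]]
      fps_infsum_mult_left[OF s(2)[OF that(1)]] fps_infsum_mult_left[OF s(2)[OF that(2)]] ..
  have "(mock_gf :: 'a fps) = fps_infsum (\<lambda>k. 1 * mock_term 0 k + (- 3) * mock_term 1 k + (3 * mock_term 2 k + (- 1) * mock_term 3 k)) (UNIV - {0} :: int set)"
    unfolding mock_gf_def by (rule fps_infsum_cong[OF M])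
  also have "\<dots> = fps_infsum (\<lambda>k. 1 * mock_term 0 k + (- 3) * mock_term 1 k) (UNIV - {0})
      + fps_infsum (\<lambda>k. 3 * mock_term 2 k + (- 1) * mock_term 3 k) (UNIV - {0})"
    by (rule fps_infsum_add; intro fps_summable_add s; simp)
  also have "\<dots> = 1 * ?S 0 + (- 3) * ?S 1 + (3 * ?S 2 + (- 1) * ?S 3)"
    by (subst (1 2) lin) simp_all
  also have "?S 3 = - ?S 1" using mock_term_sum_uminus[of 3, where ?'a = 'a] by simp
  \<comment> \<open>Writing 3 as 4 + 4 - 5 avoids a division by 2: the reflection only gives
    \<open>?S 2 + ?S 2 = 0\<close>.\<close>
  also have "1 * ?S 0 + (- 3) * ?S 1 + (3 * ?S 2 + (- 1) * (- ?S 1)) = ?S 0 - 2 * ?S 1 + 4 * (?S 2 + ?S 2) - 5 * ?S 2"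
    by (simp add: algebra_simps)
  also have "?S 2 + ?S 2 = 0" using mock_term_sum_uminus[of 2, where ?'a = 'a] by (simp add: eq_neg_iff_add_eq_0)
  finally show ?thesis by (simp add: five')
qed

section \<open>Exponent classes of products, theta series and Lambert series\<close>

lemma fps_supp5_add: "fps_supp5 r f \<Longrightarrow> fps_supp5 r g \<Longrightarrow> fps_supp5 r (f + g)" for f g :: "'a::comm_ring_1 fps"
  by (auto simp: fps_supp5_def)

lemma fps_supp5_infsum:
  assumes "\<And>k. k \<in> A \<Longrightarrow> fps_supp5 r (t k)"
  shows "fps_supp5 r (fps_infsum t A)"
  unfolding fps_supp5_def
proof (intro allI impI)
  fix n :: nat assume "n mod 5 \<noteq> r mod 5"
  then show "fps_infsum t A $ n = 0"
    using assms by (intro trans[OF fps_infsum_nth[of "{}"]]) (auto simp: fps_supp5_def)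
qed

lemma fps_supp5_const: "fps_supp5 0 (fps_const c)"
  by (auto simp: fps_supp5_def)

lemma fps_supp5_numeral: "fps_supp5 0 (numeral n :: 'a::comm_ring_1 fps)"
  unfolding numeral_fps_const by (rule fps_supp5_const)

lemma fps_supp5_scale: "fps_supp5 0 f \<Longrightarrow> fps_supp5 r g \<Longrightarrow> fps_supp5 r (f * g)" for f g :: "'a::comm_ring_1 fps"
  using fps_supp5_mult[of 0 f r g] by simp

lemma fps_supp5_power: "fps_supp5 r f \<Longrightarrow> fps_supp5 (n * r) (f ^ n)" for f :: "'a::comm_ring_1 fps"
  by (induction n) (auto simp: fps_supp5_1 intro: fps_supp5_mult)

lemma fps_supp5_alt_sign: "fps_supp5 r f \<Longrightarrow> fps_supp5 r (alt_sign k * f)"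
  by (simp add: fps_supp5_def alt_sign_mult_nth)

lemma fps_supp5_cong: "r mod 5 = s mod 5 \<Longrightarrow> fps_supp5 r f \<Longrightarrow> fps_supp5 s f"
  by (simp add: fps_supp5_def)

lemma fps_vanish5_supp5: "fps_supp5 r f \<Longrightarrow> r mod 5 \<noteq> s mod 5 \<Longrightarrow> fps_vanish5 s f"
  by (auto simp: fps_vanish5_def fps_supp5_def)

lemma fps_vanish5_add: "fps_vanish5 r f \<Longrightarrow> fps_vanish5 r g \<Longrightarrow> fps_vanish5 r (f + g)" for f g :: "'a::comm_ring_1 fps"
  by (auto simp: fps_vanish5_def)

lemma fps_supp5_class_prods:
  "fps_supp5 0 (class_prod i :: 'a::comm_ring_1 fps)" "fps_supp5 0 (P1 :: 'a fps)" "fps_supp5 0 (P2 :: 'a fps)"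
proof -
  have c: "fps_supp5 0 (class_prod i :: 'a fps)" for i
    unfolding class_prod_def by (rule fps_supp5_qprod) auto
  show "fps_supp5 0 (class_prod i :: 'a fps)" by (rule c)
  show "fps_supp5 0 (P1 :: 'a fps)" "fps_supp5 0 (P2 :: 'a fps)"
    unfolding P1_def P2_def using c by (auto intro: fps_supp5_scale)
qed

lemma fps_supp5_geom: "fps_supp5 0 (geom 10 m :: 'a::field fps)"
proof (cases "m = 0")
  case True
  then show ?thesis by (simp add: geom_def fps_supp5_def)
next
  case False
  then have i: "fps_supp5 0 (inverse (1 - fps_X ^ (10 * nat \<bar>m\<bar>)) :: 'a fps)"
    by (intro fps_supp5_inverse fps_supp5_one_minus) (auto simp: fps_X_power_nth)
  have "fps_supp5 0 (fps_X ^ (10 * nat \<bar>m\<bar>) :: 'a fps)"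
    by (rule fps_supp5_cong[OF _ fps_supp5_X_power]) simp
  from fps_supp5_scale[OF this i] have "fps_supp5 0 (- (fps_X ^ (10 * nat \<bar>m\<bar>) * inverse (1 - fps_X ^ (10 * nat \<bar>m\<bar>))) :: 'a fps)"
    by (simp add: fps_supp5_def)
  then show ?thesis using i unfolding geom_def by (cases "m > 0") (simp_all only: if_True if_False)
qed

lemma fps_supp5_lambert:
  assumes "b \<in> {0, 1}" "m mod 5 = r" "(r * (3 * r + 1) + 2 * b * r) mod 5 = int s" "s < 5"
  shows "fps_supp5 s (lambert b m :: 'a::field fps)"
proof -
  have kk: "\<bar>m\<bar> \<le> m * m"
    by (cases "m = 0") (use mult_left_mono[of 1 "\<bar>m\<bar>" "\<bar>m\<bar>"] in \<open>auto simp: abs_mult_self_eq\<close>)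
  have e: "m * (3 * m + 1) + 2 * b * m \<ge> 0" using assms(1) kk by (auto simp: algebra_simps)
  have "(m * (3 * m + 1) + 2 * b * m) mod 5 = (r * (3 * r + 1) + 2 * b * r) mod 5"
    by (intro mod_add_cong mod_mult_cong) (use assms(2) in auto)
  then have "int (nat (m * (3 * m + 1) + 2 * b * m) mod 5) = int s"
    using e assms(3) by (simp add: zmod_int)
  then have "nat (m * (3 * m + 1) + 2 * b * m) mod 5 = s mod 5" using assms(4) by simp
  then have "fps_supp5 s (fps_X ^ nat (m * (3 * m + 1) + 2 * b * m) :: 'a fps)"
    by (rule fps_supp5_cong[OF _ fps_supp5_X_power])
  from fps_supp5_scale[OF fps_supp5_geom[of m] this] show ?thesis
    unfolding lambert_def mult.assoc by (intro fps_supp5_alt_sign) (simp add: mult.commute)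
qed

lemma fps_supp5_Lambert:
  assumes "A \<subseteq> residue_class r" "b \<in> {0, 1}" "(r * (3 * r + 1) + 2 * b * r) mod 5 = int s" "s < 5"
  shows "fps_supp5 s (fps_infsum (lambert b) A :: 'a::field fps)"
  by (intro fps_supp5_infsum fps_supp5_lambert[OF assms(2) _ assms(3,4)]) (use assms(1) in \<open>auto simp: residue_class_def\<close>)

lemma fps_supp5_Theta_4: "fps_supp5 2 (Theta 4 :: 'a::comm_ring_1 fps)"
proof (rule fps_supp5_infsum)
  fix m assume "m \<in> residue_class 4"
  then have m: "m mod 5 = 4" by (simp add: residue_class_def)
  have "(2 + 10 * k) mod 5 = 2 mod 5" for k :: nat by presburger
  then have "fps_supp5 2 (fps_X ^ (2 + 10 * nat (exp1 m)) :: 'a fps)"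
    by (rule fps_supp5_cong[OF _ fps_supp5_X_power])
  then have "fps_supp5 2 (fps_X ^ nat (m * (3 * m + 1)) :: 'a fps)"
    unfolding X_power_exp1(1)[OF m] power_add .
  then show "fps_supp5 2 (pent m :: 'a fps)" unfolding pent_def by (rule fps_supp5_alt_sign)
qed

text \<open>The exponent classes are r(3r+1) for b = 0 and 3r(r+1) for b = 1. Class 0 is collected
  in \<open>A0\<close>; the other four groups have classes 2, 4, 1, 3 in the order written, and are
  the combinations occurring in the Lambert relations.\<close>

lemma mock_dissection:
  assumes five: "(5 :: 'a::field) = 0"
  obtains A0 where "fps_supp5 0 A0"
    "mock_gf = A0 + Lambert 0 4 + (Lambert 0 1 + Lambert 0 2) + (- 2) * (Lambert 1 1 + Lambert 1 3) + (- 2) * (Lambert 1 2 :: 'a fps)"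
proof -
  have S: "fps_infsum (mock_term b) (UNIV - {0}) = (\<Sum>r\<in>{0,1,2,3,4}. fps_infsum (lambert b) (residue_class r - {0}) :: 'a fps)"
    if b: "b \<in> {0, 1}" for b
  proof -
    have "fps_infsum (mock_term b) (UNIV - {0}) = (\<Sum>r\<in>{0,1,2,3,4}. fps_infsum (mock_term b) ((UNIV - {0}) \<inter> residue_class r) :: 'a fps)"
      by (rule fps_infsum_classes, rule summable_mock_term) (use b in auto)
    also have "\<dots> = (\<Sum>r\<in>{0,1,2,3,4}. fps_infsum (lambert b) (residue_class r - {0}))"
      by (intro sum.cong refl, subst Int_commute, unfold Int_Diff[symmetric] Int_UNIV_right, rule fps_infsum_cong)
         (use b in \<open>auto intro: mock_term_lambert\<close>)
    finally show ?thesis .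
  qed
  have R: "residue_class 1 - {0} = residue_class 1" "residue_class 2 - {0} = residue_class 2"
      "residue_class 3 - {0} = residue_class 3" "residue_class 4 - {0} = residue_class 4"
    by (auto simp: residue_class_def)
  let ?L = "\<lambda>b. fps_infsum (lambert b) (residue_class 0 - {0}) :: 'a fps"
  define A0 where "A0 = (?L 0 + Lambert 0 3) + (- 2) * (?L 1 + Lambert 1 4)"
  have n2: "fps_supp5 0 (- 2 :: 'a fps)" using fps_supp5_numeral[of "num.Bit0 num.One", where ?'a = 'a] by (simp add: fps_supp5_def)
  have "fps_supp5 0 A0"
    unfolding A0_def
    by (intro fps_supp5_add fps_supp5_scale[OF n2])
       (rule fps_supp5_Lambert[where r = 0] fps_supp5_Lambert[where r = 3] fps_supp5_Lambert[where r = 4], auto)+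
  moreover have "mock_gf = A0 + Lambert 0 4 + (Lambert 0 1 + Lambert 0 2) + (- 2) * (Lambert 1 1 + Lambert 1 3) + (- 2) * (Lambert 1 2 :: 'a fps)"
    unfolding mock_gf_char_5[OF five] by (simp add: S R A0_def algebra_simps)
  ultimately show ?thesis by (rule that)
qed

text \<open>Ramanujan's dissection of \<open>f\<^sub>2\<close>, with denominators cleared.\<close>

lemma euler_even_factor:
  "fps_X ^ 2 * P1 * P2 * qprod {k. even k}
    = Theta 4 * (- (P2 ^ 2) + fps_X ^ 2 * P1 * P2 + fps_X ^ 4 * P1 ^ 2 :: 'a::field fps)"
proof -
  have "fps_X ^ 2 * P1 * P2 * qprod {k. even k} = P2 * (fps_X ^ 2 * P1 * (Theta 0 + Theta 3))
      + fps_X ^ 2 * P1 * P2 * Theta 4 + fps_X ^ 2 * P1 * (P2 * (Theta 1 + Theta 2 :: 'a fps))"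
    unfolding euler_even_dissection by (simp add: algebra_simps)
  also have "\<dots> = Theta 4 * (- (P2 ^ 2) + fps_X ^ 2 * P1 * P2 + fps_X ^ 4 * P1 ^ 2)"
    unfolding Theta_relation_1 Theta_relation_2 by (simp add: algebra_simps power_numeral_reduce)
  finally show ?thesis .
qed

text \<open>Terms are grouped by the exponent of \<open>x\<close> modulo 5. The coefficient of
  \<open>x ^ 4\<close> is -5 \<open>p ^ 4 * q ^ 4\<close>, so one of the five groups
  disappears.\<close>

lemma quartic_char_5:
  fixes x p q :: "'b::comm_ring_1"
  assumes "(5 :: 'b) = 0"
  shows "(- (q ^ 2) + x * p * q + x ^ 2 * p ^ 2) ^ 4 = (q ^ 8 + 2 * x ^ 5 * p ^ 5 * q ^ 3)
     + x * (p * q ^ 7 + 2 * x ^ 5 * p ^ 6 * q ^ 2)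
     + x ^ 2 * (2 * p ^ 2 * q ^ 6 + 4 * x ^ 5 * p ^ 7 * q) + x ^ 3 * (3 * p ^ 3 * q ^ 5 + x ^ 5 * p ^ 8)"
proof -
  have "(- (q ^ 2) + x * p * q + x ^ 2 * p ^ 2) ^ 4 = (q ^ 8 + 2 * x ^ 5 * p ^ 5 * q ^ 3)
     + x * (p * q ^ 7 + 2 * x ^ 5 * p ^ 6 * q ^ 2)
     + x ^ 2 * (2 * p ^ 2 * q ^ 6 + 4 * x ^ 5 * p ^ 7 * q) + x ^ 3 * (3 * p ^ 3 * q ^ 5 + x ^ 5 * p ^ 8)
     + 5 * (x ^ 3 * p ^ 3 * q ^ 5 - x * p * q ^ 7 - x ^ 4 * p ^ 4 * q ^ 4 - 2 * x ^ 5 * p ^ 5 * q ^ 3)"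
    by (simp add: algebra_simps power_numeral_reduce)
  then show ?thesis by (simp add: assms)
qed

text \<open>Modulo 5 the form is a combination of the two given relations with the common factor
  \<open>?w\<close>; the multipliers q and -2 x^2 p make the inhomogeneous terms cancel.\<close>

lemma class_combination_char_5:
  fixes x p q :: "'b::comm_ring_1"
  assumes "(5 :: 'b) = 0"
    and "x * p ^ 2 * a1 - p * q * a2 = x ^ 2 * B * q"
    and "q ^ 2 * a4 + x * p * q * a3 = 2 * (x ^ 4 * B * p)"
  shows "(q ^ 8 + 2 * x ^ 5 * p ^ 5 * q ^ 3) * a4 + x * (p * q ^ 7 + 2 * x ^ 5 * p ^ 6 * q ^ 2) * a3
     + x ^ 2 * (2 * p ^ 2 * q ^ 6 + 4 * x ^ 5 * p ^ 7 * q) * a2 + x ^ 3 * (3 * p ^ 3 * q ^ 5 + x ^ 5 * p ^ 8) * a1 = 0"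
proof -
  let ?w = "q ^ 5 + 2 * x ^ 5 * p ^ 5"
  have "(q ^ 8 + 2 * x ^ 5 * p ^ 5 * q ^ 3) * a4 + x * (p * q ^ 7 + 2 * x ^ 5 * p ^ 6 * q ^ 2) * a3
     + x ^ 2 * (2 * p ^ 2 * q ^ 6 + 4 * x ^ 5 * p ^ 7 * q) * a2 + x ^ 3 * (3 * p ^ 3 * q ^ 5 + x ^ 5 * p ^ 8) * a1
    = q * ?w * (q ^ 2 * a4 + x * p * q * a3) - 2 * x ^ 2 * p * ?w * (x * p ^ 2 * a1 - p * q * a2)
      + 5 * (x ^ 3 * p ^ 3 * q ^ 5 * a1 + x ^ 8 * p ^ 8 * a1)"
    by (simp add: algebra_simps power_numeral_reduce)
  also have "\<dots> = 0" unfolding assms(2,3) by (simp add: assms(1) algebra_simps power_numeral_reduce)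
  finally show ?thesis .
qed

lemma mock_part_vanishes:
  assumes five: "(5 :: 'a::field) = 0"
  shows "fps_vanish5 3 (inverse (qprod {k. even k}) * mock_gf :: 'a fps)"
proof -
  let ?f2 = "qprod {k. even k} :: 'a fps"
  have five': "(5 :: 'a fps) = 0" using five by (simp add: numeral_fps_const)
  define x where "x = (fps_X :: 'a fps) ^ 2"
  define p where "p = (P1 :: 'a fps)"
  define q where "q = (P2 :: 'a fps)"
  define t where "t = (Theta 4 :: 'a fps)"
  obtain A0 where A0: "fps_supp5 0 A0"
    "mock_gf = A0 + Lambert 0 4 + (Lambert 0 1 + Lambert 0 2) + (- 2) * (Lambert 1 1 + Lambert 1 3) + (- 2) * (Lambert 1 2 :: 'a fps)"
    using mock_dissection[OF five] by blast
  define A1 where "A1 = (Lambert 0 4 :: 'a fps)"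
  define A2 where "A2 = (Lambert 0 1 + Lambert 0 2 :: 'a fps)"
  define A3 where "A3 = (- 2) * (Lambert 1 1 + Lambert 1 3 :: 'a fps)"
  define A4 where "A4 = (- 2) * (Lambert 1 2 :: 'a fps)"
  have n2: "fps_supp5 0 (- 2 :: 'a fps)" using fps_supp5_numeral[of "num.Bit0 num.One", where ?'a = 'a] by (simp add: fps_supp5_def)
  have A: "fps_supp5 2 A1" "fps_supp5 4 A2" "fps_supp5 1 A3" "fps_supp5 3 A4"
    unfolding A1_def A2_def A3_def A4_def
    by (intro fps_supp5_add fps_supp5_scale[OF n2] fps_supp5_Lambert[OF subset_refl]; simp)+
  define D0 where "D0 = q ^ 8 + 2 * x ^ 5 * p ^ 5 * q ^ 3"
  define D1 where "D1 = x * (p * q ^ 7 + 2 * x ^ 5 * p ^ 6 * q ^ 2)"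
  define D2 where "D2 = x ^ 2 * (2 * p ^ 2 * q ^ 6 + 4 * x ^ 5 * p ^ 7 * q)"
  define D3 where "D3 = x ^ 3 * (3 * p ^ 3 * q ^ 5 + x ^ 5 * p ^ 8)"
  have s0: "fps_supp5 0 (f * g)" if "fps_supp5 0 f" "fps_supp5 0 g" for f g :: "'a fps"
    using that by (rule fps_supp5_scale)
  have pw0: "fps_supp5 0 (f ^ n)" if "fps_supp5 0 f" for f :: "'a fps" and n
    using fps_supp5_power[OF that, of n] by simp
  have pq: "fps_supp5 0 p" "fps_supp5 0 q"
    unfolding p_def q_def by (rule fps_supp5_class_prods)+
  have x: "fps_supp5 (2 * n) (x ^ n)" for n
    unfolding x_def power_mult[symmetric] by (rule fps_supp5_X_power)
  have x5: "fps_supp5 0 (x ^ 5)" by (rule fps_supp5_cong[OF _ x]) simp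
  note supp0 = fps_supp5_add s0 pw0 pq x5 fps_supp5_numeral
  have D: "fps_supp5 0 D0" "fps_supp5 2 D1" "fps_supp5 4 D2" "fps_supp5 1 D3"
  proof -
    show "fps_supp5 0 D0" unfolding D0_def by (intro supp0)
    have "fps_supp5 (2 * 1 + 0) (x ^ 1 * (p * q ^ 7 + 2 * x ^ 5 * p ^ 6 * q ^ 2))"
      by (intro fps_supp5_mult x supp0)
    then show "fps_supp5 2 D1" by (simp add: D1_def)
    have "fps_supp5 (2 * 2 + 0) D2" unfolding D2_def by (intro fps_supp5_mult x supp0)
    then show "fps_supp5 4 D2" by simp
    have "fps_supp5 (2 * 3 + 0) D3" unfolding D3_def by (intro fps_supp5_mult x supp0)
    then show "fps_supp5 1 D3" by (simp add: fps_supp5_def)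
  qed
  have t: "fps_supp5 8 (t ^ 4)" using fps_supp5_power[OF fps_supp5_Theta_4, of 4] by (simp add: t_def)
  \<comment> \<open>Target class 16 = 8 + 8: after the class 8 of \<open>t ^ 4\<close>, a product
    \<open>D i * A j\<close> matters only if its class is 3. The classes 0, 2, 4, 1 of the D's and
    0, 2, 4, 1, 3 of the A's leave the four products in \<open>Z\<close>.\<close>
  have van: "fps_vanish5 16 (t ^ 4 * (f * g))" if "fps_supp5 r f" "fps_supp5 s g" "(8 + (r + s)) mod 5 \<noteq> 16 mod 5"
    for f g :: "'a fps" and r s
    by (rule fps_vanish5_supp5[OF fps_supp5_mult[OF t fps_supp5_mult[OF that(1,2)]] that(3)])
  have R1: "x * p ^ 2 * A1 - p * q * A2 = x ^ 2 * class_prod 0 ^ 2 * q"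
    using Lambert_relation_1[where ?'a = 'a] by (simp add: x_def p_def q_def A1_def A2_def flip: power_mult)
  have R2: "q ^ 2 * A4 + x * p * q * A3 = 2 * (x ^ 4 * class_prod 0 ^ 2 * p)"
  proof -
    have "q ^ 2 * A4 + x * p * q * A3 = (- 2) * (q ^ 2 * Lambert 1 2 + x * p * q * (Lambert 1 1 + Lambert 1 3))"
      unfolding A3_def A4_def by (simp add: algebra_simps)
    also have "q ^ 2 * Lambert 1 2 + x * p * q * (Lambert 1 1 + Lambert 1 3) = - (x ^ 4 * class_prod 0 ^ 2 * p)"
      using Lambert_relation_2[where ?'a = 'a] by (simp add: x_def p_def q_def flip: power_mult)
    finally show ?thesis by simp
  qed
  have Z: "D0 * A4 + D1 * A3 + D2 * A2 + D3 * A1 = 0"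
    unfolding D0_def D1_def D2_def D3_def by (rule class_combination_char_5[OF five' R1 R2])
  have f2: "x * p * q * ?f2 = t * (- (q ^ 2) + x * p * q + x ^ 2 * p ^ 2)"
    using euler_even_factor[where ?'a = 'a] by (simp add: x_def p_def q_def t_def flip: power_mult)
  have "(x * p * q * ?f2) ^ 4 * mock_gf = t ^ 4 * ((D0 + D1 + D2 + D3) * (A0 + A1 + A2 + A3 + A4))"
    unfolding f2 power_mult_distrib quartic_char_5[OF five'] A0(2) A1_def[symmetric] A2_def[symmetric] A3_def[symmetric] A4_def[symmetric]
    by (simp only: D0_def D1_def D2_def D3_def mult.assoc)
  also have "(D0 + D1 + D2 + D3) * (A0 + A1 + A2 + A3 + A4) = (D0 * A4 + D1 * A3 + D2 * A2 + D3 * A1)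
     + (D0 * A0 + D0 * A1 + D0 * A2 + D0 * A3 + D1 * A0 + D1 * A1 + D1 * A2 + D1 * A4
      + D2 * A0 + D2 * A1 + D2 * A3 + D2 * A4 + D3 * A0 + D3 * A2 + D3 * A3 + D3 * A4)"
    by (simp add: algebra_simps)
  finally have G: "(x * p * q * ?f2) ^ 4 * mock_gf = t ^ 4 * (D0 * A0) + t ^ 4 * (D0 * A1) + t ^ 4 * (D0 * A2) + t ^ 4 * (D0 * A3)
      + t ^ 4 * (D1 * A0) + t ^ 4 * (D1 * A1) + t ^ 4 * (D1 * A2) + t ^ 4 * (D1 * A4)
      + t ^ 4 * (D2 * A0) + t ^ 4 * (D2 * A1) + t ^ 4 * (D2 * A3) + t ^ 4 * (D2 * A4)
      + t ^ 4 * (D3 * A0) + t ^ 4 * (D3 * A2) + t ^ 4 * (D3 * A3) + t ^ 4 * (D3 * A4)"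
    unfolding Z by (simp add: distrib_left)
  have vG: "fps_vanish5 16 ((x * p * q * ?f2) ^ 4 * mock_gf)"
    unfolding G
    by (intro fps_vanish5_add van[OF D(1) A0(1)] van[OF D(1) A(1)] van[OF D(1) A(2)] van[OF D(1) A(3)]
        van[OF D(2) A0(1)] van[OF D(2) A(1)] van[OF D(2) A(2)] van[OF D(2) A(4)]
        van[OF D(3) A0(1)] van[OF D(3) A(1)] van[OF D(3) A(3)] van[OF D(3) A(4)]
        van[OF D(4) A0(1)] van[OF D(4) A(2)] van[OF D(4) A(3)] van[OF D(4) A(4)]) simp_all
  have "(x * p * q * ?f2) ^ 4 * mock_gf = fps_X ^ 8 * ((p * q) ^ 4 * (?f2 ^ 4 * mock_gf))"
    by (simp add: x_def power_mult_distrib mult_ac flip: power_mult)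
  then have v16: "fps_vanish5 16 (fps_X ^ 8 * ((p * q) ^ 4 * (?f2 ^ 4 * mock_gf)))" using vG by (simp only:)
  \<comment> \<open>The factor \<open>fps_X ^ 8\<close> moves class 3 to 11, which is congruent to
    16.\<close>
  have "((p * q) ^ 4 * (?f2 ^ 4 * mock_gf)) $ n = 0" if "n mod 5 = 3 mod 5" for n
  proof -
    have "(8 + n) mod 5 = (8 + 3) mod 5" by (rule mod_add_cong[OF refl that])
    then have "(8 + n) mod 5 = 16 mod 5" by simp
    then have "(fps_X ^ 8 * ((p * q) ^ 4 * (?f2 ^ 4 * mock_gf))) $ (8 + n) = 0"
      using v16 by (simp only: fps_vanish5_def)
    then show ?thesis by (simp add: fps_X_power_mult_nth)
  qed
  then have "fps_vanish5 3 ((p * q) ^ 4 * (?f2 ^ 4 * mock_gf))" by (simp only: fps_vanish5_def) blast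
  then have v: "fps_vanish5 3 (?f2 ^ 4 * mock_gf)"
  proof (rule fps_vanish5_cancel[rotated 2])
    show "fps_supp5 0 ((p * q) ^ 4)" by (intro supp0)
    show "(p * q) ^ 4 $ 0 \<noteq> 0" by (simp add: p_def q_def fps_power_zeroth)
  qed
  have "?f2 ^ 5 * (inverse ?f2 * mock_gf) = (?f2 * inverse ?f2) * (?f2 ^ 4 * mock_gf)"
    by (simp add: power_numeral_reduce mult_ac)
  also have "\<dots> = ?f2 ^ 4 * mock_gf" by simp
  finally have "fps_vanish5 3 (?f2 ^ 5 * (inverse ?f2 * mock_gf))" using v by (simp only:)
  then show ?thesis
    by (rule fps_vanish5_cancel[rotated 2]) (auto intro: fps_supp5_power5[OF five] simp: fps_power_zeroth)
qed

lemma spt_omega_char_5: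
  assumes five: "(5 :: 'a::field) = 0"
  shows "of_nat (spt_omega (5 * n + 3)) = (0 :: 'a)"
proof -
  let ?f2 = "qprod {k. even k} :: 'a fps"
  have "spt_omega_gf = (inverse ?f2 * ?f2) * spt_omega_gf" by simp
  also have "\<dots> = inverse ?f2 * divisor_gf + inverse ?f2 * mock_gf"
    by (simp only: mult.assoc spt_omega_gf distrib_left)
  finally have "fps_vanish5 3 (spt_omega_gf :: 'a fps)"
    using fps_vanish5_add[OF divisor_part_vanishes[OF five] mock_part_vanishes[OF five]] by simp
  then have "(spt_omega_gf :: 'a fps) $ (5 * n + 3) = 0" by (simp add: fps_vanish5_def)
  then show ?thesis by (simp add: spt_omega_gf_def)
qed

subsection \<open>A field of characteristic 5\<close>

text \<open>\<open>mod_ring\<close> takes its modulus from the cardinality of its type argument, so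
  a type with five elements yields the field of order 5.\<close>

typedef five = "{..<5 :: nat}" by (rule exI[of _ 0]) simp

lemma card_five: "CARD(five) = 5"
  using type_definition.card[OF type_definition_five] by simp

instance five :: prime_card
  by standard (simp add: card_five)

theorem theorem6p2:
  fixes n :: nat
  shows "[spt_omega (5 * n + 3) = 0] (mod 5)"
proof -
  have char: "CHAR(five mod_ring) = 5" by (simp add: card_five)
  have "(5 :: five mod_ring) = 0"
    using of_nat_eq_0_iff_char_dvd[of 5, where ?'a = "five mod_ring"] unfolding char by simp
  then have "of_nat (spt_omega (5 * n + 3)) = (0 :: five mod_ring)" by (rule spt_omega_char_5)
  then have "5 dvd spt_omega (5 * n + 3)" unfolding of_nat_eq_0_iff_char_dvd char .
  then show ?thesis by (simp add: cong_0_iff)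
qed

end
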